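(* Assume that $(\bar t,\bar y(\cdot),\bar u(\cdot))$ is an optimal classical triple of the blowup time optimal control Problem (BT) described in the context. Then there exists a nontrivial solution $\bar\psi(\cdot)\in C([0,\bar t);\mathbb R^n)$ of $$\frac{d\bar\psi(t)}{dt}=-|\bar y(t)|^{p-1}\Big(I+(p-1)\frac{\bar y(t)\bar y(t)^\top}{|\bar y(t)|^2}\Big)\bar\psi(t),\qquad t\in[0,\bar t),$$ such that $$\langle\bar\psi(t),B(t)\bar u(t)\rangle=\max_{u\in U}\langle\bar\psi(t),B(t)u\rangle\qquad\text{for a.e. }t\in[0,\bar t).$$ Moreover, $$\lim_{t\to\bar t^-}\bar\psi(t)=0.$$
   Context: Let $n\ge1$, $m\ge1$ be integers, $p>1$, $\rho_0>0$, $y_0\in\mathbb R^n$, $U=\{u\in\mathbb R^m:|u|\le\rho_0\}$ and $B(\cdot)\in L^\infty([0,+\infty);\mathbb R^{n\times m})$. The controlled system is $$\frac{dy(t)}{dt}=|y(t)|^{p-1}y(t)+B(t)u(t),\quad t\ge0,\qquad y(0)=y_0.$$ $\mathcal U$ is the set of measurable $u(\cdot):[0,+\infty)\to U$. $\mathcal P$ is the set of triples $(T,y(\cdot),u(\cdot))\in(0,+\infty)\times C([0,T);\mathbb R^n)\times\mathcal U$ such that the system holds (in integral form) on $[0,T)$. $\mathcal P_{ad}$ is the set of $(T,y(\cdot),u(\cdot))\in\mathcal P$ with $\lim_{t\to T^-}|y(t)|=+\infty$. Problem (BT): find $(\bar t,\bar y(\cdot),\bar u(\cdot))\in\mathcal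 P_{ad}$ with $\bar t=\inf\{T:(T,y(\cdot),u(\cdot))\in\mathcal P_{ad}\}$; such a triple is called an optimal classical triple. The matrix $|y|^{p-1}\big(I+(p-1)\frac{yy^\top}{|y|^2}\big)$ is the Jacobian of $y\mapsto|y|^{p-1}y$ and is understood to be $0$ when $y=0$. *)

theory Defs
  imports "HOL-Analysis.Analysis"
begin

definition essentially_bounded_on :: "real set \<Rightarrow> (real \<Rightarrow> 'a::euclidean_space) \<Rightarrow> bool" where
  "essentially_bounded_on S f \<longleftrightarrow>
     f \<in> borel_measurable (lebesgue_on S) \<and> (\<exists>C. AE t in lebesgue_on S. norm (f t) \<le> C)"

definition control_set :: "real \<Rightarrow> (real^'m) set" where
  "control_set \<rho>0 = {u. norm u \<le> \<rho>0}"

text \<open>Functions on an interval are modelled by total functions; only their values on that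
  interval are constrained, so several triples below can stand for the same mathematical triple.\<close>

definition admissible_controls :: "real \<Rightarrow> (real \<Rightarrow> real^'m) set" where
  "admissible_controls \<rho>0 =
     {u. u \<in> borel_measurable (lebesgue_on {0..}) \<and> (\<forall>t\<ge>0. u t \<in> control_set \<rho>0)}"

text \<open>For essentially bounded \<open>B\<close>, the integrand in the following definition is measurable and
  essentially bounded on \<open>{0..t}\<close>, so that the gauge integral is the Lebesgue integral.\<close>

definition trajectories ::
  "real \<Rightarrow> real \<Rightarrow> real^'n \<Rightarrow> (real \<Rightarrow> real^'m^'n)
     \<Rightarrow> (real \<times> (real \<Rightarrow> real^'n) \<times> (real \<Rightarrow> real^'m)) set" where
  "trajectories p \<rho>0 y0 B =
     {(T, y, u). 0 < T \<and> continuous_on {0..<T} y \<and> u \<in> admissible_controls \<rho>0 \<and>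
        (\<forall>t\<in>{0..<T}.
           ((\<lambda>s. (norm (y s) powr (p - 1)) *\<^sub>R y s + B s *v u s) has_integral (y t - y0)) {0..t})}"

definition blowup_trajectories ::
  "real \<Rightarrow> real \<Rightarrow> real^'n \<Rightarrow> (real \<Rightarrow> real^'m^'n)
     \<Rightarrow> (real \<times> (real \<Rightarrow> real^'n) \<times> (real \<Rightarrow> real^'m)) set" where
  "blowup_trajectories p \<rho>0 y0 B =
     {(T, y, u). (T, y, u) \<in> trajectories p \<rho>0 y0 B \<and>
        filterlim (\<lambda>t. norm (y t)) at_top (at_left T)}"

definition optimal_classical_triple ::
  "real \<Rightarrow> real \<Rightarrow> real^'n \<Rightarrow> (real \<Rightarrow> real^'m^'n)
     \<Rightarrow> real \<times> (real \<Rightarrow> real^'n) \<times> (real \<Rightarrow> real^'m) \<Rightarrow> bool" where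
  "optimal_classical_triple p \<rho>0 y0 B z \<longleftrightarrow>
     z \<in> blowup_trajectories p \<rho>0 y0 B \<and>
     fst z = Inf {T. \<exists>y u. (T, y, u) \<in> blowup_trajectories p \<rho>0 y0 B}"

definition blowup_jacobian :: "real \<Rightarrow> real^'n \<Rightarrow> real^'n^'n" where
  "blowup_jacobian p y =
     (if y = 0 then 0
      else (norm y powr (p - 1)) *\<^sub>R
             (mat 1 + ((p - 1) / (norm y)\<^sup>2) *\<^sub>R (\<chi> i j. y $ i * y $ j)))"

text \<open>The coefficient of the adjoint equation is continuous on \<open>{0..<T}\<close>, so its solutions
  are classical ones, with a one-sided derivative at \<open>0\<close>.\<close>

definition adjoint_solution ::
  "real \<Rightarrow> real \<Rightarrow> (real \<Rightarrow> real^'n) \<Rightarrow> (real \<Rightarrow> real^'n) \<Rightarrow> bool" where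
  "adjoint_solution p T y \<psi> \<longleftrightarrow>
     continuous_on {0..<T} \<psi> \<and>
     (\<forall>t\<in>{0..<T}.
        (\<psi> has_vector_derivative - (blowup_jacobian p (y t) *v \<psi> t)) (at t within {0..<T}))"

end

theory Submission
  imports Defs
begin

text \<open>Write \<open>f(y) = |y|^(p-1) y\<close>, let \<open>J(y)\<close> be its derivative, \<open>T\<close> the minimal blow-up time, \<open>y\<close> the optimal
trajectory with control \<open>u\<close>, and \<open>\<psi>\<close> a solution of the adjoint equation along \<open>y\<close>. Since the control enters
linearly and \<open>U\<close> is convex, it is enough to vary the control along segments: \<open>u + \<theta>(v - u)\<close>, where
\<open>v = u\<close> after some time \<open>s < T\<close>. Minimality of \<open>T\<close> forces the perturbed trajectory \<open>z\<close> to exist on all of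
\<open>[0,T)\<close>, because a trajectory that cannot be continued blows up in norm (\<open>solution_until_blowup\<close>).

The pairing \<open>m = \<langle>\<psi>, z - y\<rangle>\<close> has derivative \<open>\<langle>\<psi>, f(z) - f(y) - J(y)(z - y)\<rangle> + \<theta>\<langle>\<psi>, B(v - u)\<rangle>\<close>. On \<open>[0,s]\<close> the first
term is \<open>o(\<theta>)\<close>, so if \<open>\<integral>\<langle>\<psi>, B(v - u)\<rangle>\<close> were positive, then \<open>m(s) > 0\<close> for small \<open>\<theta>\<close>. After \<open>s\<close> the second term
vanishes, and the first is nonnegative because \<open>x \<mapsto> \<langle>\<psi>, f(x)\<rangle>\<close> is convex in a narrow cone around \<open>\<psi>\<close>
(\<open>power_field_convex_in_cone\<close>), provided that \<open>\<psi>\<close>, \<open>y\<close> and \<open>z\<close> stay close in direction. Hence \<open>m\<close> stays above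
a positive constant up to \<open>T\<close>. On the other hand all trajectories alive until \<open>T\<close> obey the same rate, so that
\<open>|z| \<le> const |y|\<close> (\<open>blowup_rate_comparison\<close>), and \<open>|m| \<le> const |\<psi>||y|\<close>. If \<open>|\<psi>||y| \<rightarrow> 0\<close>, this is a contradiction
(\<open>pairing_nonpos\<close>). So \<open>\<integral>\<langle>\<psi>, B(v - u)\<rangle> \<le> 0\<close> for every \<open>v\<close> (\<open>first_order_condition\<close>), and the choice of
\<open>v\<close> as the pointwise maximizer turns this into the maximum condition almost everywhere.

It remains to find a \<open>\<psi>\<close> with the required direction and decay. Once \<open>|y|\<close> is large, its direction hardly moves
any more, say it stays near a unit vector \<open>e\<close>. The adjoint equation damps the component of \<open>\<psi>\<close> along \<open>y\<close> faster
than the others, so backward in time \<open>\<psi>\<close> is drawn towards \<open>y\<close>, and a cone around \<open>e\<close> is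
invariant backward in time. Shooting backward from times close to \<open>T\<close> and using compactness of the unit sphere of
initial values yields a \<open>\<psi>\<close> that stays in the cone until \<open>T\<close> (\<open>costate_exists\<close>). In the cone, \<open>\<langle>\<psi>, y\<rangle> |y|^((p-1)/2)\<close>
is eventually nonincreasing, whence \<open>|\<psi>||y| \<rightarrow> 0\<close> and also \<open>\<psi> \<rightarrow> 0\<close> (\<open>costate_decay\<close>).

Trajectories are only Lipschitz on compact intervals, since the controls are merely measurable. All
differential inequalities are therefore stated for integrals of bounded measurable functions, for which a
chain rule is proved first.\<close>

section \<open>Primitives of bounded measurable functions and their chain rule\<close>

text \<open>The substitute for "\<open>x\<close> is differentiable with derivative \<open>h\<close>". Boundedness is required at every point of the
interval and not only almost everywhere, so that bounds on \<open>h\<close> can be used without exceptional sets.\<close>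

definition bounded_primitive ::
    "real \<Rightarrow> real \<Rightarrow> (real \<Rightarrow> 'a::euclidean_space) \<Rightarrow> (real \<Rightarrow> 'a) \<Rightarrow> bool" where
  "bounded_primitive a b h x \<longleftrightarrow>
     h \<in> borel_measurable (lebesgue_on {a..b}) \<and> (\<exists>C. \<forall>t\<in>{a..b}. norm (h t) \<le> C) \<and>
     (\<forall>t\<in>{a..b}. (h has_integral (x t - x a)) {a..t})"

lemma integrable_bounded_measurable:
  fixes h :: "real \<Rightarrow> 'a::euclidean_space"
  assumes "h \<in> borel_measurable (lebesgue_on {a..b})" "\<And>t. t \<in> {a..b} \<Longrightarrow> norm (h t) \<le> C"
  shows "h integrable_on {a..b}"
  by (rule measurable_bounded_by_integrable_imp_integrable[where g = "\<lambda>_. C"]) (use assms in auto)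

lemma bounded_primitive_measurable_sub:
  assumes "bounded_primitive a b h x" "{s..t} \<subseteq> {a..b}"
  shows "h \<in> borel_measurable (lebesgue_on {s..t})"
  using assms measurable_restrict_mono unfolding bounded_primitive_def by blast

lemma bounded_primitive_has_integral:
  assumes bp: "bounded_primitive a b h x" and st: "a \<le> s" "s \<le> t" "t \<le> b"
  shows "(h has_integral (x t - x s)) {s..t}"
proof -
  obtain C where C: "\<forall>t\<in>{a..b}. norm (h t) \<le> C"
    using bp unfolding bounded_primitive_def by blast
  have i: "(h has_integral (x s - x a)) {a..s}" "(h has_integral (x t - x a)) {a..t}"
    using bp st unfolding bounded_primitive_def by auto
  have "h integrable_on {s..t}"
    by (rule integrable_bounded_measurable[where C=C])
      (use bounded_primitive_measurable_sub[OF bp] C st in auto)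
  moreover have "integral {s..t} h = x t - x s"
    using Henstock_Kurzweil_Integration.integral_combine[of a s t h] i st
    by (auto simp: integral_unique has_integral_integrable algebra_simps)
  ultimately show ?thesis by (simp add: has_integral_integrable_integral)
qed

lemma bounded_primitive_subinterval:
  assumes bp: "bounded_primitive a b h x" and st: "a \<le> s" "t \<le> b"
  shows "bounded_primitive s t h x"
proof -
  have sub: "{s..t} \<subseteq> {a..b}" using st by auto
  show ?thesis
    unfolding bounded_primitive_def
    using bounded_primitive_measurable_sub[OF bp sub] bounded_primitive_has_integral[OF bp] bp sub st
    unfolding bounded_primitive_def by (auto; meson atLeastAtMost_iff order_trans)
qed

lemma bounded_primitive_lipschitz:
  assumes bp: "bounded_primitive a b h x"
  obtains C where "C \<ge> 0" "\<And>t. t \<in> {a..b} \<Longrightarrow> norm (h t) \<le> C"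
    "\<And>s t. s \<in> {a..b} \<Longrightarrow> t \<in> {a..b} \<Longrightarrow> norm (x t - x s) \<le> C * \<bar>t - s\<bar>"
proof -
  obtain C' where C': "\<forall>t\<in>{a..b}. norm (h t) \<le> C'"
    using bp unfolding bounded_primitive_def by blast
  define C where "C = max C' 0"
  have C: "C \<ge> 0" "\<forall>t\<in>{a..b}. norm (h t) \<le> C" using C' by (auto simp: C_def le_max_iff_disj)
  have *: "norm (x t - x s) \<le> C * (t - s)" if "a \<le> s" "s \<le> t" "t \<le> b" for s t
  proof -
    have "norm (x t - x s) \<le> C * measure lborel (cbox s t)"
      by (rule has_integral_bound[of C h]) (use bounded_primitive_has_integral[OF bp] C that in auto)
    then show ?thesis using that by simp
  qed
  show thesis
  proof (rule that[of C])
    fix s t assume st: "s \<in> {a..b}" "t \<in> {a..b}"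
    show "norm (x t - x s) \<le> C * \<bar>t - s\<bar>"
    proof (cases "s \<le> t")
      case True then show ?thesis using *[of s t] st by simp
    next
      case False then show ?thesis using *[of t s] st by (simp add: norm_minus_commute)
    qed
  qed (use C in auto)
qed

lemma bounded_primitive_continuous_on:
  assumes "bounded_primitive a b h x"
  shows "continuous_on {a..b} x"
proof -
  obtain C where C: "C \<ge> 0"
    "\<And>s t. s \<in> {a..b} \<Longrightarrow> t \<in> {a..b} \<Longrightarrow> norm (x t - x s) \<le> C * \<bar>t - s\<bar>"
    using bounded_primitive_lipschitz[OF assms] by metis
  have "C-lipschitz_on {a..b} x"
    by (rule lipschitz_onI) (use C in \<open>auto simp: dist_norm norm_minus_commute abs_minus_commute\<close>)
  then show ?thesis by (rule lipschitz_on_continuous_on)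
qed

lemma bounded_primitive_cong:
  assumes "bounded_primitive a b h x" "\<And>t. t \<in> {a..b} \<Longrightarrow> h t = k t" "\<And>t. t \<in> {a..b} \<Longrightarrow> x t = z t"
  shows "bounded_primitive a b k z"
proof -
  have "k \<in> borel_measurable (lebesgue_on {a..b})"
    using assms measurable_cong[of "lebesgue_on {a..b}" h k borel] unfolding bounded_primitive_def by auto
  moreover have "(k has_integral (z t - z a)) {a..t}" if "t \<in> {a..b}" for t
  proof -
    have "(h has_integral (x t - x a)) {a..t}" using assms(1) that unfolding bounded_primitive_def by auto
    then have "(k has_integral (x t - x a)) {a..t}"
      by (rule has_integral_eq[rotated]) (use assms(2) that in auto)
    then show ?thesis using assms(3) that by auto
  qed
  ultimately show ?thesis using assms(1,2) unfolding bounded_primitive_def by metis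
qed

text \<open>The error \<open>W(t) = \<phi>(x(t)) - \<integral> \<langle>G(x), h\<rangle>\<close> need not be compared with a derivative of \<open>x\<close>, which may fail to exist. It has
derivative 0 at every point: \<open>x\<close> is Lipschitz, so the first-order expansion of \<open>\<phi>\<close> at \<open>x(t)\<close> is exact up to
\<open>o(|s - t|)\<close>, and replacing \<open>G(x(r))\<close> by \<open>G(x(t))\<close> under the integral costs \<open>o(|s - t|)\<close> by continuity.\<close>

lemma bounded_primitive_chain:
  fixes x :: "real \<Rightarrow> 'a::euclidean_space" and \<phi> :: "'a \<Rightarrow> real" and G :: "'a \<Rightarrow> 'a"
  assumes bp: "bounded_primitive a b h x"
    and der: "\<And>t. t \<in> {a..b} \<Longrightarrow> (\<phi> has_derivative (\<lambda>v. G (x t) \<bullet> v)) (at (x t))"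
    and cont: "continuous_on {a..b} (\<lambda>t. G (x t))"
  shows "bounded_primitive a b (\<lambda>t. G (x t) \<bullet> h t) (\<lambda>t. \<phi> (x t))"
proof -
  obtain C where C: "C \<ge> 0" "\<And>t. t \<in> {a..b} \<Longrightarrow> norm (h t) \<le> C"
    and lip: "\<And>s t. s \<in> {a..b} \<Longrightarrow> t \<in> {a..b} \<Longrightarrow> norm (x t - x s) \<le> C * \<bar>t - s\<bar>"
    using bounded_primitive_lipschitz[OF bp] by metis
  define w where "w = (\<lambda>t. G (x t) \<bullet> h t)"
  have "compact ((\<lambda>t. G (x t)) ` {a..b})"
    by (rule compact_continuous_image[OF cont]) simp
  then obtain D where D: "\<And>t. t \<in> {a..b} \<Longrightarrow> norm (G (x t)) \<le> D"
    using compact_imp_bounded bounded_iff by (metis imageI)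
  have wm: "w \<in> borel_measurable (lebesgue_on {a..b})"
    unfolding w_def
    by (rule borel_measurable_inner)
      (use bp continuous_imp_measurable_on_sets_lebesgue[OF cont] in \<open>auto simp: bounded_primitive_def\<close>)
  have wb: "norm (w t) \<le> D * C" if "t \<in> {a..b}" for t
  proof -
    have "norm (w t) \<le> norm (G (x t)) * norm (h t)"
      unfolding w_def real_norm_def by (rule Cauchy_Schwarz_ineq2)
    also have "\<dots> \<le> D * C"
      by (rule mult_mono) (use D[OF that] C that norm_ge_zero order_trans in \<open>blast+\<close>)
    finally show ?thesis .
  qed
  have wi: "w integrable_on {s..t}" if "a \<le> s" "t \<le> b" for s t
    by (rule integrable_bounded_measurable[where C="D*C"])
      (use that wb measurable_restrict_mono[OF wm, of "{s..t}"] in auto)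
  define W where "W t = \<phi> (x t) - integral {a..t} w" for t
  \<comment> \<open>A null derivative at every point, not just almost everywhere, forces \<open>W\<close> to be constant.\<close>
  have W0: "(W has_derivative (\<lambda>_. 0)) (at t within {a..b})" if t: "t \<in> {a..b}" for t
    unfolding has_derivative_within_alt
  proof (intro conjI allI impI)
    show "bounded_linear (\<lambda>_::real. 0::real)" by simp
    fix e :: real assume e: "e > 0"
    define e' where "e' = e / (2 * (C + 1))"
    have e': "e' > 0" "2 * e' * C \<le> e" using e C(1)
      by (auto simp: e'_def field_simps)
    have "\<forall>\<^sub>F z in at (x t). norm (\<phi> z - \<phi> (x t) - G (x t) \<bullet> (z - x t)) \<le> e' * norm (z - x t)"
      using der[OF t] e'(1) unfolding has_derivative_within_alt2 by blast
    then obtain d1 where d1: "d1 > 0" "\<And>z. norm (z - x t) < d1 \<Longrightarrow>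
        norm (\<phi> z - \<phi> (x t) - G (x t) \<bullet> (z - x t)) \<le> e' * norm (z - x t)"
      unfolding eventually_at by (metis UNIV_I diff_self dist_norm inner_zero_right norm_zero mult_zero_right order_refl)
    obtain d2 where d2: "d2 > 0" "\<And>s. s \<in> {a..b} \<Longrightarrow> \<bar>s - t\<bar> < d2 \<Longrightarrow> norm (G (x s) - G (x t)) < e'"
      using cont t e'(1) unfolding continuous_on_iff dist_norm real_norm_def by meson
    define d where "d = min (d1 / (C + 1)) d2"
    have "d > 0" using d1 d2 C by (simp add: d_def)
    moreover have "norm (W s - W t - 0) \<le> e * norm (s - t)" if s: "s \<in> {a..b}" "norm (s - t) < d" for s
    proof -
      have "norm (x s - x t) \<le> C * \<bar>s - t\<bar>" using lip s t by blast
      also have "\<dots> \<le> (C+1) * \<bar>s - t\<bar>" by (simp add: mult_right_mono)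
      also have "\<dots> < d1" using s C(1) by (simp add: d_def field_simps)
      finally have "norm (\<phi> (x s) - \<phi> (x t) - G (x t) \<bullet> (x s - x t)) \<le> e' * norm (x s - x t)" by (rule d1(2))
      also have "\<dots> \<le> e' * (C * \<bar>s - t\<bar>)" using e' lip s t by (intro mult_left_mono) auto
      finally have A: "\<bar>\<phi> (x s) - \<phi> (x t) - G (x t) \<bullet> (x s - x t)\<bar> \<le> e' * C * \<bar>s - t\<bar>"
        by (simp add: mult.assoc)
      have B: "\<bar>G (x t) \<bullet> (x v - x u) - integral {u..v} w\<bar> \<le> e' * C * (v - u)"
        if uv: "a \<le> u" "u \<le> v" "v \<le> b" "\<And>r. r \<in> {u..v} \<Longrightarrow> \<bar>r - t\<bar> < d2" for u v
      proof -
        have "((\<lambda>r. G (x t) \<bullet> h r - w r) has_integral (G (x t) \<bullet> (x v - x u) - integral {u..v} w)) {u..v}"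
          using has_integral_linear[OF bounded_primitive_has_integral[OF bp uv(1-3)]
              bounded_linear_inner_right[of "G (x t)"]] wi[of u v] uv
          by (intro has_integral_diff) (auto simp: o_def has_integral_integrable_integral)
        then have I: "((\<lambda>r. G (x t) \<bullet> h r - w r) has_integral (G (x t) \<bullet> (x v - x u) - integral {u..v} w)) (cbox u v)"
          by simp
        have "norm (G (x t) \<bullet> h r - w r) \<le> e' * C" if "r \<in> cbox u v" for r
        proof -
          have r: "r \<in> {u..v}" using that by simp
          have "\<bar>G (x t) \<bullet> h r - w r\<bar> = \<bar>(G (x t) - G (x r)) \<bullet> h r\<bar>" by (simp add: w_def inner_diff_left)
          also have "\<dots> \<le> norm (G (x t) - G (x r)) * norm (h r)" by (rule Cauchy_Schwarz_ineq2)
          also have "\<dots> \<le> e' * C"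
            using d2(2)[of r] uv r C e' by (intro mult_mono) (auto simp: norm_minus_commute intro: less_imp_le)
          finally show ?thesis by simp
        qed
        then have "norm (G (x t) \<bullet> (x v - x u) - integral {u..v} w) \<le> (e' * C) * measure lborel (cbox u v)"
          using e' C by (intro has_integral_bound[OF _ I]) auto
        then show ?thesis using uv by simp
      qed
      have "\<bar>W s - W t\<bar> \<le> 2 * e' * C * \<bar>s - t\<bar>"
      proof (cases "t \<le> s")
        case True
        have "\<bar>G (x t) \<bullet> (x s - x t) - integral {t..s} w\<bar> \<le> e' * C * (s - t)"
          by (rule B) (use True s t in \<open>auto simp: d_def\<close>)
        moreover have "integral {a..s} w = integral {a..t} w + integral {t..s} w"
          using Henstock_Kurzweil_Integration.integral_combine[of a t s w] wi[of a s] True s t by auto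
        ultimately show ?thesis using A True unfolding W_def by auto
      next
        case False
        have "\<bar>G (x t) \<bullet> (x t - x s) - integral {s..t} w\<bar> \<le> e' * C * (t - s)"
          by (rule B) (use False s t in \<open>auto simp: d_def\<close>)
        moreover have "integral {a..t} w = integral {a..s} w + integral {s..t} w"
          using Henstock_Kurzweil_Integration.integral_combine[of a s t w] wi[of a t] False s t by auto
        ultimately show ?thesis using A False unfolding W_def by (auto simp: inner_diff_right)
      qed
      also have "\<dots> \<le> e * \<bar>s - t\<bar>" using e' by (intro mult_right_mono) auto
      finally show ?thesis by simp
    qed
    ultimately show "\<exists>d>0. \<forall>y\<in>{a..b}. norm (y - t) < d \<longrightarrow> norm (W y - W t - 0) \<le> e * norm (y - t)" by blast
  qed
  then obtain c where c: "\<And>t. t \<in> {a..b} \<Longrightarrow> W t = c"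
    using has_derivative_zero_constant[of "{a..b}" W] by auto
  have "(w has_integral (\<phi> (x t) - \<phi> (x a))) {a..t}" if "t \<in> {a..b}" for t
  proof -
    have "W t = W a" using c that by auto
    then have "integral {a..t} w = \<phi> (x t) - \<phi> (x a)" by (simp add: W_def)
    then show ?thesis using wi[of a t] that by (auto simp: has_integral_integrable_integral)
  qed
  then show ?thesis using wm wb unfolding bounded_primitive_def w_def[symmetric] by blast
qed

lemma bounded_primitive_continuousI:
  assumes c: "continuous_on {a..b} h"
    and "\<And>t. t \<in> {a..b} \<Longrightarrow> (h has_integral (x t - x a)) {a..t}"
  shows "bounded_primitive a b h x"
proof -
  have "bounded (h ` {a..b})" using compact_continuous_image[OF c] compact_imp_bounded by simp
  then obtain C where "\<forall>t\<in>{a..b}. norm (h t) \<le> C" unfolding bounded_iff by auto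
  moreover have "h \<in> borel_measurable (lebesgue_on {a..b})"
    using continuous_imp_measurable_on_sets_lebesgue[OF c] by simp
  ultimately show ?thesis using assms(2) unfolding bounded_primitive_def by blast
qed

lemma bounded_primitive_deriv:
  assumes "\<And>t. t \<in> {a..b} \<Longrightarrow> (x has_vector_derivative h t) (at t within {a..b})"
    and c: "continuous_on {a..b} h"
  shows "bounded_primitive a b h x"
proof (rule bounded_primitive_continuousI[OF c])
  fix t assume t: "t \<in> {a..b}"
  show "(h has_integral (x t - x a)) {a..t}"
  proof (rule fundamental_theorem_of_calculus)
    fix r assume "r \<in> {a..t}"
    then show "(x has_vector_derivative h r) (at r within {a..t})"
      using has_vector_derivative_within_subset[OF assms(1), of r "{a..t}"] t by auto
  qed (use t in auto)
qed

lemma bounded_primitive_diff: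
  assumes "bounded_primitive a b h x" "bounded_primitive a b k z"
  shows "bounded_primitive a b (\<lambda>t. h t - k t) (\<lambda>t. x t - z t)"
proof -
  obtain C D where CD: "\<forall>t\<in>{a..b}. norm (h t) \<le> C" "\<forall>t\<in>{a..b}. norm (k t) \<le> D"
    using assms unfolding bounded_primitive_def by blast
  have "\<forall>t\<in>{a..b}. norm (h t - k t) \<le> C + D"
    using CD by (metis add_mono norm_triangle_ineq4 order_trans)
  moreover have "((\<lambda>t. h t - k t) has_integral (x t - z t - (x a - z a))) {a..t}" if "t \<in> {a..b}" for t
    using has_integral_diff[of h "x t - x a" "{a..t}" k "z t - z a"] assms that
    unfolding bounded_primitive_def by (simp add: algebra_simps)
  moreover have "(\<lambda>t. h t - k t) \<in> borel_measurable (lebesgue_on {a..b})"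
    using assms unfolding bounded_primitive_def by (blast intro: borel_measurable_diff)
  ultimately show ?thesis unfolding bounded_primitive_def by blast
qed

lemma bounded_primitive_Pair:
  assumes "bounded_primitive a b h x" "bounded_primitive a b k z"
  shows "bounded_primitive a b (\<lambda>t. (h t, k t)) (\<lambda>t. (x t, z t))"
proof -
  obtain C D where CD: "\<forall>t\<in>{a..b}. norm (h t) \<le> C" "\<forall>t\<in>{a..b}. norm (k t) \<le> D"
    using assms unfolding bounded_primitive_def by blast
  have "\<forall>t\<in>{a..b}. norm (h t, k t) \<le> C + D"
    using CD by (metis add_mono norm_Pair_le order_trans)
  moreover have "((\<lambda>t. (h t, k t)) has_integral ((x t, z t) - (x a, z a))) {a..t}" if "t \<in> {a..b}" for t
  proof -
    have i: "(h has_integral (x t - x a)) {a..t}" "(k has_integral (z t - z a)) {a..t}"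
      using assms that unfolding bounded_primitive_def by auto
    have "bounded_linear (\<lambda>v::'a. (v, 0::'b))" "bounded_linear (\<lambda>v::'b. (0::'a, v))"
      by (intro bounded_linear_Pair bounded_linear_ident bounded_linear_zero)+
    then have "((\<lambda>t. (h t, 0) + (0, k t)) has_integral ((x t - x a, 0) + (0, z t - z a))) {a..t}"
      using has_integral_add[OF has_integral_linear[OF i(1)] has_integral_linear[OF i(2)]]
      by (fastforce simp: o_def)
    then show ?thesis by simp
  qed
  moreover have "(\<lambda>t. (h t, k t)) \<in> borel_measurable (lebesgue_on {a..b})"
    using assms unfolding bounded_primitive_def by (blast intro: borel_measurable_Pair)
  ultimately show ?thesis unfolding bounded_primitive_def by blast
qed

lemma bounded_primitive_inner:
  fixes x z :: "real \<Rightarrow> 'a::euclidean_space"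
  assumes "bounded_primitive a b h x" "bounded_primitive a b k z"
  shows "bounded_primitive a b (\<lambda>t. z t \<bullet> h t + x t \<bullet> k t) (\<lambda>t. x t \<bullet> z t)"
proof -
  have "bounded_primitive a b (\<lambda>t. (snd (x t, z t), fst (x t, z t)) \<bullet> (h t, k t))
      (\<lambda>t. fst (x t, z t) \<bullet> snd (x t, z t))"
  proof (rule bounded_primitive_chain[OF bounded_primitive_Pair[OF assms],
        where \<phi> = "\<lambda>w. fst w \<bullet> snd w" and G = "\<lambda>w. (snd w, fst w)"])
    show "continuous_on {a..b} (\<lambda>t. (snd (x t, z t), fst (x t, z t)))"
      using assms[THEN bounded_primitive_continuous_on] by (auto intro!: continuous_intros)
  qed (auto intro!: derivative_eq_intros simp: inner_commute inner_prod_def)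
  then show ?thesis by simp
qed

lemma bounded_primitive_mult:
  fixes x z :: "real \<Rightarrow> real"
  assumes "bounded_primitive a b h x" "bounded_primitive a b k z"
  shows "bounded_primitive a b (\<lambda>t. z t * h t + x t * k t) (\<lambda>t. x t * z t)"
  using bounded_primitive_inner[OF assms] by simp

lemma bounded_primitive_ge:
  fixes x :: "real \<Rightarrow> real"
  assumes "bounded_primitive a b h x" "a \<le> s" "s \<le> t" "t \<le> b" "\<And>r. r \<in> {s..t} \<Longrightarrow> c \<le> h r"
  shows "c * (t - s) \<le> x t - x s"
  using has_integral_le[OF has_integral_const_real bounded_primitive_has_integral[OF assms(1-4)], of c]
    assms by (simp add: mult.commute)

lemma bounded_primitive_le:
  fixes x :: "real \<Rightarrow> real"
  assumes "bounded_primitive a b h x" "a \<le> s" "s \<le> t" "t \<le> b" "\<And>r. r \<in> {s..t} \<Longrightarrow> h r \<le> c"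
  shows "x t - x s \<le> c * (t - s)"
  using has_integral_le[OF bounded_primitive_has_integral[OF assms(1-4)] has_integral_const_real, of c]
    assms by (simp add: mult.commute)

lemma bounded_primitive_scaleR:
  assumes "bounded_primitive a b h x"
  shows "bounded_primitive a b (\<lambda>t. c *\<^sub>R h t) (\<lambda>t. c *\<^sub>R x t)"
proof -
  obtain C where C: "\<forall>t\<in>{a..b}. norm (h t) \<le> C" using assms unfolding bounded_primitive_def by blast
  then have "\<forall>t\<in>{a..b}. norm (c *\<^sub>R h t) \<le> \<bar>c\<bar> * C" by (auto intro: mult_left_mono)
  moreover have "((\<lambda>t. c *\<^sub>R h t) has_integral (c *\<^sub>R x t - c *\<^sub>R x a)) {a..t}" if "t \<in> {a..b}" for t
    using has_integral_cmul[of h "x t - x a" "{a..t}" c] assms that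
    unfolding bounded_primitive_def by (simp add: scaleR_diff_right)
  moreover have "(\<lambda>t. c *\<^sub>R h t) \<in> borel_measurable (lebesgue_on {a..b})"
    using assms unfolding bounded_primitive_def by (auto intro: borel_measurable_scaleR)
  ultimately show ?thesis unfolding bounded_primitive_def by blast
qed

section \<open>Gronwall inequality, hitting times and a fixed point\<close>

text \<open>The affine form with an arbitrary nonzero rate serves for stability (positive rate) and, applied to \<open>-x\<close> with a
negative rate, for lower bounds.\<close>

lemma gronwall:
  fixes x :: "real \<Rightarrow> real"
  assumes bp: "bounded_primitive a b h x" and t: "t \<in> {a..b}" and \<alpha>: "\<alpha> \<noteq> 0"
    and le: "\<And>r. r \<in> {a..b} \<Longrightarrow> h r \<le> \<alpha> * x r + \<beta>"
  shows "x t + \<beta> / \<alpha> \<le> exp (\<alpha> * (t - a)) * (x a + \<beta> / \<alpha>)"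
proof -
  define e where "e r = exp (- \<alpha> * (r - a))" for r
  have e: "bounded_primitive a b (\<lambda>r. - \<alpha> * e r) e"
    unfolding e_def
    by (rule bounded_primitive_deriv)
      (auto intro!: derivative_eq_intros continuous_intros simp flip: has_real_derivative_iff_has_vector_derivative)
  have "bounded_primitive a b (\<lambda>r. 0) (\<lambda>r. - (\<beta> / \<alpha>))"
    unfolding bounded_primitive_def by auto
  then have c: "bounded_primitive a b h (\<lambda>r. x r + \<beta> / \<alpha>)"
    using bounded_primitive_diff[OF bp] by fastforce
  have "(x t + \<beta> / \<alpha>) * e t - (x a + \<beta> / \<alpha>) * e a \<le> 0 * (t - a)"
  proof (rule bounded_primitive_le[OF bounded_primitive_mult[OF c e]])
    fix r assume "r \<in> {a..t}"
    then have "h r \<le> \<alpha> * x r + \<beta>" using le t by auto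
    then have "e r * h r \<le> e r * (\<alpha> * x r + \<beta>)" by (simp add: e_def)
    then show "e r * h r + (x r + \<beta> / \<alpha>) * (- \<alpha> * e r) \<le> 0"
      using \<alpha> by (simp add: algebra_simps)
  qed (use t in auto)
  then have "(x t + \<beta> / \<alpha>) * e t \<le> x a + \<beta> / \<alpha>" by (simp add: e_def)
  then have "exp (\<alpha> * (t - a)) * ((x t + \<beta> / \<alpha>) * e t) \<le> exp (\<alpha> * (t - a)) * (x a + \<beta> / \<alpha>)" by simp
  moreover have "exp (\<alpha> * (t - a)) * e t = 1" by (simp add: e_def flip: exp_add)
  ultimately show ?thesis by (metis mult.left_commute mult.right_neutral)
qed

lemma first_hitting_time:
  fixes \<phi> :: "real \<Rightarrow> real"
  assumes c: "continuous_on {a..b} \<phi>" and "\<phi> a < c" and r: "r \<in> {a..b}" "c \<le> \<phi> r"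
  obtains \<tau> where "a < \<tau>" "\<tau> \<le> r" "\<phi> \<tau> = c" "\<And>s. a \<le> s \<Longrightarrow> s < \<tau> \<Longrightarrow> \<phi> s < c"
proof -
  define S where "S = {t \<in> {a..b}. c \<le> \<phi> t}"
  have "closed S" unfolding S_def
    using continuous_on_closed_Collect_le[of "{a..b}" "\<lambda>_. c" \<phi>] c by auto
  moreover have ne: "r \<in> S" "bdd_below S" using r by (auto simp: S_def intro: bdd_belowI[of _ a])
  ultimately have \<tau>: "Inf S \<in> S" using closed_contains_Inf by blast
  then have \<tau>': "Inf S \<in> {a..b}" "c \<le> \<phi> (Inf S)" by (auto simp: S_def)
  have low: "\<phi> s < c" if "a \<le> s" "s < Inf S" for s
  proof (rule ccontr)
    assume "\<not> \<phi> s < c"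
    then have "s \<in> S" using that \<tau>' by (auto simp: S_def)
    then show False using that(2) ne(2) cInf_lower by fastforce
  qed
  obtain s where s: "a \<le> s" "s \<le> Inf S" "\<phi> s = c"
    using IVT'[of \<phi> a c "Inf S"] \<tau>' assms(2) continuous_on_subset[OF c, of "{a..Inf S}"] by auto
  then have "\<phi> (Inf S) = c" using low by force
  then show thesis
    using that[of "Inf S"] low ne assms(2) \<tau>' cInf_lower by (metis atLeastAtMost_iff less_eq_real_def less_irrefl)
qed

lemma last_hitting_time:
  fixes \<phi> :: "real \<Rightarrow> real"
  assumes c: "continuous_on {a..b} \<phi>" and "c < \<phi> b" and r: "r \<in> {a..b}" "\<phi> r \<le> c"
  obtains \<tau> where "r \<le> \<tau>" "\<tau> < b" "\<phi> \<tau> = c" "\<And>s. \<tau> < s \<Longrightarrow> s \<le> b \<Longrightarrow> c < \<phi> s"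
proof -
  have "continuous_on {-b..-a} (\<lambda>t. - \<phi> (- t))"
    by (intro continuous_intros continuous_on_compose2[OF c]) auto
  then obtain \<tau> where \<tau>: "- b < \<tau>" "\<tau> \<le> - r" "- \<phi> (- \<tau>) = - c" "\<And>s. - b \<le> s \<Longrightarrow> s < \<tau> \<Longrightarrow> - \<phi> (- s) < - c"
    using first_hitting_time[of "-b" "-a" "\<lambda>t. - \<phi> (- t)" "- c" "- r"] assms by auto
  show thesis
  proof (rule that[of "- \<tau>"])
    fix s assume "- \<tau> < s" "s \<le> b"
    then show "c < \<phi> s" using \<tau>(4)[of "-s"] by auto
  qed (use \<tau> in auto)
qed

text \<open>In the unknown \<open>x(t) = exp(-2Lt) y(t)\<close> the integral operator contracts the supremum norm by the factor 1/2 on the whole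
interval, so no subdivision into short intervals is needed. The forcing \<open>G\<close> is only continuous; this is how
the integral of a measurable control enters.\<close>

lemma picard_global:
  fixes F :: "real \<Rightarrow> 'a::euclidean_space \<Rightarrow> 'a" and G :: "real \<Rightarrow> 'a"
  assumes b: "0 \<le> b" and F: "continuous_on ({0..b} \<times> UNIV) (\<lambda>w. F (fst w) (snd w))"
    and L: "0 < L" and lip: "\<And>t x y. t \<in> {0..b} \<Longrightarrow> norm (F t x - F t y) \<le> L * norm (x - y)"
    and G: "continuous_on {0..b} G"
  obtains y where "continuous_on {0..b} y"
    "\<And>t. t \<in> {0..b} \<Longrightarrow> ((\<lambda>s. F s (y s)) has_integral (y t - G t)) {0..t}"
proof -
  define cl where "cl t = max 0 (min t b)" for t
  have cl: "cl t \<in> {0..b}" for t using b by (auto simp: cl_def)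
  have cl_id: "cl t = t" if "t \<in> {0..b}" for t using that by (auto simp: cl_def)
  have clc: "continuous_on UNIV cl" unfolding cl_def by (intro continuous_intros)
  have Fc: "continuous_on {0..b} (\<lambda>s. F s (exp (2 * L * s) *\<^sub>R x s))" if "continuous_on {0..b} x" for x
  proof -
    have "continuous_on {0..b} (\<lambda>s. (s, exp (2 * L * s) *\<^sub>R x s))"
      by (intro continuous_intros that)
    from continuous_on_compose2[OF F this] show ?thesis by auto
  qed
  have Fi: "(\<lambda>s. F s (exp (2 * L * s) *\<^sub>R x s)) integrable_on {0..t}" if "continuous_on {0..b} x" "t \<in> {0..b}" for x t
    by (rule integrable_continuous_real[OF continuous_on_subset[OF Fc[OF that(1)]]]) (use that in auto)
  define H where "H x \<tau> = exp (- (2 * L * \<tau>)) *\<^sub>R (G \<tau> + integral {0..\<tau>} (\<lambda>s. F s (exp (2 * L * s) *\<^sub>R x s)))" for x \<tau>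
  have Hc: "continuous_on {0..b} (H x)" if "continuous_on {0..b} x" for x
    unfolding H_def
    by (intro continuous_intros G indefinite_integral_continuous_1 Fi that) (use b in auto)
  define Op where "Op (x :: real \<Rightarrow>\<^sub>C 'a) = Bcontfun (\<lambda>t. H (apply_bcontfun x) (cl t))" for x
  have xc: "continuous_on S (apply_bcontfun x)" for S and x :: "real \<Rightarrow>\<^sub>C 'a"
    using apply_bcontfun[of x] unfolding bcontfun_def by (auto intro: continuous_on_subset)
  have Op: "apply_bcontfun (Op x) t = H (apply_bcontfun x) (cl t)" for x t
  proof -
    have "range (\<lambda>t. H (apply_bcontfun x) (cl t)) \<subseteq> H (apply_bcontfun x) ` {0..b}" using cl by auto
    moreover have "bounded (H (apply_bcontfun x) ` {0..b})"
      by (intro compact_imp_bounded compact_continuous_image Hc xc) auto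
    ultimately have "(\<lambda>t. H (apply_bcontfun x) (cl t)) \<in> bcontfun"
      unfolding bcontfun_def
      using bounded_subset continuous_on_compose2[OF Hc[OF xc[of _ x]] clc] cl by blast
    then show ?thesis unfolding Op_def by (simp add: Bcontfun_inverse)
  qed
  have "dist (Op x) (Op z) \<le> 1/2 * dist x z" for x z
  proof (rule dist_bound)
    fix t
    define \<tau> where "\<tau> = cl t"
    have \<tau>: "\<tau> \<in> {0..b}" using cl by (simp add: \<tau>_def)
    let ?f = "\<lambda>x s. F s (exp (2 * L * s) *\<^sub>R apply_bcontfun x s)"
    have I: "((\<lambda>s. L * exp (2 * L * s) * dist x z) has_integral (exp (2 * L * \<tau>) * dist x z / 2 - exp (2 * L * 0) * dist x z / 2)) {0..\<tau>}"
      using \<tau> L by (intro fundamental_theorem_of_calculus)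
        (auto intro!: derivative_eq_intros simp flip: has_real_derivative_iff_has_vector_derivative)
    have "norm (integral {0..\<tau>} (\<lambda>s. ?f x s - ?f z s)) \<le> integral {0..\<tau>} (\<lambda>s. L * exp (2 * L * s) * dist x z)"
    proof (rule integral_norm_bound_integral)
      show "(\<lambda>s. ?f x s - ?f z s) integrable_on {0..\<tau>}"
        by (intro integrable_diff Fi xc \<tau>)
      show "(\<lambda>s. L * exp (2 * L * s) * dist x z) integrable_on {0..\<tau>}" using I by blast
      fix s assume s: "s \<in> {0..\<tau>}"
      have "norm (?f x s - ?f z s) \<le> L * norm (exp (2 * L * s) *\<^sub>R apply_bcontfun x s - exp (2 * L * s) *\<^sub>R apply_bcontfun z s)"
        by (rule lip) (use s \<tau> in auto)
      also have "\<dots> = L * exp (2 * L * s) * dist (apply_bcontfun x s) (apply_bcontfun z s)"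
        by (simp add: dist_norm flip: scaleR_diff_right)
      also have "\<dots> \<le> L * exp (2 * L * s) * dist x z"
        using L by (intro mult_left_mono dist_bounded) auto
      finally show "norm (?f x s - ?f z s) \<le> L * exp (2 * L * s) * dist x z" .
    qed
    also have "\<dots> \<le> exp (2 * L * \<tau>) * (dist x z / 2)" using integral_unique[OF I] by simp
    finally have A: "norm (integral {0..\<tau>} (?f x) - integral {0..\<tau>} (?f z)) \<le> exp (2 * L * \<tau>) * (dist x z / 2)"
      using integral_diff[OF Fi Fi, OF xc \<tau> xc \<tau>, of x z] by simp
    have "dist (apply_bcontfun (Op x) t) (apply_bcontfun (Op z) t)
        = exp (- (2 * L * \<tau>)) * norm (integral {0..\<tau>} (?f x) - integral {0..\<tau>} (?f z))"
      unfolding Op H_def \<tau>_def[symmetric] dist_norm by (simp flip: scaleR_diff_right)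
    also have "\<dots> \<le> exp (- (2 * L * \<tau>)) * (exp (2 * L * \<tau>) * (dist x z / 2))"
      using A by (intro mult_left_mono) auto
    also have "\<dots> = 1/2 * dist x z" by (simp add: mult.assoc[symmetric] flip: exp_add)
    finally show "dist (apply_bcontfun (Op x) t) (apply_bcontfun (Op z) t) \<le> 1/2 * dist x z" .
  qed
  then obtain x where x: "Op x = x"
    using banach_fix_type[of "1/2" Op] by auto
  define y where "y t = exp (2 * L * t) *\<^sub>R apply_bcontfun x t" for t
  show thesis
  proof (rule that[of y])
    show "continuous_on {0..b} y" unfolding y_def by (intro continuous_intros xc)
    fix t assume t: "t \<in> {0..b}"
    have "apply_bcontfun x t = H (apply_bcontfun x) t" using Op[of x t] x cl_id[OF t] by simp
    then have "y t = G t + integral {0..t} (\<lambda>s. F s (y s))"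
      by (simp add: y_def H_def flip: exp_add)
    then show "((\<lambda>s. F s (y s)) has_integral (y t - G t)) {0..t}"
      using Fi[OF xc t, of x] by (simp add: y_def has_integral_integrable_integral)
  qed
qed

text \<open>Uniqueness makes the solutions on the intervals \<open>[0,b]\<close> agree, so the value at \<open>t\<close> may be read off from
the solution on \<open>[0,t]\<close>.\<close>

lemma glue_solutions:
  fixes P :: "real \<Rightarrow> (real \<Rightarrow> 'a) \<Rightarrow> bool"
  assumes ex: "\<And>b. 0 \<le> b \<Longrightarrow> b < T \<Longrightarrow> \<exists>y. P b y"
    and restr: "\<And>a b y. 0 \<le> a \<Longrightarrow> a \<le> b \<Longrightarrow> P b y \<Longrightarrow> P a y"
    and uniq: "\<And>b y z t. P b y \<Longrightarrow> P b z \<Longrightarrow> t \<in> {0..b} \<Longrightarrow> y t = z t"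
    and cong: "\<And>b y z. P b y \<Longrightarrow> (\<And>t. t \<in> {0..b} \<Longrightarrow> y t = z t) \<Longrightarrow> P b z"
  shows "\<exists>y. \<forall>b. 0 \<le> b \<longrightarrow> b < T \<longrightarrow> P b y"
proof -
  define Y where "Y b = (SOME y. P b y)" for b
  have Y: "P b (Y b)" if "0 \<le> b" "b < T" for b
    unfolding Y_def using ex[OF that] by (rule someI_ex)
  show ?thesis
  proof (intro exI[of _ "\<lambda>t. Y t t"] allI impI)
    fix b assume b: "0 \<le> b" "b < T"
    show "P b (\<lambda>t. Y t t)"
    proof (rule cong[OF Y[OF b]])
      fix t assume t: "t \<in> {0..b}"
      show "Y b t = Y t t"
        by (rule uniq[of t]) (use t b Y restr in auto)
    qed
  qed
qed

section \<open>The power field and its Jacobian\<close>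

definition power_field :: "real \<Rightarrow> 'a::euclidean_space \<Rightarrow> 'a" where
  "power_field p y = (norm y powr (p - 1)) *\<^sub>R y"

text \<open>The matrix \<open>|y|^(p-1) (I + (p-1) y y^T / |y|^2)\<close> applied to \<open>v\<close>. With \<open>|y|^(p-3)\<close> as factor and \<open>0 powr q = 0\<close>, the value at
\<open>y = 0\<close> is 0 without a case distinction.\<close>

definition power_jacobian :: "real \<Rightarrow> 'a::euclidean_space \<Rightarrow> 'a \<Rightarrow> 'a" where
  "power_jacobian p y v = (norm y powr (p - 1)) *\<^sub>R v + ((p - 1) * norm y powr (p - 3) * (y \<bullet> v)) *\<^sub>R y"

lemma power_jacobian_sym: "power_jacobian p y v \<bullet> w = v \<bullet> power_jacobian p y w"
  by (simp add: power_jacobian_def inner_add_left inner_add_right inner_commute algebra_simps)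

lemma power_jacobian_linear: "bounded_linear (power_jacobian p y)"
  unfolding power_jacobian_def
  by (intro bounded_linear_add bounded_linear_scaleR_right bounded_linear_scaleR_const bounded_linear_const_mult bounded_linear_inner_right)

lemma norm_powr_split: "norm (y::'a::real_normed_vector) powr (p - 3) * norm y * norm y = norm y powr (p - 1)"
proof (cases "y = 0")
  case False
  then have "norm y powr (p - 3) * norm y powr 1 * norm y powr 1 = norm y powr (p - 1)"
    by (simp only: flip: powr_add) simp
  then show ?thesis using False by simp
qed simp

lemma norm_power_jacobian_le:
  assumes "p \<ge> 1"
  shows "norm (power_jacobian p y v) \<le> p * norm y powr (p - 1) * norm v"
proof -
  have "norm (power_jacobian p y v) \<le> norm y powr (p - 1) * norm v + (p - 1) * norm y powr (p - 3) * \<bar>y \<bullet> v\<bar> * norm y"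
    unfolding power_jacobian_def using assms by (intro norm_triangle_le) (simp add: abs_mult)
  also have "\<dots> \<le> norm y powr (p - 1) * norm v + (p - 1) * norm y powr (p - 3) * (norm y * norm v) * norm y"
    using assms by (intro add_left_mono mult_right_mono mult_left_mono Cauchy_Schwarz_ineq2) auto
  also have "\<dots> = norm y powr (p - 1) * norm v + (p - 1) * (norm y powr (p - 3) * norm y * norm y) * norm v" by simp
  also have "\<dots> = p * norm y powr (p - 1) * norm v" by (simp only: norm_powr_split) (simp add: algebra_simps)
  finally show ?thesis .
qed

lemma has_derivative_norm_powr:
  fixes y :: "'a::euclidean_space"
  assumes "y \<noteq> 0"
  shows "((\<lambda>z. norm z powr q) has_derivative (\<lambda>v. ((q * norm y powr (q - 2)) *\<^sub>R y) \<bullet> v)) (at y)"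
proof -
  have "(norm has_derivative (\<lambda>v. v \<bullet> sgn y)) (at y)"
    using has_derivative_norm[OF assms] by (simp add: inner_commute)
  then have "((\<lambda>z. norm z powr q) has_derivative (\<lambda>v. (norm y powr q) * (0 * ln (norm y) + (v \<bullet> sgn y) * q / norm y))) (at y)"
    using assms by (intro has_derivative_powr has_derivative_const) auto
  moreover have "(norm y powr q) * (0 * ln (norm y) + (v \<bullet> sgn y) * q / norm y) = ((q * norm y powr (q - 2)) *\<^sub>R y) \<bullet> v" for v
  proof -
    have "norm y powr (q - 2) = norm y powr q / (norm y * norm y)"
      using assms by (simp add: powr_diff power2_eq_square)
    then show ?thesis by (simp add: sgn_div_norm inner_commute divide_inverse)
  qed
  ultimately show ?thesis by simp
qed

lemma power_field_has_derivative:
  assumes "p > 1"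
  shows "(power_field p has_derivative power_jacobian p y) (at y)"
proof (cases "y = 0")
  case False
  have "((\<lambda>z. (norm z powr (p - 1)) *\<^sub>R z) has_derivative
     (\<lambda>v. norm y powr (p - 1) *\<^sub>R v + (((p - 1) * norm y powr (p - 1 - 2)) *\<^sub>R y \<bullet> v) *\<^sub>R y)) (at y)"
    by (rule has_derivative_scaleR[OF has_derivative_norm_powr[OF False] has_derivative_ident])
  then show ?thesis
    unfolding power_field_def[abs_def] power_jacobian_def[abs_def] by (simp add: algebra_simps)
next
  case True
  have "((\<lambda>z::'a. norm (power_field p z) / norm z) \<longlongrightarrow> 0) (at 0)"
  proof (rule Lim_transform_eventually)
    have "((\<lambda>z::'a. norm z powr (p - 1)) \<longlongrightarrow> 0 powr (p - 1)) (at 0)"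
      using assms by (intro tendsto_powr2 tendsto_norm_zero tendsto_const) auto
    then show "((\<lambda>z::'a. norm z powr (p - 1)) \<longlongrightarrow> 0) (at 0)" by simp
    show "\<forall>\<^sub>F z::'a in at 0. norm z powr (p - 1) = norm (power_field p z) / norm z"
      by (auto simp: power_field_def eventually_at intro!: exI[of _ 1])
  qed
  then show ?thesis
    using True by (simp add: has_derivative_at power_jacobian_def[abs_def] power_field_def)
qed

lemma continuous_norm_powr_left:
  assumes "q > 0"
  shows "continuous_on UNIV (\<lambda>y::'a::real_normed_vector. norm y powr q)"
  using assms by (intro continuous_on_powr' continuous_intros) auto

lemma continuous_power_jacobian:
  assumes p: "p > 1"
  shows "continuous_on UNIV (\<lambda>w :: 'a::euclidean_space \<times> 'a. power_jacobian p (fst w) (snd w))"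
  unfolding continuous_on_eq_continuous_at[OF open_UNIV]
proof (intro ballI)
  fix w :: "'a \<times> 'a"
  show "isCont (\<lambda>w. power_jacobian p (fst w) (snd w)) w"
  proof (cases "fst w = 0")
    case False
    then show ?thesis
      unfolding power_jacobian_def by (intro continuous_intros) auto
  next
    case True
    have "((\<lambda>w::'a\<times>'a. p * norm (fst w) powr (p - 1) * norm (snd w)) \<longlongrightarrow> p * norm (fst w) powr (p - 1) * norm (snd w)) (at w)"
      using p by (intro tendsto_intros tendsto_powr2) (auto simp: isCont_def)
    then have "((\<lambda>w::'a\<times>'a. p * norm (fst w) powr (p - 1) * norm (snd w)) \<longlongrightarrow> 0) (at w)"
      using True by simp
    then have "((\<lambda>w::'a\<times>'a. power_jacobian p (fst w) (snd w)) \<longlongrightarrow> 0) (at w)"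
      by (rule Lim_null_comparison[rotated]) (intro always_eventually allI norm_power_jacobian_le, use p in simp)
    then show ?thesis using True by (simp add: isCont_def power_jacobian_def)
  qed
qed

lemma power_field_lipschitz_ball:
  fixes x y :: "'a::euclidean_space"
  assumes p: "p > 1" and "norm x \<le> R" "norm y \<le> R"
  shows "norm (power_field p x - power_field p y) \<le> p * R powr (p - 1) * norm (x - y)"
proof (rule differentiable_bound[of "cball 0 R" "power_field p" "power_jacobian p"])
  fix z :: 'a assume "z \<in> cball 0 R"
  then have "norm z powr (p - 1) \<le> R powr (p - 1)" using p by (auto intro: powr_mono2)
  then have "p * norm z powr (p - 1) * norm v \<le> p * R powr (p - 1) * norm v" for v :: 'a
    using p by (intro mult_right_mono mult_left_mono) auto
  then show "onorm (power_jacobian p z) \<le> p * R powr (p - 1)"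
    using norm_power_jacobian_le[of p z, THEN order_trans] p by (intro onorm_bound) auto
qed (use assms has_derivative_at_withinI[OF power_field_has_derivative[OF p]] in auto)

text \<open>Uniform differentiability on balls: \<open>J\<close> is uniformly continuous on compact sets, also at the origin, where
\<open>p > 1\<close> makes it continuous.\<close>

lemma power_field_linearization:
  fixes R \<epsilon> :: real
  assumes p: "p > 1" and \<epsilon>: "\<epsilon> > 0"
  obtains \<delta> where "\<delta> > 0"
    "\<And>x y :: 'a::euclidean_space. norm x \<le> R \<Longrightarrow> norm y \<le> R \<Longrightarrow> norm (x - y) < \<delta> \<Longrightarrow>
      norm (power_field p x - power_field p y - power_jacobian p y (x - y)) \<le> \<epsilon> * norm (x - y)"
proof -
  let ?S = "cball (0::'a) R \<times> cball (0::'a) 1"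
  have "uniformly_continuous_on ?S (\<lambda>w. power_jacobian p (fst w) (snd w))"
    by (intro compact_uniformly_continuous continuous_on_subset[OF continuous_power_jacobian[OF p]] compact_Times) auto
  then obtain \<delta> where \<delta>: "\<delta> > 0" "\<And>w w'. w \<in> ?S \<Longrightarrow> w' \<in> ?S \<Longrightarrow> dist w' w < \<delta> \<Longrightarrow>
      dist (power_jacobian p (fst w') (snd w')) (power_jacobian p (fst w) (snd w)) < \<epsilon>"
    using \<epsilon> unfolding uniformly_continuous_on_def by metis
  show thesis
  proof (rule that[OF \<delta>(1)])
    fix x y :: 'a assume xy: "norm x \<le> R" "norm y \<le> R" "norm (x - y) < \<delta>"
    let ?T = "cball 0 R \<inter> ball y \<delta>"
    have "norm (power_field p x - power_field p y - power_jacobian p y (x - y)) \<le> norm (x - y) * \<epsilon>"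
    proof (rule differentiable_bound_linearization[of y x ?T "power_field p" "power_jacobian p" y])
      have "convex ?T" by (intro convex_Int convex_cball convex_ball)
      then have "closed_segment y x \<subseteq> ?T"
        using xy by (intro closed_segment_subset) (auto simp: dist_norm norm_minus_commute \<delta>)
      then show "y + t *\<^sub>R (x - y) \<in> ?T" if "t \<in> {0..1}" for t
      proof -
        have "y + t *\<^sub>R (x - y) \<in> closed_segment y x"
          using that unfolding closed_segment_def by (auto simp: algebra_simps intro!: exI[of _ t])
        then show ?thesis using \<open>closed_segment y x \<subseteq> ?T\<close> by blast
      qed
      fix z assume z: "z \<in> ?T"
      show "onorm (power_jacobian p z - power_jacobian p y) \<le> \<epsilon>"
        unfolding fun_diff_def
      proof (rule onorm_bound)
        fix v :: 'a
        interpret z: bounded_linear "power_jacobian p z" by (rule power_jacobian_linear)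
        interpret y: bounded_linear "power_jacobian p y" by (rule power_jacobian_linear)
        show "norm (power_jacobian p z v - power_jacobian p y v) \<le> \<epsilon> * norm v"
        proof (cases "v = 0")
          case False
          have "dist (power_jacobian p z (sgn v)) (power_jacobian p y (sgn v)) < \<epsilon>"
            using \<delta>(2)[of "(y, sgn v)" "(z, sgn v)"] z xy False
            by (auto simp: dist_Pair_Pair norm_sgn dist_commute)
          then have "norm v * norm (power_jacobian p z (sgn v) - power_jacobian p y (sgn v)) \<le> norm v * \<epsilon>"
            by (intro mult_left_mono) (auto simp: dist_norm)
          moreover have "norm v * norm (power_jacobian p z (sgn v) - power_jacobian p y (sgn v))
            = norm (power_jacobian p z v - power_jacobian p y v)"
            using False by (simp add: sgn_div_norm z.scaleR y.scaleR flip: scaleR_diff_right)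
          ultimately show ?thesis by (simp add: mult.commute)
        qed (simp add: z.zero y.zero)
      qed (use \<epsilon> in auto)
    qed (use xy \<delta> has_derivative_at_withinI[OF power_field_has_derivative[OF p]] in auto)
    then show "norm (power_field p x - power_field p y - power_jacobian p y (x - y)) \<le> \<epsilon> * norm (x - y)"
      by (simp add: mult.commute)
  qed
qed

lemma continuous_on_power_field:
  assumes "p > 1" "continuous_on S y"
  shows "continuous_on S (\<lambda>t. power_field p (y t))"
  unfolding power_field_def
  by (intro continuous_on_scaleR assms(2) continuous_on_compose2[OF continuous_norm_powr_left[of "p - 1"] assms(2)])
    (use assms in auto)

lemma continuous_on_power_jacobian:
  assumes "p > 1" "continuous_on S y" "continuous_on S \<psi>"
  shows "continuous_on S (\<lambda>t. power_jacobian p (y t) (\<psi> t))"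
  using continuous_on_compose2[OF continuous_power_jacobian[OF assms(1)] continuous_on_Pair[OF assms(2,3)]]
  by simp

lemma inner_power_field: "y \<bullet> power_field p y = norm y powr p * norm y"
proof (cases "y = 0")
  case False
  then have "norm y powr (p - 1) * norm y = norm y powr p"
    using powr_add[of "norm y" "p - 1" 1] by simp
  then show ?thesis by (simp add: power_field_def dot_square_norm power2_eq_square)
qed (simp add: power_field_def)

section \<open>Convexity of the power field in a cone\<close>

text \<open>A cosine of at least 39/40 to \<open>e\<close> means a distance of at most \<open>sqrt(1/20)\<close> between the unit vectors, so two such vectors
are at distance at most \<open>sqrt(1/5)\<close>. The value 9/10 is what the convexity of the power field needs below.\<close>

lemma inner_ge_of_common_cone:
  fixes u v e :: "'a::euclidean_space"
  assumes e: "norm e = 1" and u: "39/40 * norm u \<le> u \<bullet> e" and v: "39/40 * norm v \<le> v \<bullet> e"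
  shows "9/10 * (norm u * norm v) \<le> u \<bullet> v"
proof (cases "u = 0 \<or> v = 0")
  case False
  have *: "(norm (sgn x - e))\<^sup>2 \<le> 1/20" if "39/40 * norm x \<le> x \<bullet> e" "x \<noteq> 0" for x :: 'a
  proof -
    have "39/40 \<le> sgn x \<bullet> e" using that by (simp add: sgn_div_norm field_simps)
    moreover have "(norm (sgn x - e))\<^sup>2 = 2 - 2 * (sgn x \<bullet> e)"
      using e that dot_square_norm[of e] dot_square_norm[of "sgn x"]
      by (simp add: power2_norm_eq_inner inner_diff inner_commute norm_sgn)
    ultimately show ?thesis by simp
  qed
  have "norm (sgn u - sgn v) \<le> norm (sgn u - e) + norm (sgn v - e)"
    by (metis norm_minus_commute norm_triangle_sub norm_diff_triangle_le order_refl)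
  then have "(norm (sgn u - sgn v))\<^sup>2 \<le> (norm (sgn u - e) + norm (sgn v - e))\<^sup>2"
    by (intro power_mono) auto
  also have "\<dots> \<le> 2 * (norm (sgn u - e))\<^sup>2 + 2 * (norm (sgn v - e))\<^sup>2"
    using sum_squares_bound[of "norm (sgn u - e)" "norm (sgn v - e)"] by (simp add: power2_sum)
  also have "\<dots> \<le> 1/5" using *[OF u] *[OF v] False by auto
  finally have "9/10 \<le> sgn u \<bullet> sgn v"
    using False dot_square_norm[of "sgn u"] dot_square_norm[of "sgn v"]
    by (simp add: power2_norm_eq_inner inner_diff inner_commute norm_sgn)
  then have "9/10 * (norm u * norm v) \<le> (sgn u \<bullet> sgn v) * (norm u * norm v)"
    by (intro mult_right_mono) auto
  also have "\<dots> = u \<bullet> v" using False by (simp add: sgn_div_norm field_simps)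
  finally show ?thesis .
qed auto

text \<open>Up to the factor \<open>(p - 1) |z|^(p - 3)\<close> this is the second derivative of \<open>x \<mapsto> \<langle>\<psi>, f(x)\<rangle>\<close> at \<open>z\<close> in direction \<open>d\<close>. Since
\<open>p - 3 \<ge> -2\<close>, the indefinite part is at worst \<open>2 \<langle>z,d\<rangle> \<langle>w,d\<rangle>\<close>, where \<open>w\<close> is the component of \<open>\<psi>\<close> orthogonal to \<open>z\<close>, and the
cone condition makes \<open>w\<close> small enough for the positive part to absorb it.\<close>

lemma hessian_form_nonneg:
  fixes z \<psi> d :: "'a::euclidean_space"
  assumes z: "z \<noteq> 0" and p: "p > 1" and cone: "9/10 * (norm \<psi> * norm z) \<le> \<psi> \<bullet> z"
  shows "0 \<le> 2 * (z \<bullet> d) * (\<psi> \<bullet> d) + (p - 3) * (z \<bullet> d)\<^sup>2 * (\<psi> \<bullet> z) / (norm z)\<^sup>2 + (norm d)\<^sup>2 * (\<psi> \<bullet> z)"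
proof -
  define N where "N = (norm z)\<^sup>2"
  define c where "c = \<psi> \<bullet> z"
  define w where "w = \<psi> - (c / N) *\<^sub>R z"
  have N: "N > 0" using z by (simp add: N_def)
  have c0: "c \<ge> 0" using cone by (smt (verit) c_def mult_nonneg_nonneg norm_ge_zero divide_nonneg_nonneg)
  have "(9/10 * (norm \<psi> * norm z))\<^sup>2 \<le> c\<^sup>2" using cone unfolding c_def by (intro power_mono) auto
  then have c2: "81/100 * ((norm \<psi>)\<^sup>2 * N) \<le> c\<^sup>2" by (simp add: N_def power_mult_distrib power_divide)
  have "(norm w)\<^sup>2 = (norm \<psi>)\<^sup>2 - 2 * (c / N) * c + (c / N)\<^sup>2 * N"
  proof -
    have "(norm (\<psi> - k *\<^sub>R z))\<^sup>2 = (norm \<psi>)\<^sup>2 - 2 * k * (\<psi> \<bullet> z) + k\<^sup>2 * (norm z)\<^sup>2" for k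
      unfolding power2_norm_eq_inner
      by (simp add: inner_diff_left inner_diff_right inner_commute power2_eq_square)
    then show ?thesis by (simp add: w_def c_def N_def)
  qed
  also have "\<dots> = (norm \<psi>)\<^sup>2 - c\<^sup>2 / N"
    using N by (simp add: field_simps power2_eq_square)
  finally have "(norm w)\<^sup>2 = (norm \<psi>)\<^sup>2 - c\<^sup>2 / N" .
  then have "(norm w * norm z)\<^sup>2 = (norm \<psi>)\<^sup>2 * N - c\<^sup>2"
    using N unfolding power_mult_distrib N_def[symmetric] by (simp add: field_simps)
  also have "\<dots> \<le> (c / 2)\<^sup>2" using c2 zero_le_power2[of c] by (simp add: power_divide field_simps del: zero_le_power2; linarith)
  finally have wz: "norm w * norm z \<le> c / 2" using c0 by (metis power2_le_imp_le divide_nonneg_nonneg zero_le_numeral)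
  have "\<bar>(z \<bullet> d) * (w \<bullet> d)\<bar> \<le> (norm z * norm d) * (norm w * norm d)"
    unfolding abs_mult by (intro mult_mono Cauchy_Schwarz_ineq2) auto
  also have "\<dots> = (norm w * norm z) * (norm d)\<^sup>2" by (simp add: power2_eq_square)
  also have "\<dots> \<le> c / 2 * (norm d)\<^sup>2" using wz by (intro mult_right_mono) auto
  finally have A: "0 \<le> 2 * ((z \<bullet> d) * (w \<bullet> d)) + (norm d)\<^sup>2 * c" by (simp add: abs_le_iff field_simps)
  have "(-2) * ((z \<bullet> d)\<^sup>2 * c / N) \<le> (p - 3) * ((z \<bullet> d)\<^sup>2 * c / N)"
    using p c0 N by (intro mult_right_mono) auto
  moreover have "\<psi> \<bullet> d = w \<bullet> d + c * (z \<bullet> d) / N" by (simp add: w_def inner_diff_left)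
  ultimately have "2 * (z \<bullet> d) * (\<psi> \<bullet> d) = 2 * ((z \<bullet> d) * (w \<bullet> d)) + 2 * ((z \<bullet> d)\<^sup>2 * c / N)"
    "(-2) * ((z \<bullet> d)\<^sup>2 * c / N) \<le> (p - 3) * (z \<bullet> d)\<^sup>2 * c / N"
    by (simp_all add: distrib_left power2_eq_square mult.assoc mult.left_commute)
  then show ?thesis using A unfolding N_def[symmetric] c_def[symmetric] by linarith
qed

text \<open>The segment from \<open>y\<close> to \<open>x\<close> stays in the convex cone around \<open>\<psi>\<close> and avoids the origin, so \<open>\<langle>\<psi>, f\<rangle>\<close> is twice differentiable
with nonnegative second derivative along it; the claim is that a convex function lies above its tangent.\<close>

lemma power_field_convex_in_cone:
  fixes x y \<psi> :: "'a::euclidean_space"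
  assumes p: "p > 1" and nz: "x \<noteq> 0" "y \<noteq> 0" "\<psi> \<noteq> 0"
    and x: "9/10 * (norm \<psi> * norm x) \<le> \<psi> \<bullet> x" and y: "9/10 * (norm \<psi> * norm y) \<le> \<psi> \<bullet> y"
  shows "0 \<le> \<psi> \<bullet> (power_field p x - power_field p y - power_jacobian p y (x - y))"
proof -
  define d where "d = x - y"
  define z where "z s = y + s *\<^sub>R d" for s :: real
  define G where "G s = \<psi> \<bullet> power_jacobian p (z s) d" for s
  have zc: "z s \<noteq> 0" "9/10 * (norm \<psi> * norm (z s)) \<le> \<psi> \<bullet> z s" if s: "0 \<le> s" "s \<le> 1" for s
  proof -
    have zs: "z s = (1 - s) *\<^sub>R y + s *\<^sub>R x" by (simp add: z_def d_def algebra_simps)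
    have "9/10 * (norm \<psi> * norm (z s)) \<le> 9/10 * (norm \<psi> * ((1 - s) * norm y + s * norm x))"
      unfolding zs using s by (intro mult_left_mono norm_triangle_le) auto
    also have "\<dots> = (1 - s) * (9/10 * (norm \<psi> * norm y)) + s * (9/10 * (norm \<psi> * norm x))"
      by algebra
    also have "\<dots> \<le> (1 - s) * (\<psi> \<bullet> y) + s * (\<psi> \<bullet> x)"
      using s x y by (intro add_mono mult_left_mono) auto
    finally show "9/10 * (norm \<psi> * norm (z s)) \<le> \<psi> \<bullet> z s" by (simp add: zs inner_add_right)
    have "0 < 9/10 * (norm \<psi> * norm y)" "0 < 9/10 * (norm \<psi> * norm x)" using nz by auto
    then have "0 < \<psi> \<bullet> y" "0 < \<psi> \<bullet> x" using x y by linarith+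
    then have "0 < (1 - s) * (\<psi> \<bullet> y) + s * (\<psi> \<bullet> x)"
      using s by (cases "s = 0") (auto intro: add_nonneg_pos)
    then have "0 < \<psi> \<bullet> z s" by (simp add: zs inner_add_right)
    then show "z s \<noteq> 0" by auto
  qed
  have zd: "(z has_derivative (\<lambda>h. h *\<^sub>R d)) (at s)" for s
    unfolding z_def by (auto intro!: derivative_eq_intros)
  have nd: "((\<lambda>s. norm (z s) powr q) has_real_derivative q * norm (z s) powr (q - 2) * (z s \<bullet> d)) (at s)"
    if "0 \<le> s" "s \<le> 1" for s q
    using has_derivative_compose[OF zd has_derivative_norm_powr[OF zc(1)[OF that], of q]]
    unfolding has_field_derivative_def by (simp add: algebra_simps mult_commute_abs)
  have g: "((\<lambda>s. \<psi> \<bullet> power_field p (z s)) has_real_derivative G s) (at s)" for s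
  proof -
    interpret bounded_linear "power_jacobian p (z s)" by (rule power_jacobian_linear)
    have "((\<lambda>s. \<psi> \<bullet> power_field p (z s)) has_derivative (\<lambda>h. \<psi> \<bullet> power_jacobian p (z s) (h *\<^sub>R d))) (at s)"
      by (intro has_derivative_inner_right has_derivative_compose[OF zd power_field_has_derivative[OF p]])
    then show ?thesis unfolding has_field_derivative_def by (simp add: scaleR mult_commute_abs G_def)
  qed
  have G': "\<exists>D. (G has_real_derivative D) (at s) \<and> 0 \<le> D" if s: "0 \<le> s" "s \<le> 1" for s
  proof -
    have pz: "norm (z s) powr (p - 5) = norm (z s) powr (p - 3) / (norm (z s))\<^sup>2"
      using zc(1)[OF s] powr_diff[of "norm (z s)" "p - 3" 2] by simp
    define D where "D = (p - 1) * norm (z s) powr (p - 3) *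
      (2 * (z s \<bullet> d) * (\<psi> \<bullet> d) + (p - 3) * (z s \<bullet> d)\<^sup>2 * (\<psi> \<bullet> z s) / (norm (z s))\<^sup>2 + (norm d)\<^sup>2 * (\<psi> \<bullet> z s))"
    have zi: "((\<lambda>s. z s \<bullet> v) has_real_derivative d \<bullet> v) (at s)" for v
      using has_derivative_inner_left[OF zd, of v] unfolding has_field_derivative_def by (simp add: mult_commute_abs)
    have "((\<lambda>s. norm (z s) powr (p - 1) * (\<psi> \<bullet> d) + (p - 1) * norm (z s) powr (p - 3) * (z s \<bullet> d) * (z s \<bullet> \<psi>)) has_real_derivative D) (at s)"
    proof (rule DERIV_cong)
      show "((\<lambda>s. norm (z s) powr (p - 1) * (\<psi> \<bullet> d) + (p - 1) * norm (z s) powr (p - 3) * (z s \<bullet> d) * (z s \<bullet> \<psi>)) has_real_derivative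
         ((p - 1) * norm (z s) powr (p - 1 - 2) * (z s \<bullet> d)) * (\<psi> \<bullet> d) +
         ((((p - 1) * ((p - 3) * norm (z s) powr (p - 3 - 2) * (z s \<bullet> d))) * (z s \<bullet> d)
            + (d \<bullet> d) * ((p - 1) * norm (z s) powr (p - 3))) * (z s \<bullet> \<psi>)
           + (d \<bullet> \<psi>) * ((p - 1) * norm (z s) powr (p - 3) * (z s \<bullet> d)))) (at s)"
        by (intro DERIV_add DERIV_mult DERIV_cmult DERIV_cmult_right nd[OF s] zi)
      show "((p - 1) * norm (z s) powr (p - 1 - 2) * (z s \<bullet> d)) * (\<psi> \<bullet> d) +
         ((((p - 1) * ((p - 3) * norm (z s) powr (p - 3 - 2) * (z s \<bullet> d))) * (z s \<bullet> d)
            + (d \<bullet> d) * ((p - 1) * norm (z s) powr (p - 3))) * (z s \<bullet> \<psi>)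
           + (d \<bullet> \<psi>) * ((p - 1) * norm (z s) powr (p - 3) * (z s \<bullet> d))) = D"
        unfolding D_def dot_square_norm
        by (simp add: pz inner_commute[of \<psi>] algebra_simps power2_eq_square[of "z s \<bullet> d"])
    qed
    moreover have "G = (\<lambda>s. norm (z s) powr (p - 1) * (\<psi> \<bullet> d) + (p - 1) * norm (z s) powr (p - 3) * (z s \<bullet> d) * (z s \<bullet> \<psi>))"
      by (auto simp: G_def power_jacobian_def inner_add_right inner_commute)
    moreover have "0 \<le> D"
      unfolding D_def using p by (intro mult_nonneg_nonneg hessian_form_nonneg zc s) auto
    ultimately show ?thesis by metis
  qed
  obtain s where s: "0 < s" "s < 1" "\<psi> \<bullet> power_field p (z 1) - \<psi> \<bullet> power_field p (z 0) = (1 - 0) * G s"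
    using MVT2[of 0 1 "\<lambda>s. \<psi> \<bullet> power_field p (z s)" G] g by auto
  have "G 0 \<le> G s"
    using s G' by (intro DERIV_nonneg_imp_nondecreasing[of 0 s G]) auto
  then show ?thesis using s by (simp add: G_def z_def d_def inner_diff_right)
qed

section \<open>Solutions of the forced equation\<close>

definition forced_solution ::
    "real \<Rightarrow> (real \<Rightarrow> 'a::euclidean_space) \<Rightarrow> real \<Rightarrow> (real \<Rightarrow> 'a) \<Rightarrow> bool" where
  "forced_solution p g b y \<longleftrightarrow> bounded_primitive 0 b (\<lambda>s. power_field p (y s) + g s) y"

definition bounded_force :: "real \<Rightarrow> (real \<Rightarrow> 'a::euclidean_space) \<Rightarrow> bool" where
  "bounded_force M g \<longleftrightarrow> g \<in> borel_measurable (lebesgue_on {0..}) \<and> (\<forall>t\<ge>0. norm (g t) \<le> M)"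

lemma bounded_force_measurable:
  assumes "bounded_force M g" "0 \<le> a"
  shows "g \<in> borel_measurable (lebesgue_on {a..b})"
proof -
  have "{a..b} \<subseteq> {0..}" using assms(2) by auto
  then show ?thesis using assms(1) measurable_restrict_mono unfolding bounded_force_def by blast
qed

lemma bounded_force_integrable:
  assumes "bounded_force M g" "0 \<le> a"
  shows "g integrable_on {a..b}"
  by (rule integrable_bounded_measurable[OF bounded_force_measurable[OF assms], where C = M])
    (use assms in \<open>auto simp: bounded_force_def\<close>)

lemma forced_solutionI:
  assumes p: "p > 1" and g: "bounded_force M g" and y: "continuous_on {0..b} y"
    and i: "\<And>t. t \<in> {0..b} \<Longrightarrow> ((\<lambda>s. power_field p (y s) + g s) has_integral (y t - y 0)) {0..t}"
  shows "forced_solution p g b y"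
proof -
  note c = continuous_on_power_field[OF p y]
  have "(\<lambda>s. power_field p (y s) + g s) \<in> borel_measurable (lebesgue_on {0..b})"
    by (intro borel_measurable_add continuous_imp_measurable_on_sets_lebesgue[OF c] bounded_force_measurable[OF g]) auto
  moreover have "bounded ((\<lambda>t. power_field p (y t)) ` {0..b})"
    using compact_continuous_image[OF c] compact_imp_bounded by simp
  then obtain C where "\<forall>t\<in>{0..b}. norm (power_field p (y t)) \<le> C" unfolding bounded_iff by auto
  then have "\<forall>t\<in>{0..b}. norm (power_field p (y t) + g t) \<le> C + M"
    using g unfolding bounded_force_def by (auto intro!: norm_triangle_mono)
  ultimately show ?thesis using i unfolding forced_solution_def bounded_primitive_def by blast
qed

lemma forced_solution_restrict:
  "forced_solution p g b y \<Longrightarrow> a \<le> b \<Longrightarrow> forced_solution p g a y"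
  unfolding forced_solution_def using bounded_primitive_subinterval by blast

lemma forced_solution_cong:
  assumes "forced_solution p g b y" "\<And>t. t \<in> {0..b} \<Longrightarrow> y t = z t"
  shows "forced_solution p g b z"
  using assms unfolding forced_solution_def by (auto elim!: bounded_primitive_cong)

lemma forced_solution_continuous: "forced_solution p g b y \<Longrightarrow> continuous_on {0..b} y"
  unfolding forced_solution_def by (rule bounded_primitive_continuous_on)

text \<open>Gronwall for \<open>|y - z|^2\<close>; the squared distance avoids the point where the norm is not differentiable.\<close>

lemma forced_solution_stability:
  assumes p: "p > 1" and y: "forced_solution p g b y" and z: "forced_solution p k b z"
    and R: "\<And>s. s \<in> {0..t} \<Longrightarrow> norm (y s) \<le> R" "\<And>s. s \<in> {0..t} \<Longrightarrow> norm (z s) \<le> R"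
    and gk: "\<And>s. s \<in> {0..t} \<Longrightarrow> norm (g s - k s) \<le> K" and eq: "y 0 = z 0" and t: "t \<in> {0..b}"
  shows "norm (y t - z t) \<le> K * exp ((2 * p * R powr (p - 1) + 1) * t)"
proof -
  define L where "L = p * R powr (p - 1)"
  define \<alpha> where "\<alpha> = 2 * L + 1"
  have L: "0 \<le> L" using p by (simp add: L_def)
  have K: "0 \<le> K" using order_trans[OF norm_ge_zero gk[of 0]] t by simp
  have yz: "forced_solution p g t y" "forced_solution p k t z"
    using y z t forced_solution_restrict by auto
  then have d: "bounded_primitive 0 t (\<lambda>s. (power_field p (y s) + g s) - (power_field p (z s) + k s)) (\<lambda>s. y s - z s)"
    unfolding forced_solution_def by (rule bounded_primitive_diff)
  have "(y t - z t) \<bullet> (y t - z t) + K\<^sup>2 / \<alpha> \<le> exp (\<alpha> * (t - 0)) * ((y 0 - z 0) \<bullet> (y 0 - z 0) + K\<^sup>2 / \<alpha>)"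
  proof (rule gronwall[OF bounded_primitive_inner[OF d d]])
    fix s assume s: "s \<in> {0..t}"
    let ?d = "y s - z s"
    have "?d \<bullet> (power_field p (y s) - power_field p (z s)) \<le> norm ?d * (L * norm ?d)"
      using power_field_lipschitz_ball[OF p R(1)[OF s] R(2)[OF s]] norm_cauchy_schwarz
      unfolding L_def by (meson mult_left_mono norm_ge_zero order_trans)
    moreover have "?d \<bullet> (g s - k s) \<le> norm ?d * K"
      using gk[OF s] norm_cauchy_schwarz by (meson mult_left_mono norm_ge_zero order_trans)
    moreover have "2 * (norm ?d * K) \<le> (norm ?d)\<^sup>2 + K\<^sup>2"
      using sum_squares_bound[of "norm ?d" K] by simp
    ultimately show "?d \<bullet> ((power_field p (y s) + g s) - (power_field p (z s) + k s))
        + ?d \<bullet> ((power_field p (y s) + g s) - (power_field p (z s) + k s))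
        \<le> \<alpha> * (?d \<bullet> ?d) + K\<^sup>2"
      unfolding \<alpha>_def dot_square_norm
      by (simp add: inner_diff_right inner_add_right power2_eq_square algebra_simps)
  qed (use t L in \<open>auto simp: \<alpha>_def\<close>)
  also have "\<dots> = exp (\<alpha> * t) * (K\<^sup>2 / \<alpha>)" using eq by simp
  also have "\<dots> \<le> exp (\<alpha> * t) * K\<^sup>2"
    using L by (intro mult_left_mono) (auto simp: \<alpha>_def field_simps)
  also have "\<dots> \<le> exp (\<alpha> * t) * exp (\<alpha> * t) * K\<^sup>2"
    using L t by (intro mult_right_mono) (auto simp: \<alpha>_def)
  finally have "(norm (y t - z t))\<^sup>2 + K\<^sup>2 / \<alpha> \<le> (K * exp (\<alpha> * t))\<^sup>2"
    by (simp add: dot_square_norm power_mult_distrib power2_eq_square algebra_simps)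
  moreover have "0 \<le> K\<^sup>2 / \<alpha>" using L by (simp add: \<alpha>_def)
  ultimately have "(norm (y t - z t))\<^sup>2 \<le> (K * exp (\<alpha> * t))\<^sup>2" by linarith
  then have "norm (y t - z t) \<le> K * exp (\<alpha> * t)"
    by (rule power2_le_imp_le) (use K in auto)
  then show ?thesis by (simp add: \<alpha>_def L_def mult.assoc)
qed

lemma forced_solution_unique:
  assumes p: "p > 1" and y: "forced_solution p g b y" and z: "forced_solution p g b z"
    and eq: "y 0 = z 0" and t: "t \<in> {0..b}"
  shows "y t = z t"
proof -
  have "bounded (y ` {0..b} \<union> z ` {0..b})"
    using y z by (simp add: compact_continuous_image compact_imp_bounded forced_solution_continuous)
  then obtain R where R: "\<And>v. v \<in> y ` {0..b} \<union> z ` {0..b} \<Longrightarrow> norm v \<le> R" unfolding bounded_iff by auto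
  have "norm (y t - z t) \<le> 0 * exp ((2 * p * R powr (p - 1) + 1) * t)"
    by (rule forced_solution_stability[OF p y z]) (use R t eq in auto)
  then show ?thesis by simp
qed

text \<open>Composing the power field with the projection onto a ball makes it globally Lipschitz. The truncated
solution is a true one for as long as it has not left the ball.\<close>

lemma truncated_solution:
  assumes p: "p > 1" and g: "bounded_force M g" and R: "R > 0" and b: "0 \<le> b"
  obtains y where "continuous_on {0..b} y" "y 0 = y0"
    "\<And>c. c \<in> {0..b} \<Longrightarrow> (\<And>t. t \<in> {0..c} \<Longrightarrow> norm (y t) \<le> R) \<Longrightarrow> forced_solution p g c y"
proof -
  let ?\<pi> = "closest_point (cball 0 R) :: 'a \<Rightarrow> 'a"
  have B: "convex (cball (0::'a) R)" "closed (cball (0::'a) R)" "cball (0::'a) R \<noteq> {}" using R by auto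
  have pi: "norm (?\<pi> x) \<le> R" for x using closest_point_in_set[OF B(2,3), of x] by simp
  obtain y where y: "continuous_on {0..b} y"
    "\<And>t. t \<in> {0..b} \<Longrightarrow> ((\<lambda>s. power_field p (?\<pi> (y s))) has_integral (y t - (y0 + integral {0..t} g))) {0..t}"
  proof (rule picard_global[OF b, of "\<lambda>_ x. power_field p (?\<pi> x)" "p * R powr (p - 1)" "\<lambda>t. y0 + integral {0..t} g"])
    show "continuous_on ({0..b} \<times> UNIV) (\<lambda>w. power_field p (?\<pi> (snd w)))"
      by (intro continuous_on_power_field[OF p] continuous_on_compose2[OF continuous_on_closest_point[OF B]])
        (auto intro!: continuous_intros)
    show "0 < p * R powr (p - 1)" using p R by simp
    fix x y :: 'a
    have "norm (power_field p (?\<pi> x) - power_field p (?\<pi> y)) \<le> p * R powr (p - 1) * norm (?\<pi> x - ?\<pi> y)"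
      by (intro power_field_lipschitz_ball p pi)
    also have "\<dots> \<le> p * R powr (p - 1) * norm (x - y)"
      using closest_point_lipschitz[OF B, of x y] p by (intro mult_left_mono) (auto simp: dist_norm)
    finally show "norm (power_field p (?\<pi> x) - power_field p (?\<pi> y)) \<le> p * R powr (p - 1) * norm (x - y)" .
  next
    show "continuous_on {0..b} (\<lambda>t. y0 + integral {0..t} g)"
      by (intro continuous_intros indefinite_integral_continuous_1 bounded_force_integrable[OF g]) auto
  qed blast
  have y0: "y 0 = y0" using integral_unique[OF y(2)[of 0]] b by simp
  show thesis
  proof (rule that[OF y(1) y0])
    fix c assume c: "c \<in> {0..b}" "\<And>t. t \<in> {0..c} \<Longrightarrow> norm (y t) \<le> R"
    show "forced_solution p g c y"
    proof (rule forced_solutionI[OF p g])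
      show "continuous_on {0..c} y" using continuous_on_subset[OF y(1)] c by auto
      fix t assume t: "t \<in> {0..c}"
      have "((\<lambda>s. power_field p (y s)) has_integral (y t - (y0 + integral {0..t} g))) {0..t}"
      proof (rule has_integral_eq[rotated])
        show "((\<lambda>s. power_field p (?\<pi> (y s))) has_integral (y t - (y0 + integral {0..t} g))) {0..t}"
          using y(2)[of t] t c by auto
        fix s assume "s \<in> {0..t}"
        then have "?\<pi> (y s) = y s" using c(2)[of s] t by (intro closest_point_self) auto
        then show "power_field p (?\<pi> (y s)) = power_field p (y s)" by simp
      qed
      from has_integral_add[OF this integrable_integral[OF bounded_force_integrable[OF g, of 0 t]]]
      show "((\<lambda>s. power_field p (y s) + g s) has_integral (y t - y 0)) {0..t}" using y0 by simp
    qed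
  qed
qed

section \<open>Growth, direction and blow-up rate of large solutions\<close>

text \<open>Where \<open>|y|^p \<ge> M\<close> the outward push of the power field beats the forcing. To return below its value at \<open>s\<close> the
norm would first have to fall to \<open>R\<close>, but it cannot decrease before it gets there.\<close>

lemma large_solution_norm_mono:
  assumes y: "forced_solution p g b y" and g: "bounded_force M g" and p: "p > 1"
    and R: "R > 0" "M \<le> R powr p" and s: "0 \<le> s" "R < norm (y s)" and t: "s \<le> t" "t \<le> b"
  shows "norm (y s) \<le> norm (y t)"
proof -
  have yc: "continuous_on {s..b} (\<lambda>r. norm (y r))"
    using continuous_on_subset[OF forced_solution_continuous[OF y], of "{s..b}"] s
    by (auto intro!: continuous_intros)
  have mono: "norm (y s) \<le> norm (y r)" if r: "s \<le> r" "r \<le> b" "\<And>q. q \<in> {s..r} \<Longrightarrow> R \<le> norm (y q)" for r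
  proof -
    have "0 * (r - s) \<le> y r \<bullet> y r - y s \<bullet> y s"
    proof (rule bounded_primitive_ge)
      show "bounded_primitive 0 b (\<lambda>t. y t \<bullet> (power_field p (y t) + g t) + y t \<bullet> (power_field p (y t) + g t)) (\<lambda>t. y t \<bullet> y t)"
        using y unfolding forced_solution_def by (intro bounded_primitive_inner)
      fix q assume q: "q \<in> {s..r}"
      have "\<bar>y q \<bullet> g q\<bar> \<le> norm (y q) * M"
        using Cauchy_Schwarz_ineq2[of "y q" "g q"] g q s mult_left_mono[of "norm (g q)" M "norm (y q)"]
        unfolding bounded_force_def by auto
      also have "\<dots> \<le> norm (y q) * norm (y q) powr p"
        using R r(3)[OF q] p powr_mono2[of p R "norm (y q)"] by (intro mult_left_mono) auto
      finally show "0 \<le> y q \<bullet> (power_field p (y q) + g q) + y q \<bullet> (power_field p (y q) + g q)"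
        by (simp add: inner_add_right inner_power_field abs_le_iff mult.commute)
    qed (use r s in auto)
    then show ?thesis by (simp add: dot_square_norm)
  qed
  show ?thesis
  proof (cases "\<forall>q\<in>{s..t}. R \<le> norm (y q)")
    case True then show ?thesis using mono t by auto
  next
    case False
    then obtain q where q: "q \<in> {s..t}" "norm (y q) < R" by force
    obtain \<tau> where \<tau>: "s < \<tau>" "\<tau> \<le> q" "- norm (y \<tau>) = - R" "\<And>r. s \<le> r \<Longrightarrow> r < \<tau> \<Longrightarrow> - norm (y r) < - R"
      by (rule first_hitting_time[of s b "\<lambda>r. - norm (y r)" "- R" q])
        (use continuous_on_minus[OF yc] s q t in auto)
    have "R \<le> norm (y r)" if "r \<in> {s..\<tau>}" for r
      using \<tau>(3) \<tau>(4)[of r] that by (cases "r = \<tau>") auto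
    then have "norm (y s) \<le> norm (y \<tau>)" using mono[of \<tau>] \<tau> q t by auto
    then show ?thesis using \<tau>(3) s(2) by simp
  qed
qed

text \<open>The power field is radial, so only the forcing turns the direction, and it does so at speed at most \<open>2M/|y|\<close>.\<close>

lemma large_solution_direction:
  assumes y: "forced_solution p g b y" and g: "bounded_force M g"
    and R: "R > 0" and e: "norm e = 1" and st: "0 \<le> s" "s \<le> t" "t \<le> b"
    and large: "\<And>r. r \<in> {s..t} \<Longrightarrow> R \<le> norm (y r)"
  shows "y s \<bullet> e / norm (y s) - 2 * M / R * (t - s) \<le> y t \<bullet> e / norm (y t)"
proof -
  have M: "0 \<le> M" using g norm_ge_zero order_trans unfolding bounded_force_def by blast
  define G where "G x = (1 / norm x) *\<^sub>R e - ((x \<bullet> e) / norm x ^ 3) *\<^sub>R x" for x :: 'a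
  have bp: "bounded_primitive s t (\<lambda>r. power_field p (y r) + g r) y"
    using y st bounded_primitive_subinterval unfolding forced_solution_def by blast
  have nz: "y r \<noteq> 0" if "r \<in> {s..t}" for r using large[OF that] R by auto
  have "bounded_primitive s t (\<lambda>r. G (y r) \<bullet> (power_field p (y r) + g r)) (\<lambda>r. (y r \<bullet> e) * norm (y r) powr (-1))"
  proof (rule bounded_primitive_chain[OF bp])
    fix r assume r: "r \<in> {s..t}"
    have "((\<lambda>x. (x \<bullet> e) * norm x powr (-1)) has_derivative
       (\<lambda>v. (y r \<bullet> e) * ((((-1) * norm (y r) powr (-1 - 2)) *\<^sub>R y r) \<bullet> v) + (v \<bullet> e) * norm (y r) powr (-1))) (at (y r))"
      by (intro has_derivative_mult has_derivative_norm_powr nz[OF r] has_derivative_inner_left has_derivative_ident)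
    moreover have "norm (y r) powr (-1) = 1 / norm (y r)" "norm (y r) powr (-1 - 2) = 1 / norm (y r) ^ 3"
      using nz[OF r] powr_minus_divide[of "norm (y r)" 1] powr_minus_divide[of "norm (y r)" 3] by auto
    ultimately show "((\<lambda>x. (x \<bullet> e) * norm x powr (-1)) has_derivative (\<lambda>v. G (y r) \<bullet> v)) (at (y r))"
      by (simp add: G_def inner_diff_left inner_commute[of e] algebra_simps)
  next
    show "continuous_on {s..t} (\<lambda>r. G (y r))"
      unfolding G_def using nz by (intro continuous_intros bounded_primitive_continuous_on[OF bp]) auto
  qed
  then have "(- (2 * M / R)) * (t - s) \<le> (y t \<bullet> e) * norm (y t) powr (-1) - (y s \<bullet> e) * norm (y s) powr (-1)"
  proof (rule bounded_primitive_ge)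
    fix r assume r: "r \<in> {s..t}"
    let ?n = "norm (y r)"
    have n: "?n > 0" "R \<le> ?n" using nz[OF r] large[OF r] by auto
    have "G (y r) \<bullet> power_field p (y r) = 0"
      using n by (simp add: G_def power_field_def inner_diff_left inner_commute[of e] dot_square_norm power2_eq_square power3_eq_cube)
    moreover have "\<bar>G (y r) \<bullet> g r\<bar> \<le> 2 / ?n * M"
    proof -
      have "norm (G (y r)) \<le> norm ((1 / ?n) *\<^sub>R e) + norm (((y r \<bullet> e) / ?n ^ 3) *\<^sub>R y r)"
        unfolding G_def by (rule norm_triangle_ineq4)
      also have "\<dots> = 1 / ?n + \<bar>y r \<bullet> e\<bar> / ?n ^ 2" using e n by (simp add: power2_eq_square power3_eq_cube)
      also have "\<dots> \<le> 1 / ?n + ?n / ?n ^ 2"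
        using Cauchy_Schwarz_ineq2[of "y r" e] e n by (intro add_left_mono divide_right_mono) auto
      also have "\<dots> = 2 / ?n" using n by (simp add: power2_eq_square)
      finally have "norm (G (y r)) * norm (g r) \<le> 2 / ?n * M"
        using g r st n unfolding bounded_force_def by (intro mult_mono) auto
      then show ?thesis using Cauchy_Schwarz_ineq2 order_trans by blast
    qed
    moreover have "2 / ?n * M \<le> 2 * M / R" using n R M by (simp add: frac_le)
    ultimately show "- (2 * M / R) \<le> G (y r) \<bullet> (power_field p (y r) + g r)"
      by (simp add: inner_add_right abs_le_iff)
  qed (use st in auto)
  moreover have "norm (y t) powr (-1) = 1 / norm (y t)" "norm (y s) powr (-1) = 1 / norm (y s)"
    using nz[of t] nz[of s] st powr_minus_divide[of "norm (y t)" 1] powr_minus_divide[of "norm (y s)" 1] by auto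
  ultimately show ?thesis by (simp add: algebra_simps)
qed

text \<open>Without forcing, \<open>|y|^(1-p)\<close> decreases exactly at the rate \<open>p - 1\<close>. The forcing changes this by a relative error of
at most \<open>M/|y|^p \<le> 1/2\<close>.\<close>

lemma large_solution_rate:
  assumes y: "forced_solution p g b y" and g: "bounded_force M g" and p: "p > 1"
    and R: "R > 0" "2 * M \<le> R powr p" and st: "0 \<le> s" "s \<le> t" "t \<le> b"
    and large: "\<And>r. r \<in> {s..t} \<Longrightarrow> R \<le> norm (y r)"
  shows "norm (y t) powr (1 - p) \<le> norm (y s) powr (1 - p) - (p - 1) / 2 * (t - s)"
    and "norm (y s) powr (1 - p) - 3 * (p - 1) / 2 * (t - s) \<le> norm (y t) powr (1 - p)"
proof -
  define h where "h r = (((1 - p) * norm (y r) powr (1 - p - 2)) *\<^sub>R y r) \<bullet> (power_field p (y r) + g r)" for r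
  have bp: "bounded_primitive s t (\<lambda>r. power_field p (y r) + g r) y"
    using y st bounded_primitive_subinterval unfolding forced_solution_def by blast
  have nz: "y r \<noteq> 0" if "r \<in> {s..t}" for r using large[OF that] R by auto
  have H: "bounded_primitive s t h (\<lambda>r. norm (y r) powr (1 - p))"
    unfolding h_def
  proof (rule bounded_primitive_chain[OF bp, where G = "\<lambda>x. ((1 - p) * norm x powr (1 - p - 2)) *\<^sub>R x"])
    show "continuous_on {s..t} (\<lambda>r. ((1 - p) * norm (y r) powr (1 - p - 2)) *\<^sub>R y r)"
      using nz by (intro continuous_intros bounded_primitive_continuous_on[OF bp]) auto
  qed (intro has_derivative_norm_powr nz)
  have hb: "\<bar>h r + (p - 1)\<bar> \<le> (p - 1) / 2" if r: "r \<in> {s..t}" for r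
  proof -
    let ?n = "norm (y r)"
    have n: "?n > 0" "R \<le> ?n" using nz[OF r] large[OF r] by auto
    have e: "?n powr (1 - p - 2) * (?n powr p * ?n) = 1"
    proof -
      have "?n powr (1 - p - 2) * (?n powr p * ?n powr 1) = ?n powr (1 - p - 2 + (p + 1))"
        by (simp only: powr_add)
      then show ?thesis using n by simp
    qed
    have "h r + (p - 1) = (1 - p) * (?n powr (1 - p - 2) * (y r \<bullet> g r)) + (p - 1) * (1 - ?n powr (1 - p - 2) * (?n powr p * ?n))"
      unfolding h_def inner_scaleR_left inner_add_right inner_power_field by (simp add: algebra_simps)
    also have "\<dots> = (1 - p) * (?n powr (1 - p - 2) * (y r \<bullet> g r))" by (simp only: e) simp
    finally have A: "\<bar>h r + (p - 1)\<bar> = (p - 1) * (?n powr (1 - p - 2) * \<bar>y r \<bullet> g r\<bar>)"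
      using p by (simp add: abs_mult)
    have "2 * M \<le> ?n powr p"
      using R(2) powr_mono2[of p R ?n] n R p by linarith
    moreover have "norm (g r) \<le> M" using g r st unfolding bounded_force_def by auto
    ultimately have "norm (g r) \<le> ?n powr p / 2" by linarith
    then have "\<bar>y r \<bullet> g r\<bar> \<le> ?n * (?n powr p / 2)"
      using Cauchy_Schwarz_ineq2[of "y r" "g r"] mult_left_mono[of "norm (g r)" "?n powr p / 2" ?n] by auto
    then have "?n powr (1 - p - 2) * \<bar>y r \<bullet> g r\<bar> \<le> ?n powr (1 - p - 2) * (?n * (?n powr p / 2))"
      by (intro mult_left_mono) auto
    also have "\<dots> = 1/2" using e by (simp add: mult.commute)
    finally show ?thesis unfolding A using p mult_left_mono[of _ "1/2" "p - 1"] by fastforce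
  qed
  have hb': "h r \<le> - ((p - 1) / 2)" "- (3 * (p - 1) / 2) \<le> h r" if "r \<in> {s..t}" for r
    using hb[OF that] by argo+
  have "norm (y t) powr (1 - p) - norm (y s) powr (1 - p) \<le> (- ((p - 1) / 2)) * (t - s)"
    by (rule bounded_primitive_le[OF H]) (use st hb' in auto)
  then show "norm (y t) powr (1 - p) \<le> norm (y s) powr (1 - p) - (p - 1) / 2 * (t - s)" by simp
  have "(- (3 * (p - 1) / 2)) * (t - s) \<le> norm (y t) powr (1 - p) - norm (y s) powr (1 - p)"
    by (rule bounded_primitive_ge[OF H]) (use st hb' in auto)
  then show "norm (y s) powr (1 - p) - 3 * (p - 1) / 2 * (t - s) \<le> norm (y t) powr (1 - p)" by simp
qed

section \<open>Existence up to the minimal blow-up time\<close>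

text \<open>Suppose that some time \<open>b < T\<close> is out of reach, and let \<open>S\<close> be the supremum of the times up to which a solution exists.
Truncated solutions attain every large level while they are still true solutions, hence no later than \<open>S\<close>, and by
uniqueness the solution on \<open>[0,S)\<close> attains these levels too. Since large norms are monotone in time, the norm
then tends to infinity at \<open>S\<close>.\<close>

lemma solution_until_blowup:
  fixes g :: "real \<Rightarrow> 'a::euclidean_space"
  assumes p: "p > 1" and g: "bounded_force M g" and T: "0 < T"
    and no_blowup: "\<And>S y. 0 < S \<Longrightarrow> S < T \<Longrightarrow> y 0 = y0 \<Longrightarrow>
       (\<And>b. 0 \<le> b \<Longrightarrow> b < S \<Longrightarrow> forced_solution p g b y) \<Longrightarrow>
       \<not> filterlim (\<lambda>t. norm (y t)) at_top (at_left S)"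
  obtains y where "y 0 = y0" "\<And>b. 0 \<le> b \<Longrightarrow> b < T \<Longrightarrow> forced_solution p g b y"
proof -
  define P where "P b y \<longleftrightarrow> 0 \<le> b \<and> forced_solution p g b y \<and> y 0 = y0" for b y
  have restr: "P a y" if "0 \<le> a" "a \<le> b" "P b y" for a b y
    using that forced_solution_restrict unfolding P_def by blast
  have uniq: "y t = z t" if "P b y" "P b z" "t \<in> {0..b}" for b y z t
    using that forced_solution_unique[OF p] unfolding P_def by metis
  have cong: "P b z" if "P b y" "\<And>t. t \<in> {0..b} \<Longrightarrow> y t = z t" for b y z
    using that forced_solution_cong unfolding P_def by (metis atLeastAtMost_iff order_refl)
  have glue: "\<exists>y. \<forall>b. 0 \<le> b \<longrightarrow> b < S \<longrightarrow> P b y" if "\<And>b. 0 \<le> b \<Longrightarrow> b < S \<Longrightarrow> \<exists>y. P b y" for S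
    by (rule glue_solutions[of S P]; fact that restr uniq cong)
  have "\<exists>y. P b y" if b: "0 \<le> b" "b < T" for b
  proof (rule ccontr)
    assume none: "\<not> (\<exists>y. P b y)"
    \<comment> \<open>If the time \<open>b\<close> is out of reach, every level above \<open>|y0|\<close> is attained by a truncated solution before \<open>b\<close>.\<close>
    have hit: "\<exists>\<tau> z. 0 < \<tau> \<and> \<tau> \<le> b \<and> P \<tau> z \<and> norm (z \<tau>) = K" if K: "norm y0 < K" for K
    proof -
      have "0 < K" using K norm_ge_zero[of y0] by linarith
      then obtain z where z: "continuous_on {0..b} z" "z 0 = y0"
        "\<And>c. c \<in> {0..b} \<Longrightarrow> (\<And>t. t \<in> {0..c} \<Longrightarrow> norm (z t) \<le> K) \<Longrightarrow> forced_solution p g c z"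
        using truncated_solution[OF p g _ b(1)] by metis
      have "\<not> forced_solution p g b z" using none z(2) b unfolding P_def by auto
      then obtain r where r: "r \<in> {0..b}" "K \<le> norm (z r)" using z(3)[of b] b by force
      obtain \<tau> where \<tau>: "0 < \<tau>" "\<tau> \<le> r" "norm (z \<tau>) = K" "\<And>s. 0 \<le> s \<Longrightarrow> s < \<tau> \<Longrightarrow> norm (z s) < K"
        by (rule first_hitting_time[of 0 b "\<lambda>r. norm (z r)" K r])
          (use continuous_on_norm[OF z(1)] r K z(2) in auto)
      have "norm (z t) \<le> K" if "t \<in> {0..\<tau>}" for t
        using \<tau>(3) \<tau>(4)[of t] that by (cases "t = \<tau>") auto
      then have "P \<tau> z" using z \<tau> r unfolding P_def by auto
      then show ?thesis using \<tau> r by auto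
    qed
    define A where "A = {c. c \<le> b \<and> (\<exists>y. P c y)}"
    define S where "S = Sup A"
    have Abdd: "bdd_above A" unfolding A_def by (rule bdd_aboveI[of _ b]) auto
    have hitA: "\<tau> \<le> S" if "\<tau> \<le> b" "P \<tau> z" for \<tau> z
      unfolding S_def using that Abdd by (intro cSup_upper) (auto simp: A_def)
    obtain \<tau>0 z0 where "0 < \<tau>0" "\<tau>0 \<le> b" "P \<tau>0 z0" using hit[of "norm y0 + 1"] by auto
    then have S0: "0 < S" and Ane: "A \<noteq> {}" using hitA by (fastforce simp: A_def)+
    have Sb: "S \<le> b" unfolding S_def by (rule cSup_least[OF Ane]) (auto simp: A_def)
    have "\<exists>y. P c y" if c: "0 \<le> c" "c < S" for c
    proof -
      obtain a where "a \<in> A" "c < a" using c less_cSup_iff[OF Ane Abdd] unfolding S_def by auto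
      moreover from this obtain w where "P a w" unfolding A_def by auto
      ultimately show ?thesis using restr[OF c(1), of a w] by auto
    qed
    then obtain y where y: "\<And>c. 0 \<le> c \<Longrightarrow> c < S \<Longrightarrow> P c y" using glue by metis
    have unbounded: "\<exists>t. 0 \<le> t \<and> t < S \<and> norm (y t) = K" if K: "norm y0 < K" for K
    proof -
      obtain \<tau> z where z: "0 < \<tau>" "\<tau> \<le> b" "P \<tau> z" "norm (z \<tau>) = K" using hit[OF K] by auto
      \<comment> \<open>A solution on the closed interval \<open>[0,S]\<close> would be bounded, but higher levels are attained no later than \<open>S\<close>.\<close>
      have "\<tau> \<noteq> S"
      proof
        assume "\<tau> = S"
        have "bounded (z ` {0..\<tau>})"
          using z(3) unfolding P_def
          by (intro compact_imp_bounded compact_continuous_image) (auto intro: forced_solution_continuous)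
        then obtain K' where K': "\<And>t. t \<in> {0..\<tau>} \<Longrightarrow> norm (z t) \<le> K'" unfolding bounded_iff by blast
        have "norm y0 < max K' (norm y0) + 1" by linarith
        from hit[OF this] obtain \<sigma> w where w: "0 < \<sigma>" "\<sigma> \<le> b" "P \<sigma> w" "norm (w \<sigma>) = max K' (norm y0) + 1"
          by blast
        have "\<sigma> \<le> \<tau>" using hitA[OF w(2,3)] \<open>\<tau> = S\<close> by simp
        then have "w \<sigma> = z \<sigma>" using uniq[OF w(3) restr[OF _ _ z(3)], of \<sigma>] w(1) by auto
        then show False using w(4) K'[of \<sigma>] w(1) \<open>\<sigma> \<le> \<tau>\<close> by auto
      qed
      then have \<tau>: "\<tau> < S" using hitA[OF z(2,3)] by simp
      then have "y \<tau> = z \<tau>" using uniq[OF y z(3), of \<tau>] z(1) by auto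
      then show ?thesis using z \<tau> by (auto intro!: exI[of _ \<tau>])
    qed
    define R where "R = max 1 M"
    have R: "0 < R" "M \<le> R powr p"
      using p powr_mono[of 1 p R] by (auto simp: R_def max_def split: if_splits)
    have "filterlim (\<lambda>t. norm (y t)) at_top (at_left S)"
      unfolding filterlim_at_top
    proof
      fix Z
      define K where "K = max (max Z (norm y0)) R + 1"
      have "norm y0 < K" unfolding K_def by linarith
      from unbounded[OF this] obtain t0 where t0: "0 \<le> t0" "t0 < S" "norm (y t0) = K" by blast
      have "Z \<le> norm (y t)" if "t0 < t" "t < S" for t
      proof -
        have "norm (y t0) \<le> norm (y t)"
          using y[of t] that t0 by (intro large_solution_norm_mono[OF _ g p R, of t])
            (auto simp: P_def K_def)
        then show ?thesis using t0 by (simp add: K_def)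
      qed
      then show "\<forall>\<^sub>F t in at_left S. Z \<le> norm (y t)"
        using t0 by (auto simp: eventually_at_left[of t0 S])
    qed
    moreover have "y 0 = y0" using y[of 0] S0 by (simp add: P_def)
    ultimately show False
      using no_blowup[of S y] S0 Sb b y unfolding P_def by auto
  qed
  then obtain y where "\<And>b. 0 \<le> b \<Longrightarrow> b < T \<Longrightarrow> P b y" using glue[of T] by metis
  then show thesis using that[of y] T unfolding P_def by auto
qed

section \<open>The adjoint flow and the costate\<close>

definition adjoint_primitive ::
    "real \<Rightarrow> (real \<Rightarrow> 'a::euclidean_space) \<Rightarrow> real \<Rightarrow> (real \<Rightarrow> 'a) \<Rightarrow> bool" where
  "adjoint_primitive p y b \<psi> \<longleftrightarrow> bounded_primitive 0 b (\<lambda>t. - power_jacobian p (y t) (\<psi> t)) \<psi>"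

text \<open>\<open>J(y)\<close> is positive semidefinite, so the adjoint equation contracts. Applied to differences, this
gives uniqueness.\<close>

lemma adjoint_primitive_norm_le:
  assumes p: "p > 1" and \<psi>: "adjoint_primitive p y b \<psi>" and t: "t \<in> {0..b}"
  shows "norm (\<psi> t) \<le> norm (\<psi> 0)"
proof -
  note bp = \<psi>[unfolded adjoint_primitive_def]
  have "\<psi> t \<bullet> \<psi> t - \<psi> 0 \<bullet> \<psi> 0 \<le> 0 * (t - 0)"
  proof (rule bounded_primitive_le[OF bounded_primitive_inner[OF bp bp]])
    fix r
    have "\<psi> r \<bullet> power_jacobian p (y r) (\<psi> r) = norm (y r) powr (p - 1) * (\<psi> r \<bullet> \<psi> r) + (p - 1) * norm (y r) powr (p - 3) * (y r \<bullet> \<psi> r)\<^sup>2"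
      by (simp add: power_jacobian_def inner_add_right power2_eq_square inner_commute)
    then have "0 \<le> \<psi> r \<bullet> power_jacobian p (y r) (\<psi> r)" using p by simp
    then show "\<psi> r \<bullet> - power_jacobian p (y r) (\<psi> r) + \<psi> r \<bullet> - power_jacobian p (y r) (\<psi> r) \<le> 0" by simp
  qed (use t in auto)
  then show ?thesis by (simp add: dot_square_norm)
qed

lemma adjoint_primitive_nonzero:
  assumes p: "p > 1" and \<psi>: "adjoint_primitive p y b \<psi>" and y: "continuous_on {0..b} y"
    and t: "t \<in> {0..b}" and nz: "\<psi> 0 \<noteq> 0"
  shows "\<psi> t \<noteq> 0"
proof -
  note bp = \<psi>[unfolded adjoint_primitive_def]
  have "bounded (y ` {0..b})" using y by (simp add: compact_continuous_image compact_imp_bounded)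
  then obtain R where R: "\<And>s. s \<in> {0..b} \<Longrightarrow> norm (y s) \<le> R" unfolding bounded_iff by blast
  define L where "L = p * R powr (p - 1) + 1"
  have L: "L > 0" using p by (simp add: L_def add_nonneg_pos)
  have b: "bounded_primitive 0 b (\<lambda>t. (-1) *\<^sub>R (\<psi> t \<bullet> - power_jacobian p (y t) (\<psi> t) + \<psi> t \<bullet> - power_jacobian p (y t) (\<psi> t))) (\<lambda>t. (-1) *\<^sub>R (\<psi> t \<bullet> \<psi> t))"
    by (intro bounded_primitive_scaleR bounded_primitive_inner bp)
  have "(-1) *\<^sub>R (\<psi> t \<bullet> \<psi> t) + 0 / (- (2 * L)) \<le> exp (- (2 * L) * (t - 0)) * ((-1) *\<^sub>R (\<psi> 0 \<bullet> \<psi> 0) + 0 / (- (2 * L)))"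
  proof (rule gronwall[OF b t])
    fix r assume r: "r \<in> {0..b}"
    have "norm (power_jacobian p (y r) (\<psi> r)) \<le> p * norm (y r) powr (p - 1) * norm (\<psi> r)"
      using norm_power_jacobian_le[of p] p by simp
    also have "\<dots> \<le> p * R powr (p - 1) * norm (\<psi> r)"
      using p R[OF r] by (intro mult_right_mono mult_left_mono powr_mono2) auto
    also have "\<dots> \<le> L * norm (\<psi> r)" by (intro mult_right_mono) (auto simp: L_def)
    finally have "norm (\<psi> r) * norm (power_jacobian p (y r) (\<psi> r)) \<le> norm (\<psi> r) * (L * norm (\<psi> r))"
      by (intro mult_left_mono) auto
    then have "\<psi> r \<bullet> power_jacobian p (y r) (\<psi> r) \<le> L * (\<psi> r \<bullet> \<psi> r)"
      using norm_cauchy_schwarz[of "\<psi> r" "power_jacobian p (y r) (\<psi> r)"]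
      by (simp add: dot_square_norm power2_eq_square algebra_simps)
    then show "(-1) *\<^sub>R (\<psi> r \<bullet> - power_jacobian p (y r) (\<psi> r) + \<psi> r \<bullet> - power_jacobian p (y r) (\<psi> r)) \<le> - (2 * L) * ((-1) *\<^sub>R (\<psi> r \<bullet> \<psi> r)) + 0"
      by simp
  qed (use L in auto)
  then have "exp (- (2 * L) * t) * (\<psi> 0 \<bullet> \<psi> 0) \<le> \<psi> t \<bullet> \<psi> t" by simp
  moreover have "0 < exp (- (2 * L) * t) * (\<psi> 0 \<bullet> \<psi> 0)" using nz by simp
  ultimately show ?thesis by auto
qed

text \<open>All solutions are started at time 0. The linear maps \<open>\<Psi> t\<close> are injective because solutions decay at most
exponentially on compact intervals; in finite dimension they are then onto, so that a solution with prescribed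
value at a later time exists without solving the equation backward.\<close>

lemma adjoint_flow:
  fixes y :: "real \<Rightarrow> 'a::euclidean_space"
  assumes p: "p > 1" and T: "0 < T" and y: "continuous_on {0..<T} y"
  obtains \<Psi> where "\<And>b x. 0 \<le> b \<Longrightarrow> b < T \<Longrightarrow> adjoint_primitive p y b (\<lambda>t. \<Psi> t x)"
    "\<And>x. \<Psi> 0 x = x" "\<And>t. 0 \<le> t \<Longrightarrow> t < T \<Longrightarrow> linear (\<Psi> t)" "\<And>t. 0 \<le> t \<Longrightarrow> t < T \<Longrightarrow> inj (\<Psi> t)"
proof -
  define P where "P x b \<psi> \<longleftrightarrow> 0 \<le> b \<and> b < T \<and> adjoint_primitive p y b \<psi> \<and> \<psi> 0 = x" for x b \<psi>
  have lin: "linear (power_jacobian p v)" for v :: 'a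
    using power_jacobian_linear bounded_linear.linear by blast
  have yb: "continuous_on {0..b} y" if "b < T" for b using that by (auto intro: continuous_on_subset[OF y])
  have sub: "adjoint_primitive p y b (\<lambda>t. \<psi> t - \<phi> t)" if "adjoint_primitive p y b \<psi>" "adjoint_primitive p y b \<phi>" for b \<psi> \<phi>
    using bounded_primitive_diff[OF that[unfolded adjoint_primitive_def]]
    unfolding adjoint_primitive_def by (simp add: linear_diff[OF lin])
  have scale: "adjoint_primitive p y b (\<lambda>t. c *\<^sub>R \<psi> t)" if "adjoint_primitive p y b \<psi>" for b c \<psi>
    using bounded_primitive_scaleR[OF that[unfolded adjoint_primitive_def], of c]
    unfolding adjoint_primitive_def by (simp add: linear_cmul[OF lin])
  have "\<exists>\<psi>. \<forall>b. 0 \<le> b \<longrightarrow> b < T \<longrightarrow> P x b \<psi>" for x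
  proof -
    have "\<exists>\<psi>. P x b \<psi>" if b: "0 \<le> b" "b < T" for b
    proof -
      have "bounded (y ` {0..b})" using yb[OF b(2)] by (simp add: compact_continuous_image compact_imp_bounded)
      then obtain R where R: "\<And>s. s \<in> {0..b} \<Longrightarrow> norm (y s) \<le> R" unfolding bounded_iff by blast
      obtain \<psi> where \<psi>: "continuous_on {0..b} \<psi>"
        "\<And>t. t \<in> {0..b} \<Longrightarrow> ((\<lambda>s. - power_jacobian p (y s) (\<psi> s)) has_integral (\<psi> t - x)) {0..t}"
      proof (rule picard_global[OF b(1), of "\<lambda>t v. - power_jacobian p (y t) v" "p * R powr (p - 1) + 1" "\<lambda>_. x"])
        show "continuous_on ({0..b} \<times> UNIV) (\<lambda>w. - power_jacobian p (y (fst w)) (snd w))"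
          by (intro continuous_on_minus continuous_on_power_jacobian[OF p] continuous_on_compose2[OF yb[OF b(2)]])
            (auto intro!: continuous_intros)
        show "0 < p * R powr (p - 1) + 1" using p by (simp add: add_nonneg_pos)
        fix t v w assume t: "t \<in> {0..b}"
        have "norm (- power_jacobian p (y t) v - - power_jacobian p (y t) w) = norm (power_jacobian p (y t) (v - w))"
          by (simp add: linear_diff[OF lin] norm_minus_commute)
        also have "\<dots> \<le> p * norm (y t) powr (p - 1) * norm (v - w)" using norm_power_jacobian_le[of p] p by simp
        also have "\<dots> \<le> (p * R powr (p - 1) + 1) * norm (v - w)"
          using p R[OF t] by (intro mult_right_mono add_increasing2 mult_left_mono powr_mono2) auto
        finally show "norm (- power_jacobian p (y t) v - - power_jacobian p (y t) w) \<le> (p * R powr (p - 1) + 1) * norm (v - w)" .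
      qed (auto intro: continuous_on_const)
      have "\<psi> 0 = x" using integral_unique[OF \<psi>(2)[of 0]] b by simp
      moreover have "adjoint_primitive p y b \<psi>"
        unfolding adjoint_primitive_def
        using \<psi> \<open>\<psi> 0 = x\<close> by (intro bounded_primitive_continuousI continuous_on_minus continuous_on_power_jacobian[OF p yb[OF b(2)]]) auto
      ultimately show ?thesis using b unfolding P_def by auto
    qed
    note ex = this
    have restr: "P x a \<psi>" if "0 \<le> a" "a \<le> b" "P x b \<psi>" for a b \<psi>
      using that bounded_primitive_subinterval unfolding P_def adjoint_primitive_def by fastforce
    have uniq: "\<psi> t = \<phi> t" if "P x b \<psi>" "P x b \<phi>" "t \<in> {0..b}" for b \<psi> \<phi> t
      using adjoint_primitive_norm_le[OF p sub, of b \<psi> \<phi> t] that unfolding P_def by auto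
    have cong: "P x b \<phi>" if "P x b \<psi>" "\<And>t. t \<in> {0..b} \<Longrightarrow> \<psi> t = \<phi> t" for b \<psi> \<phi>
    proof -
      have "adjoint_primitive p y b \<phi>"
        using that bounded_primitive_cong[of 0 b "\<lambda>t. - power_jacobian p (y t) (\<psi> t)" \<psi>]
        unfolding P_def adjoint_primitive_def by simp
      then show ?thesis using that unfolding P_def by auto
    qed
    show ?thesis by (rule glue_solutions[of T "P x"]; fact ex restr uniq cong)
  qed
  then obtain F where F: "\<And>x b. 0 \<le> b \<Longrightarrow> b < T \<Longrightarrow> P x b (F x)" by metis
  define \<Psi> where "\<Psi> t x = F x t" for t x
  have ap: "adjoint_primitive p y b (\<lambda>t. \<Psi> t x)" if "0 \<le> b" "b < T" for b x
    using F[OF that] unfolding P_def \<Psi>_def by simp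
  have \<Psi>0: "\<Psi> 0 x = x" for x using F[of 0 x] T unfolding P_def \<Psi>_def by simp
  have lin\<Psi>: "linear (\<Psi> t)" if t: "0 \<le> t" "t < T" for t
  proof
    fix x z
    have "norm (\<Psi> t (x + z) - \<Psi> t x - \<Psi> t z) \<le> norm (\<Psi> 0 (x + z) - \<Psi> 0 x - \<Psi> 0 z)"
      by (rule adjoint_primitive_norm_le[OF p, of y t]) (use ap[OF t] sub t in auto)
    then show "\<Psi> t (x + z) = \<Psi> t x + \<Psi> t z" by (simp add: \<Psi>0 algebra_simps)
  next
    fix c x
    have "norm (\<Psi> t (c *\<^sub>R x) - c *\<^sub>R \<Psi> t x) \<le> norm (\<Psi> 0 (c *\<^sub>R x) - c *\<^sub>R \<Psi> 0 x)"
      by (rule adjoint_primitive_norm_le[OF p, of y t]) (use ap[OF t] sub scale t in auto)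
    then show "\<Psi> t (c *\<^sub>R x) = c *\<^sub>R \<Psi> t x" by (simp add: \<Psi>0)
  qed
  have "inj (\<Psi> t)" if t: "0 \<le> t" "t < T" for t
    unfolding linear_injective_0[OF lin\<Psi>[OF t]]
    using adjoint_primitive_nonzero[OF p ap[OF t] yb[OF t(2)], of t] t \<Psi>0 by fastforce
  then show thesis using that ap \<Psi>0 lin\<Psi> by blast
qed

text \<open>With \<open>c = 39/40\<close> and \<open>h = \<langle>\<psi>, e\<rangle> - c |\<psi>|\<close>,
\<open>h' = - |y|^(p-1) h - (p-1) |y|^(p-3) \<langle>y, \<psi>\<rangle> (\<langle>y, e\<rangle> - c \<langle>y, \<psi>\<rangle> / |\<psi>|)\<close>. As long as \<open>h \<ge> 0\<close>, both \<open>y\<close> and \<open>\<psi>\<close> lie in the cone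
around \<open>e\<close>, which makes the second term nonpositive as well. So \<open>h\<close> grows backward in time and cannot reach 0.\<close>

lemma adjoint_cone_backward:
  assumes p: "p > 1" and \<psi>: "adjoint_primitive p y s \<psi>" and y: "continuous_on {0..s} y"
    and e: "norm e = 1" and r: "0 \<le> r" and t: "t \<in> {r..s}" and nz: "\<psi> 0 \<noteq> 0"
    and cone: "\<And>q. q \<in> {r..s} \<Longrightarrow> y q \<noteq> 0 \<and> 39/40 * norm (y q) \<le> y q \<bullet> e"
    and final: "39/40 * norm (\<psi> s) < \<psi> s \<bullet> e"
  shows "39/40 * norm (\<psi> t) \<le> \<psi> t \<bullet> e"
proof (rule ccontr)
  assume neg: "\<not> 39/40 * norm (\<psi> t) \<le> \<psi> t \<bullet> e"
  define h where "h q = \<psi> q \<bullet> e - 39/40 * norm (\<psi> q)" for q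
  have \<psi>nz: "\<psi> q \<noteq> 0" if "q \<in> {r..s}" for q
    using adjoint_primitive_nonzero[OF p \<psi> y _ nz] that r by auto
  have bp: "bounded_primitive r s (\<lambda>q. - power_jacobian p (y q) (\<psi> q)) \<psi>"
    using \<psi> r bounded_primitive_subinterval unfolding adjoint_primitive_def by blast
  define G where "G v = e - (39/40) *\<^sub>R sgn v" for v :: 'a
  have H: "bounded_primitive r s (\<lambda>q. G (\<psi> q) \<bullet> - power_jacobian p (y q) (\<psi> q)) h"
    unfolding h_def
  proof (rule bounded_primitive_chain[OF bp])
    fix q assume q: "q \<in> {r..s}"
    show "((\<lambda>v. v \<bullet> e - 39 / 40 * norm v) has_derivative (\<lambda>v. G (\<psi> q) \<bullet> v)) (at (\<psi> q))"
    proof (rule has_derivative_eq_rhs)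
      show "((\<lambda>v. v \<bullet> e - 39 / 40 * norm v) has_derivative (\<lambda>v. v \<bullet> e - 39 / 40 * (v \<bullet> sgn (\<psi> q)))) (at (\<psi> q))"
        by (intro has_derivative_diff has_derivative_mult_right has_derivative_norm[OF \<psi>nz[OF q]]
            has_derivative_inner_left has_derivative_ident)
    qed (simp add: G_def inner_diff_right inner_commute)
  next
    show "continuous_on {r..s} (\<lambda>q. G (\<psi> q))"
      unfolding G_def sgn_div_norm using \<psi>nz
      by (intro continuous_intros bounded_primitive_continuous_on[OF bp]) auto
  qed
  obtain \<tau> where \<tau>: "t \<le> \<tau>" "\<tau> < s" "h \<tau> = 0" "\<And>q. \<tau> < q \<Longrightarrow> q \<le> s \<Longrightarrow> 0 < h q"
    by (rule last_hitting_time[of r s h 0 t])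
      (use bounded_primitive_continuous_on[OF H] neg t final in \<open>auto simp: h_def\<close>)
  have "h s - h \<tau> \<le> 0 * (s - \<tau>)"
  proof (rule bounded_primitive_le[OF H])
    fix q assume q: "q \<in> {\<tau>..s}"
    have qs: "q \<in> {r..s}" using q \<tau> t by auto
    have h0: "0 \<le> h q" using \<tau>(3) \<tau>(4)[of q] q by (cases "q = \<tau>") auto
    let ?n = "norm (y q)" and ?m = "norm (\<psi> q)"
    have m: "?m > 0" using \<psi>nz[OF qs] by simp
    have "9/10 * (?n * ?m) \<le> y q \<bullet> \<psi> q"
      using cone[OF qs] h0 by (intro inner_ge_of_common_cone[OF e]) (auto simp: h_def)
    then have y\<psi>: "0 \<le> y q \<bullet> \<psi> q"
      using order_trans[of 0 "9/10 * (?n * ?m)"] by simp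
    have "(y q \<bullet> \<psi> q) / ?m \<le> ?n" using m norm_cauchy_schwarz[of "y q" "\<psi> q"] by (simp add: field_simps)
    then have c: "0 \<le> y q \<bullet> e - 39/40 * ((y q \<bullet> \<psi> q) / ?m)" using cone[OF qs] by simp
    have "G (\<psi> q) \<bullet> power_jacobian p (y q) (\<psi> q) = ?n powr (p - 1) * h q
        + (p - 1) * ?n powr (p - 3) * (y q \<bullet> \<psi> q) * (y q \<bullet> e - 39/40 * ((y q \<bullet> \<psi> q) / ?m))"
    proof -
      let ?u = "?n powr (p - 1)" and ?k = "(p - 1) * ?n powr (p - 3) * (y q \<bullet> \<psi> q)"
      have "e \<bullet> power_jacobian p (y q) (\<psi> q) = ?u * (\<psi> q \<bullet> e) + ?k * (y q \<bullet> e)"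
        by (simp add: power_jacobian_def inner_add_right inner_commute)
      moreover have "sgn (\<psi> q) \<bullet> power_jacobian p (y q) (\<psi> q) = ?u * ?m + ?k * ((y q \<bullet> \<psi> q) / ?m)"
        using m by (simp add: power_jacobian_def inner_add_right sgn_div_norm inner_commute[of "\<psi> q"]
            dot_square_norm power2_eq_square divide_inverse)
      ultimately have "G (\<psi> q) \<bullet> power_jacobian p (y q) (\<psi> q)
          = (?u * (\<psi> q \<bullet> e) + ?k * (y q \<bullet> e)) - 39/40 * (?u * ?m + ?k * ((y q \<bullet> \<psi> q) / ?m))"
        by (simp only: G_def inner_diff_left inner_scaleR_left)
      then show ?thesis unfolding h_def by (simp only: right_diff_distrib distrib_left mult.assoc mult.left_commute)
    qed
    moreover have "0 \<le> \<dots>" using h0 y\<psi> c p by (intro add_nonneg_nonneg mult_nonneg_nonneg) auto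
    ultimately show "G (\<psi> q) \<bullet> - power_jacobian p (y q) (\<psi> q) \<le> 0" by simp
  qed (use \<tau> t in auto)
  then show False using \<tau>(3) final by (simp add: h_def)
qed

text \<open>For each \<open>t\<close> the initial values whose solution is in the cone at time \<open>t\<close> form a closed set. Finitely many of these
sets have a common unit vector: prescribe the value \<open>e\<close> at the largest of the times and use backward invariance.
Compactness of the sphere gives a unit vector in all of them.\<close>

lemma costate_exists:
  fixes y :: "real \<Rightarrow> 'a::euclidean_space"
  assumes p: "p > 1" and T: "0 < T" and y: "continuous_on {0..<T} y" and e: "norm e = 1"
    and r: "0 \<le> r" "r < T"
    and cone: "\<And>t. r \<le> t \<Longrightarrow> t < T \<Longrightarrow> y t \<noteq> 0 \<and> 39/40 * norm (y t) \<le> y t \<bullet> e"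
  obtains \<psi> where "\<And>b. 0 \<le> b \<Longrightarrow> b < T \<Longrightarrow> adjoint_primitive p y b \<psi>" "\<psi> 0 \<noteq> 0"
    "\<And>t. r \<le> t \<Longrightarrow> t < T \<Longrightarrow> 39/40 * norm (\<psi> t) \<le> \<psi> t \<bullet> e"
proof -
  obtain \<Psi> where \<Psi>: "\<And>b x. 0 \<le> b \<Longrightarrow> b < T \<Longrightarrow> adjoint_primitive p y b (\<lambda>t. \<Psi> t x)"
    "\<And>x. \<Psi> 0 x = x" and lin: "\<And>t. 0 \<le> t \<Longrightarrow> t < T \<Longrightarrow> linear (\<Psi> t)"
    and inj: "\<And>t. 0 \<le> t \<Longrightarrow> t < T \<Longrightarrow> inj (\<Psi> t)"
    using adjoint_flow[OF p T y] by metis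
  define K where "K t = {x. 39/40 * norm (\<Psi> t x) \<le> \<Psi> t x \<bullet> e}" for t
  have "sphere 0 1 \<inter> (\<Inter>t\<in>{r..<T}. K t) \<noteq> {}"
  proof (rule compact_imp_fip_image)
    show "compact (sphere (0::'a) 1)" by simp
    fix t assume "t \<in> {r..<T}"
    then have "continuous_on UNIV (\<Psi> t)"
      using lin[of t] r linear_continuous_on linear_conv_bounded_linear by auto
    then show "closed (K t)"
      unfolding K_def by (intro closed_Collect_le continuous_intros) auto
  next
    fix I assume I: "finite I" "I \<subseteq> {r..<T}"
    \<comment> \<open>The point \<open>r\<close> is inserted to cover the empty family.\<close>
    define s where "s = Max (insert r I)"
    have "s \<in> insert r I" unfolding s_def by (rule Max_in) (use I in auto)
    then have s: "r \<le> s" "s < T" using r I by auto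
    have le: "t \<le> s" if "t \<in> I" for t unfolding s_def using that I by auto
    have "surj (\<Psi> s)"
      using linear_injective_imp_surjective[OF lin inj] s r by auto
    then obtain x where x: "\<Psi> s x = e" by (metis surjD)
    have ls: "linear (\<Psi> s)" using lin s r by auto
    have x0: "x \<noteq> 0" using x e linear_0[OF ls] by auto
    have "sgn x \<in> K t" if t: "t \<in> I" for t
    proof -
      have lt: "linear (\<Psi> t)" using lin t I r by auto
      have "39/40 * norm (\<Psi> t (sgn x)) \<le> \<Psi> t (sgn x) \<bullet> e"
      proof (rule adjoint_cone_backward[OF p \<Psi>(1)[of s] _ e r(1), of t])
        show "continuous_on {0..s} y" using s by (auto intro: continuous_on_subset[OF y])
        show "\<Psi> 0 (sgn x) \<noteq> 0" using x0 \<Psi>(2) by (simp add: sgn_zero_iff)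
        show "39/40 * norm (\<Psi> s (sgn x)) < \<Psi> s (sgn x) \<bullet> e"
          using x0 e by (simp add: sgn_div_norm linear_cmul[OF ls] x dot_square_norm)
      qed (use s r cone le t I in auto)
      then show ?thesis by (simp add: K_def)
    qed
    then have "sgn x \<in> sphere 0 1 \<inter> (\<Inter>t\<in>I. K t)" using x0 by (simp add: norm_sgn)
    then show "sphere 0 1 \<inter> (\<Inter>t\<in>I. K t) \<noteq> {}" by blast
  qed
  then obtain x where "norm x = 1" "\<forall>t\<in>{r..<T}. x \<in> K t" by auto
  then show thesis using that[of "\<lambda>t. \<Psi> t x"] \<Psi> unfolding K_def by force
qed

text \<open>Here \<open>\<langle>\<psi>, y\<rangle>' = -(p-1) |y|^(p-1) \<langle>\<psi>, y\<rangle> + \<langle>\<psi>, g\<rangle>\<close>, whereas \<open>|y|^\<alpha>\<close> grows at relative rate about \<open>\<alpha> |y|^(p-1)\<close>. With \<open>\<alpha> = (p-1)/2\<close>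
half of the decay survives, and for large \<open>|y|\<close> it dominates the contribution of the forcing, because
the cone condition bounds \<open>|\<psi>||y|\<close> by \<open>\<langle>\<psi>, y\<rangle>\<close>. So \<open>\<langle>\<psi>, y\<rangle> |y|^\<alpha>\<close> stays bounded, and \<open>|\<psi>||y|\<close> is of order \<open>|y|^(-\<alpha>)\<close>.\<close>

lemma costate_decay:
  fixes y \<psi> :: "real \<Rightarrow> 'a::euclidean_space"
  assumes p: "p > 1" and g: "bounded_force M g" and r: "0 \<le> r" "r < T"
    and y: "\<And>b. 0 \<le> b \<Longrightarrow> b < T \<Longrightarrow> forced_solution p g b y"
    and \<psi>: "\<And>b. 0 \<le> b \<Longrightarrow> b < T \<Longrightarrow> adjoint_primitive p y b \<psi>"
    and blowup: "filterlim (\<lambda>t. norm (y t)) at_top (at_left T)"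
    and cone: "\<And>t. r \<le> t \<Longrightarrow> t < T \<Longrightarrow> 9/10 * (norm (\<psi> t) * norm (y t)) \<le> \<psi> t \<bullet> y t"
  shows "((\<lambda>t. norm (\<psi> t) * norm (y t)) \<longlongrightarrow> 0) (at_left T)"
proof -
  have M: "0 \<le> M" using g norm_ge_zero order_trans unfolding bounded_force_def by blast
  define \<alpha> where "\<alpha> = (p - 1) / 2"
  have \<alpha>: "\<alpha> > 0" using p by (simp add: \<alpha>_def)
  define R where "R = max 1 ((2 + \<alpha>) * M / \<alpha>)"
  have R: "R \<ge> 1" "(2 + \<alpha>) * M \<le> \<alpha> * R powr p"
  proof -
    show "R \<ge> 1" by (simp add: R_def)
    then have "R \<le> R powr p" using powr_mono[of 1 p R] p by simp
    moreover have "(2 + \<alpha>) * M / \<alpha> \<le> R" by (simp add: R_def)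
    ultimately have "(2 + \<alpha>) * M / \<alpha> \<le> R powr p" by linarith
    then show "(2 + \<alpha>) * M \<le> \<alpha> * R powr p" using \<alpha> by (simp add: field_simps)
  qed
  have "\<forall>\<^sub>F t in at_left T. R \<le> norm (y t)" using blowup unfolding filterlim_at_top by blast
  then obtain s' where s': "s' < T" "\<And>t. s' < t \<Longrightarrow> t < T \<Longrightarrow> R \<le> norm (y t)"
    using eventually_at_left[OF r(2)] by auto
  define s where "s = (max s' r + T) / 2"
  have s: "r \<le> s" "s < T" "s' < s" using s' r by (auto simp: s_def)
  have large: "R \<le> norm (y t)" if "s \<le> t" "t < T" for t using s'(2)[of t] that s by auto
  define Q where "Q t = (\<psi> t \<bullet> y t) * norm (y t) powr \<alpha>" for t
  have Q: "Q t \<le> Q s" if t: "s \<le> t" "t < T" for t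
  proof -
    have nz: "y q \<noteq> 0" if "q \<in> {s..t}" for q using large[of q] that t R by auto
    have yb: "bounded_primitive s t (\<lambda>q. power_field p (y q) + g q) y"
      using y[of t] t s r unfolding forced_solution_def by (auto intro: bounded_primitive_subinterval)
    have \<psi>b: "bounded_primitive s t (\<lambda>q. - power_jacobian p (y q) (\<psi> q)) \<psi>"
      using \<psi>[of t] t s r unfolding adjoint_primitive_def by (auto intro: bounded_primitive_subinterval)
    have Yb: "bounded_primitive s t (\<lambda>q. ((\<alpha> * norm (y q) powr (\<alpha> - 2)) *\<^sub>R y q) \<bullet> (power_field p (y q) + g q)) (\<lambda>q. norm (y q) powr \<alpha>)"
    proof (rule bounded_primitive_chain[OF yb, where G = "\<lambda>x. (\<alpha> * norm x powr (\<alpha> - 2)) *\<^sub>R x"])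
      show "continuous_on {s..t} (\<lambda>q. (\<alpha> * norm (y q) powr (\<alpha> - 2)) *\<^sub>R y q)"
        using nz by (intro continuous_intros bounded_primitive_continuous_on[OF yb]) auto
    qed (intro has_derivative_norm_powr nz)
    have "Q t - Q s \<le> 0 * (t - s)"
      unfolding Q_def
    proof (rule bounded_primitive_le[OF bounded_primitive_mult[OF bounded_primitive_inner[OF \<psi>b yb] Yb]])
      fix q assume q: "q \<in> {s..t}"
      define n u v X where "n = norm (y q)" and "u = n powr (p - 1)" and "v = n powr \<alpha>" and "X = \<psi> q \<bullet> y q"
      have n: "n > 0" "R \<le> n" using nz[OF q] large[of q] q t by (auto simp: n_def)
      have pw: "n powr p = u * n" "n powr (p - 3) = u / (n * n)" "n powr (\<alpha> - 2) = v / (n * n)" "u > 0" "v > 0"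
        using n powr_add[of n "p - 1" 1] powr_diff[of n "p - 1" 2] powr_diff[of n \<alpha> 2]
        by (auto simp: u_def v_def power2_eq_square)
      have J: "y q \<bullet> power_jacobian p (y q) (\<psi> q) = p * u * X"
      proof -
        have "y q \<bullet> power_jacobian p (y q) (\<psi> q) = u * X + (p - 1) * (u / (n * n)) * X * (n * n)"
          unfolding power_jacobian_def inner_add_right inner_scaleR_right
          by (simp add: n_def[symmetric] u_def[symmetric] pw dot_square_norm power2_eq_square X_def inner_commute[of "y q"])
        also have "\<dots> = u * X + (p - 1) * u * X" using n by simp
        finally show ?thesis by (simp add: algebra_simps)
      qed
      have f: "\<psi> q \<bullet> power_field p (y q) = u * X" by (simp add: power_field_def u_def n_def X_def)
      have gM: "norm (g q) \<le> M" using g q s r unfolding bounded_force_def by auto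
      have cq: "9/10 * (norm (\<psi> q) * n) \<le> X" using cone[of q] q s t by (simp add: n_def X_def)
      have X0: "0 \<le> X" using order_trans[OF _ cq] n by simp
      have "norm (\<psi> q) \<le> 2 * X / n" using cq X0 n by (simp add: field_simps)
      then have "norm (\<psi> q) * norm (g q) \<le> 2 * X / n * M" using gM X0 n by (intro mult_mono) auto
      then have b1: "\<psi> q \<bullet> g q \<le> 2 * X / n * M" using norm_cauchy_schwarz[of "\<psi> q" "g q"] by linarith
      have "n * norm (g q) \<le> n * M" using gM n by (intro mult_left_mono) auto
      then have b2: "y q \<bullet> g q \<le> n * M" using norm_cauchy_schwarz[of "y q" "g q"] by (simp add: n_def)
      have "norm (y q) powr \<alpha> * (y q \<bullet> - power_jacobian p (y q) (\<psi> q) + \<psi> q \<bullet> (power_field p (y q) + g q))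
          + (\<psi> q \<bullet> y q) * (((\<alpha> * norm (y q) powr (\<alpha> - 2)) *\<^sub>R y q) \<bullet> (power_field p (y q) + g q))
        = v * (- (p - 1) * u * X + \<psi> q \<bullet> g q) + X * (\<alpha> * (v / (n * n)) * (u * n * n + y q \<bullet> g q))"
        by (simp add: inner_add_right J f inner_power_field pw n_def[symmetric] v_def[symmetric] X_def[symmetric] algebra_simps)
      also have "\<dots> \<le> v * (- (p - 1) * u * X + 2 * X / n * M) + X * (\<alpha> * (v / (n * n)) * (u * n * n + n * M))"
      proof (rule add_mono)
        show "v * (- (p - 1) * u * X + \<psi> q \<bullet> g q) \<le> v * (- (p - 1) * u * X + 2 * X / n * M)"
          using pw by (intro mult_left_mono add_left_mono b1) auto
        show "X * (\<alpha> * (v / (n * n)) * (u * n * n + y q \<bullet> g q)) \<le> X * (\<alpha> * (v / (n * n)) * (u * n * n + n * M))"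
          using X0 n \<alpha> pw by (intro mult_left_mono add_left_mono b2) auto
      qed
      also have "\<dots> = (v * X / n) * ((2 + \<alpha>) * M - \<alpha> * (u * n))"
        using n by (simp add: \<alpha>_def field_simps)
      also have "\<dots> \<le> 0"
      proof (rule mult_nonneg_nonpos)
        have "R powr p \<le> n powr p" using n R p by (intro powr_mono2) auto
        then have "\<alpha> * R powr p \<le> \<alpha> * (u * n)" using \<alpha> pw by simp
        then show "(2 + \<alpha>) * M - \<alpha> * (u * n) \<le> 0" using R by linarith
      qed (use X0 pw n in auto)
      finally show "norm (y q) powr \<alpha> * (y q \<bullet> - power_jacobian p (y q) (\<psi> q) + \<psi> q \<bullet> (power_field p (y q) + g q))
          + (\<psi> q \<bullet> y q) * (((\<alpha> * norm (y q) powr (\<alpha> - 2)) *\<^sub>R y q) \<bullet> (power_field p (y q) + g q)) \<le> 0" .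
    qed (use t in auto)
    then show ?thesis by simp
  qed
  have bound: "norm (\<psi> t) * norm (y t) \<le> 2 * \<bar>Q s\<bar> * norm (y t) powr (- \<alpha>)" if t: "s \<le> t" "t < T" for t
  proof -
    let ?n = "norm (y t)"
    have n: "?n > 0" using large[OF t] R by linarith
    have "9/10 * (norm (\<psi> t) * ?n) * ?n powr \<alpha> \<le> Q t"
      unfolding Q_def using cone[of t] t s by (intro mult_right_mono) auto
    also have "\<dots> \<le> \<bar>Q s\<bar>" using Q[OF t] by linarith
    finally have "norm (\<psi> t) * ?n * ?n powr \<alpha> \<le> 2 * \<bar>Q s\<bar>" by simp
    then have "norm (\<psi> t) * ?n * ?n powr \<alpha> * ?n powr (- \<alpha>) \<le> 2 * \<bar>Q s\<bar> * ?n powr (- \<alpha>)"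
      by (intro mult_right_mono) auto
    moreover have "?n powr \<alpha> * ?n powr (- \<alpha>) = 1" using n by (simp flip: powr_add)
    ultimately show ?thesis by (simp add: mult.assoc)
  qed
  show ?thesis
  proof (rule Lim_null_comparison)
    show "\<forall>\<^sub>F t in at_left T. norm (norm (\<psi> t) * norm (y t)) \<le> 2 * \<bar>Q s\<bar> * norm (y t) powr (- \<alpha>)"
      using bound s by (auto simp: eventually_at_left[of s T] intro!: exI[of _ s])
    have "((\<lambda>t. norm (y t) powr (- \<alpha>)) \<longlongrightarrow> 0) (at_left T)"
      using \<alpha> by (intro tendsto_neg_powr blowup) auto
    then show "((\<lambda>t. 2 * \<bar>Q s\<bar> * norm (y t) powr (- \<alpha>)) \<longlongrightarrow> 0) (at_left T)"
      by (rule tendsto_mult_right_zero)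
  qed
qed

section \<open>The first-order condition\<close>

lemma linear_le_at_left:
  fixes t T :: real
  assumes "t < T" "\<And>b. t \<le> b \<Longrightarrow> b < T \<Longrightarrow> c * (b - t) \<le> X"
  shows "c * (T - t) \<le> X"
proof (rule tendsto_upperbound)
  show "((\<lambda>b. c * (b - t)) \<longlongrightarrow> c * (T - t)) (at_left T)" by (intro tendsto_intros)
  show "\<forall>\<^sub>F b in at_left T. c * (b - t) \<le> X"
    using assms by (auto simp: eventually_at_left[OF assms(1)] intro!: exI[of _ t])
qed simp

text \<open>Integrating the rate from \<open>t\<close> to \<open>T\<close>, where \<open>|y|^(1-p)\<close> reaches 0 and \<open>|z|^(1-p)\<close> stays nonnegative, gives
\<open>|y(t)|^(1-p) \<le> (3/2)(p-1)(T-t)\<close> and \<open>|z(t)|^(1-p) \<ge> (1/2)(p-1)(T-t)\<close>.\<close>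

lemma blowup_rate_comparison:
  fixes y z :: "real \<Rightarrow> 'a::euclidean_space"
  assumes p: "p > 1" and g: "bounded_force M g" and h: "bounded_force M h"
    and R: "R > 0" "2 * M \<le> R powr p" and t: "0 \<le> t" "t < T"
    and y: "\<And>b. 0 \<le> b \<Longrightarrow> b < T \<Longrightarrow> forced_solution p g b y"
    and z: "\<And>b. 0 \<le> b \<Longrightarrow> b < T \<Longrightarrow> forced_solution p h b z"
    and yR: "\<And>q. t \<le> q \<Longrightarrow> q < T \<Longrightarrow> R \<le> norm (y q)"
    and zR: "\<And>q. t \<le> q \<Longrightarrow> q < T \<Longrightarrow> R \<le> norm (z q)"
    and blowup: "filterlim (\<lambda>t. norm (y t)) at_top (at_left T)"
  shows "norm (z t) \<le> 3 powr (1 / (p - 1)) * norm (y t)"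
proof -
  let ?y = "norm (y t)" and ?z = "norm (z t)"
  have pos: "?y > 0" "?z > 0" using yR[of t] zR[of t] t R by auto
  have "(p - 1) / 2 * (T - t) \<le> ?z powr (1 - p)"
  proof (rule linear_le_at_left[OF t(2)])
    fix b assume b: "t \<le> b" "b < T"
    have "norm (z b) powr (1 - p) \<le> ?z powr (1 - p) - (p - 1) / 2 * (b - t)"
      using b t zR by (intro large_solution_rate(1)[OF z[of b] h p R]) auto
    then show "(p - 1) / 2 * (b - t) \<le> ?z powr (1 - p)"
      using powr_ge_zero[of "norm (z b)" "1 - p"] by linarith
  qed
  moreover have "?y powr (1 - p) - 3 * (p - 1) / 2 * (T - t) \<le> 0"
  proof (rule tendsto_le)
    show "((\<lambda>b. norm (y b) powr (1 - p)) \<longlongrightarrow> 0) (at_left T)"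
      using p by (intro tendsto_neg_powr blowup) auto
    show "((\<lambda>b. ?y powr (1 - p) - 3 * (p - 1) / 2 * (b - t)) \<longlongrightarrow> ?y powr (1 - p) - 3 * (p - 1) / 2 * (T - t)) (at_left T)"
      by (intro tendsto_intros)
    have "?y powr (1 - p) - 3 * (p - 1) / 2 * (b - t) \<le> norm (y b) powr (1 - p)" if b: "t < b" "b < T" for b
      using b t yR by (intro large_solution_rate(2)[OF y[of b] g p R]) auto
    then show "\<forall>\<^sub>F b in at_left T. ?y powr (1 - p) - 3 * (p - 1) / 2 * (b - t) \<le> norm (y b) powr (1 - p)"
      using t by (auto simp: eventually_at_left[OF t(2)] intro!: exI[of _ t])
  qed simp
  ultimately have le: "?y powr (1 - p) / 3 \<le> ?z powr (1 - p)" by (simp add: field_simps)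
  let ?a = "- (1 / (p - 1))"
  have a: "(1 - p) * ?a = 1" using p by (simp add: field_simps)
  have "(?z powr (1 - p)) powr ?a \<le> (?y powr (1 - p) / 3) powr ?a"
    using le pos p by (intro powr_mono2') auto
  moreover have "(?y powr (1 - p) / 3) powr ?a = ?y * 3 powr (1 / (p - 1))"
    using pos a by (simp add: powr_divide powr_powr powr_minus_divide)
  ultimately show ?thesis using pos a by (simp add: powr_powr mult.commute)
qed

text \<open>Stability needs a common bound on both solutions, which is known beforehand only for \<open>y\<close>. Until the distance reaches 1
the bound \<open>R\<close> is valid for \<open>z\<close> too, and then the distance is in fact below 1, so 1 is never reached.\<close>

lemma small_perturbation:
  fixes y z :: "real \<Rightarrow> 'a::euclidean_space"
  assumes p: "p > 1" and y: "forced_solution p g s y" and z: "forced_solution p h s z"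
    and eq: "z 0 = y 0" and s: "0 \<le> s" and gh: "\<And>t. t \<in> {0..s} \<Longrightarrow> norm (h t - g t) \<le> K"
    and R: "\<And>t. t \<in> {0..s} \<Longrightarrow> norm (y t) + 1 \<le> R"
    and small: "K * exp ((2 * p * R powr (p - 1) + 1) * s) < 1"
    and t: "t \<in> {0..s}"
  shows "norm (z t - y t) \<le> K * exp ((2 * p * R powr (p - 1) + 1) * s)" and "norm (z t) \<le> R"
proof -
  let ?E = "\<lambda>t. K * exp ((2 * p * R powr (p - 1) + 1) * t)"
  have K: "0 \<le> K" using order_trans[OF norm_ge_zero gh[of 0]] s by simp
  have E: "?E r \<le> ?E s" if "r \<le> s" for r
    using that p K by (intro mult_left_mono) (auto intro!: mult_left_mono add_nonneg_nonneg)
  have close: "norm (z r - y r) \<le> ?E s"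
    if r: "r \<in> {0..s}" and le1: "\<And>q. q \<in> {0..r} \<Longrightarrow> norm (z q - y q) \<le> 1" for r
  proof -
    have "norm (z r - y r) \<le> ?E r"
    proof (rule forced_solution_stability[OF p z y _ _ _ eq r])
      fix q assume q: "q \<in> {0..r}"
      then have qs: "q \<in> {0..s}" using r by auto
      show "norm (y q) \<le> R" using R[OF qs] by simp
      show "norm (z q) \<le> R" using R[OF qs] le1[OF q] norm_triangle_sub[of "z q" "y q"] by linarith
      show "norm (h q - g q) \<le> K" using gh[OF qs] .
    qed
    then show ?thesis using E[of r] r by simp
  qed
  have lt1: "norm (z r - y r) < 1" if r: "r \<in> {0..s}" for r
  proof (rule ccontr)
    assume "\<not> norm (z r - y r) < 1"
    moreover have "continuous_on {0..s} (\<lambda>r. norm (z r - y r))"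
      by (intro continuous_intros forced_solution_continuous[OF y] forced_solution_continuous[OF z])
    ultimately obtain \<tau> where \<tau>: "0 < \<tau>" "\<tau> \<le> r" "norm (z \<tau> - y \<tau>) = 1" "\<And>q. 0 \<le> q \<Longrightarrow> q < \<tau> \<Longrightarrow> norm (z q - y q) < 1"
      using first_hitting_time[of 0 s "\<lambda>r. norm (z r - y r)" 1 r] eq r by auto
    have "norm (z q - y q) \<le> 1" if "q \<in> {0..\<tau>}" for q
      using \<tau>(3) \<tau>(4)[of q] that by (cases "q = \<tau>") auto
    then have "norm (z \<tau> - y \<tau>) \<le> ?E s" using \<tau> r by (intro close) auto
    then show False using \<tau>(3) small by linarith
  qed
  show "norm (z t - y t) \<le> ?E s"
    using lt1 t by (intro close) (auto intro: less_imp_le)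
  show "norm (z t) \<le> R" using R[OF t] lt1[OF t] norm_triangle_sub[of "z t" "y t"] by linarith
qed

text \<open>The linear parts cancel because \<open>J(y)\<close> is symmetric and \<open>\<psi>\<close> solves the adjoint equation.\<close>

lemma pairing_primitive:
  assumes y: "forced_solution p g b y" and z: "forced_solution p (\<lambda>t. g t + \<theta> *\<^sub>R k t) b z"
    and \<psi>: "adjoint_primitive p y b \<psi>"
  shows "bounded_primitive 0 b
    (\<lambda>t. \<psi> t \<bullet> (power_field p (z t) - power_field p (y t) - power_jacobian p (y t) (z t - y t)) + \<theta> * (\<psi> t \<bullet> k t))
    (\<lambda>t. \<psi> t \<bullet> (z t - y t))"
proof -
  have "bounded_primitive 0 b
    (\<lambda>t. (z t - y t) \<bullet> (- power_jacobian p (y t) (\<psi> t)) + \<psi> t \<bullet> ((power_field p (z t) + (g t + \<theta> *\<^sub>R k t)) - (power_field p (y t) + g t)))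
    (\<lambda>t. \<psi> t \<bullet> (z t - y t))"
    using assms unfolding forced_solution_def adjoint_primitive_def
    by (intro bounded_primitive_inner bounded_primitive_diff)
  then show ?thesis
  proof (rule bounded_primitive_cong)
    fix t
    have "(z t - y t) \<bullet> power_jacobian p (y t) (\<psi> t) = \<psi> t \<bullet> power_jacobian p (y t) (z t - y t)"
      using power_jacobian_sym[of p "y t" "\<psi> t" "z t - y t"] by (simp add: inner_commute)
    then show "(z t - y t) \<bullet> (- power_jacobian p (y t) (\<psi> t)) + \<psi> t \<bullet> ((power_field p (z t) + (g t + \<theta> *\<^sub>R k t)) - (power_field p (y t) + g t))
      = \<psi> t \<bullet> (power_field p (z t) - power_field p (y t) - power_jacobian p (y t) (z t - y t)) + \<theta> * (\<psi> t \<bullet> k t)"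
      by (simp add: inner_diff_right inner_add_right)
  qed simp
qed

text \<open>A positive value of \<open>\<langle>\<psi>, z - y\<rangle>\<close> at time \<open>s\<close> would be preserved until \<open>T\<close> by convexity, although the pairing is bounded by
a multiple of \<open>|\<psi>||y|\<close>, which tends to 0. The cosine of \<open>z\<close> to \<open>e\<close> starts at 118/120 and loses at most
1/120, which leaves 117/120 = 39/40.\<close>

lemma pairing_nonpos:
  fixes y z \<psi> :: "real \<Rightarrow> 'a::euclidean_space"
  assumes p: "p > 1" and g: "bounded_force M g" and h: "bounded_force M (\<lambda>t. g t + \<theta> *\<^sub>R k t)"
    and R: "R > 0" "2 * M \<le> R powr p" "2 * M / R * T \<le> 1/120" and s: "0 \<le> s" "s < T"
    and y: "\<And>b. 0 \<le> b \<Longrightarrow> b < T \<Longrightarrow> forced_solution p g b y"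
    and z: "\<And>b. 0 \<le> b \<Longrightarrow> b < T \<Longrightarrow> forced_solution p (\<lambda>t. g t + \<theta> *\<^sub>R k t) b z"
    and \<psi>: "\<And>b. 0 \<le> b \<Longrightarrow> b < T \<Longrightarrow> adjoint_primitive p y b \<psi>" and nz: "\<psi> 0 \<noteq> 0"
    and k: "\<And>t. s \<le> t \<Longrightarrow> k t = 0" and e: "norm e = 1"
    and blowup: "filterlim (\<lambda>t. norm (y t)) at_top (at_left T)"
    and yR: "\<And>t. s \<le> t \<Longrightarrow> t < T \<Longrightarrow> R < norm (y t) \<and> 39/40 * norm (y t) \<le> y t \<bullet> e"
    and zR: "R < norm (z s)" "118/120 * norm (z s) \<le> z s \<bullet> e"
    and \<psi>e: "\<And>t. s \<le> t \<Longrightarrow> t < T \<Longrightarrow> 39/40 * norm (\<psi> t) \<le> \<psi> t \<bullet> e"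
    and decay: "((\<lambda>t. norm (\<psi> t) * norm (y t)) \<longlongrightarrow> 0) (at_left T)"
  shows "\<psi> s \<bullet> (z s - y s) \<le> 0"
proof -
  have M: "0 \<le> M" using g norm_ge_zero order_trans unfolding bounded_force_def by blast
  have zlarge: "R < norm (z t)" if t: "s \<le> t" "t < T" for t
  proof -
    have "norm (z s) \<le> norm (z t)"
      using t s zR R M by (intro large_solution_norm_mono[OF z[of t] h p, of R]) auto
    then show ?thesis using zR by simp
  qed
  have ze: "39/40 * norm (z t) \<le> z t \<bullet> e" if t: "s \<le> t" "t < T" for t
  proof -
    have "z s \<bullet> e / norm (z s) - 2 * M / R * (t - s) \<le> z t \<bullet> e / norm (z t)"
      using t s zlarge by (intro large_solution_direction[OF z[of t] h R(1) e]) (auto intro: less_imp_le)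
    moreover have "2 * M / R * (t - s) \<le> 2 * M / R * T"
      using t s M R by (intro mult_left_mono) auto
    moreover have "118/120 \<le> z s \<bullet> e / norm (z s)"
      using zR R order.strict_trans[OF R(1) zR(1)] by (simp only: pos_le_divide_eq)
    ultimately have "39/40 \<le> z t \<bullet> e / norm (z t)" using R by linarith
    then show ?thesis using order.strict_trans[OF R(1) zlarge[OF t]] by (simp only: pos_le_divide_eq)
  qed
  have \<psi>nz: "\<psi> t \<noteq> 0" if "0 \<le> t" "t < T" for t
    by (rule adjoint_primitive_nonzero[OF p \<psi>[of t] _ _ nz])
      (use that forced_solution_continuous[OF y[of t]] in auto)
  have mono: "\<psi> s \<bullet> (z s - y s) \<le> \<psi> t \<bullet> (z t - y t)" if t: "s \<le> t" "t < T" for t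
  proof -
    have t': "0 \<le> t" "t < T" using t s by auto
    have "0 * (t - s) \<le> \<psi> t \<bullet> (z t - y t) - \<psi> s \<bullet> (z s - y s)"
    proof (rule bounded_primitive_ge[OF pairing_primitive[OF y[OF t'] z[OF t'] \<psi>[OF t']]])
      fix q assume "q \<in> {s..t}"
      then have q: "s \<le> q" "q < T" "0 \<le> q" using t s by auto
      have "0 \<le> \<psi> q \<bullet> (power_field p (z q) - power_field p (y q) - power_jacobian p (y q) (z q - y q))"
      proof (rule power_field_convex_in_cone[OF p])
        show "z q \<noteq> 0" "y q \<noteq> 0" using zlarge[OF q(1,2)] yR[OF q(1,2)] R by auto
        show "9/10 * (norm (\<psi> q) * norm (z q)) \<le> \<psi> q \<bullet> z q" "9/10 * (norm (\<psi> q) * norm (y q)) \<le> \<psi> q \<bullet> y q"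
          using \<psi>e[OF q(1,2)] ze[OF q(1,2)] yR[OF q(1,2)] inner_ge_of_common_cone[OF e] by blast+
      qed (use \<psi>nz q in auto)
      then show "0 \<le> \<psi> q \<bullet> (power_field p (z q) - power_field p (y q) - power_jacobian p (y q) (z q - y q)) + \<theta> * (\<psi> q \<bullet> k q)"
        using k[OF q(1)] by simp
    qed (use t s in auto)
    then show ?thesis by simp
  qed
  let ?c = "3 powr (1 / (p - 1)) + 1"
  have upper: "\<psi> t \<bullet> (z t - y t) \<le> ?c * (norm (\<psi> t) * norm (y t))" if t: "s \<le> t" "t < T" for t
  proof -
    have "norm (z t) \<le> 3 powr (1 / (p - 1)) * norm (y t)"
      using t s zlarge yR by (intro blowup_rate_comparison[OF p g h R(1,2) _ t(2) y z _ _ blowup]) (auto intro: less_imp_le)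
    then have "norm (z t - y t) \<le> ?c * norm (y t)"
      using norm_triangle_ineq4[of "z t" "y t"] by (simp add: algebra_simps)
    then have "norm (\<psi> t) * norm (z t - y t) \<le> norm (\<psi> t) * (?c * norm (y t))" by (intro mult_left_mono) auto
    then show ?thesis using norm_cauchy_schwarz[of "\<psi> t" "z t - y t"] by (simp add: mult.left_commute)
  qed
  show ?thesis
  proof (rule tendsto_lowerbound)
    show "((\<lambda>t. ?c * (norm (\<psi> t) * norm (y t))) \<longlongrightarrow> 0) (at_left T)"
      by (rule tendsto_mult_right_zero[OF decay])
    have "\<psi> s \<bullet> (z s - y s) \<le> ?c * (norm (\<psi> t) * norm (y t))" if "s < t" "t < T" for t
      using mono[of t] upper[of t] that by linarith
    then show "\<forall>\<^sub>F t in at_left T. \<psi> s \<bullet> (z s - y s) \<le> ?c * (norm (\<psi> t) * norm (y t))"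
      using s by (auto simp: eventually_at_left[OF s(2)] intro!: exI[of _ s])
  qed simp
qed

text \<open>For small \<open>\<theta>\<close> the pairing \<open>\<langle>\<psi>, z - y\<rangle>\<close> at time \<open>s\<close> equals \<open>\<theta> \<integral>\<langle>\<psi>, k\<rangle> + o(\<theta>)\<close>, while after \<open>s\<close> the two trajectories have the same forcing.
A positive integral would therefore make the pairing positive at \<open>s\<close>.\<close>

lemma first_order_condition:
  fixes y \<psi> g k :: "real \<Rightarrow> 'a::euclidean_space"
  assumes p: "p > 1" and gk: "\<And>\<theta>. 0 \<le> \<theta> \<Longrightarrow> \<theta> \<le> 1 \<Longrightarrow> bounded_force M (\<lambda>t. g t + \<theta> *\<^sub>R k t)"
    and R: "R > 0" "2 * M \<le> R powr p" "2 * M / R * T \<le> 1/120" and s: "0 \<le> s" "s < T"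
    and y: "\<And>b. 0 \<le> b \<Longrightarrow> b < T \<Longrightarrow> forced_solution p g b y"
    and pert: "\<And>\<theta>. 0 \<le> \<theta> \<Longrightarrow> \<theta> \<le> 1 \<Longrightarrow>
        \<exists>z. z 0 = y 0 \<and> (\<forall>b. 0 \<le> b \<longrightarrow> b < T \<longrightarrow> forced_solution p (\<lambda>t. g t + \<theta> *\<^sub>R k t) b z)"
    and \<psi>: "\<And>b. 0 \<le> b \<Longrightarrow> b < T \<Longrightarrow> adjoint_primitive p y b \<psi>" and nz: "\<psi> 0 \<noteq> 0"
    and k: "\<And>t. s \<le> t \<Longrightarrow> k t = 0" and e: "norm e = 1"
    and blowup: "filterlim (\<lambda>t. norm (y t)) at_top (at_left T)"
    and yR: "\<And>t. s \<le> t \<Longrightarrow> t < T \<Longrightarrow> R < norm (y t) \<and> 119/120 * norm (y t) \<le> y t \<bullet> e"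
    and \<psi>e: "\<And>t. s \<le> t \<Longrightarrow> t < T \<Longrightarrow> 39/40 * norm (\<psi> t) \<le> \<psi> t \<bullet> e"
    and decay: "((\<lambda>t. norm (\<psi> t) * norm (y t)) \<longlongrightarrow> 0) (at_left T)"
  shows "integral {0..s} (\<lambda>t. \<psi> t \<bullet> k t) \<le> 0"
proof (rule ccontr)
  define I where "I = integral {0..s} (\<lambda>t. \<psi> t \<bullet> k t)"
  assume "\<not> integral {0..s} (\<lambda>t. \<psi> t \<bullet> k t) \<le> 0"
  then have I: "I > 0" by (simp add: I_def)
  have g: "bounded_force M g" using gk[of 0] by simp
  have M: "0 \<le> M" using g norm_ge_zero order_trans unfolding bounded_force_def by blast
  have kM: "norm (k t) \<le> 2 * M" if "0 \<le> t" for t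
  proof -
    have "norm (g t + 1 *\<^sub>R k t) \<le> M" "norm (g t) \<le> M"
      using g gk[of 1] that unfolding bounded_force_def by auto
    then show ?thesis using norm_triangle_ineq4[of "g t + k t" "g t"] by simp
  qed
  have km: "k \<in> borel_measurable (lebesgue_on {0..s})"
    using borel_measurable_diff[OF bounded_force_measurable[OF gk[of 1], of 0 s] bounded_force_measurable[OF g, of 0 s]] by simp
  have \<psi>c: "continuous_on {0..s} \<psi>"
    using \<psi>[OF s] bounded_primitive_continuous_on unfolding adjoint_primitive_def by blast
  have \<psi>b: "norm (\<psi> t) \<le> norm (\<psi> 0)" if "t \<in> {0..s}" for t
    by (rule adjoint_primitive_norm_le[OF p \<psi>[OF s] that])
  have \<psi>k: "((\<lambda>t. \<psi> t \<bullet> k t) has_integral I) {0..s}"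
    unfolding I_def
  proof (rule integrable_integral, rule integrable_bounded_measurable[where C = "norm (\<psi> 0) * (2 * M)"])
    show "(\<lambda>t. \<psi> t \<bullet> k t) \<in> borel_measurable (lebesgue_on {0..s})"
      by (intro borel_measurable_inner km continuous_imp_measurable_on_sets_lebesgue[OF \<psi>c]) auto
    fix t assume t: "t \<in> {0..s}"
    have "norm (\<psi> t) * norm (k t) \<le> norm (\<psi> 0) * (2 * M)"
      using t \<psi>b[OF t] kM[of t] by (intro mult_mono) auto
    then show "norm (\<psi> t \<bullet> k t) \<le> norm (\<psi> 0) * (2 * M)"
      using Cauchy_Schwarz_ineq2[of "\<psi> t" "k t"] by simp
  qed
  have "bounded (y ` {0..s})"
    using forced_solution_continuous[OF y[OF s]] by (simp add: compact_continuous_image compact_imp_bounded)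
  then obtain N where N: "\<And>t. t \<in> {0..s} \<Longrightarrow> norm (y t) \<le> N" unfolding bounded_iff by blast
  define C where "C = 2 * M * exp ((2 * p * (N + 1) powr (p - 1) + 1) * s)"
  have C: "0 \<le> C" using M by (simp add: C_def)
  \<comment> \<open>Integrated over \<open>[0,s]\<close>, the linearization error is at most \<open>\<theta> C |\<psi> 0| s \<epsilon>\<close>; this \<epsilon> keeps it below \<open>\<theta> I\<close>.\<close>
  define D where "D = (norm (\<psi> 0) + 1) * (C + 1) * (s + 1)"
  have D: "0 < D" using C s unfolding D_def by (intro mult_pos_pos add_nonneg_pos) auto
  define \<epsilon> where "\<epsilon> = I / (2 * D)"
  have \<epsilon>: "0 < \<epsilon>" using I D by (simp add: \<epsilon>_def)
  have "norm (\<psi> 0) * C * s \<le> D"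
    using C s unfolding D_def by (intro mult_mono) auto
  then have "norm (\<psi> 0) * C * s * \<epsilon> \<le> D * \<epsilon>"
    using \<epsilon> by (intro mult_right_mono) auto
  also have "\<dots> = I / 2" using D by (simp add: \<epsilon>_def)
  finally have \<epsilon>': "norm (\<psi> 0) * C * s * \<epsilon> < I" using I by simp
  obtain \<delta> where \<delta>: "\<delta> > 0" "\<And>x w :: 'a. norm x \<le> N + 1 \<Longrightarrow> norm w \<le> N + 1 \<Longrightarrow> norm (x - w) < \<delta> \<Longrightarrow>
      norm (power_field p x - power_field p w - power_jacobian p w (x - w)) \<le> \<epsilon> * norm (x - w)"
    using power_field_linearization[OF p \<epsilon>] by metis
  \<comment> \<open>The distance of \<open>z\<close> and \<open>y\<close> will be at most \<open>\<mu>\<close>. It must stay below 1 and below the linearization radius, keep \<open>|z s| > R\<close>,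
  and turn the direction of \<open>z s\<close> by at most 1/120 in terms of cosines.\<close>
  define \<mu> where "\<mu> = min (min (1/2) (\<delta> / 2)) (min ((norm (y s) - R) / 2) (R / 240))"
  have ys: "R < norm (y s)" "119/120 * norm (y s) \<le> y s \<bullet> e" using yR[of s] s by auto
  have \<mu>: "0 < \<mu>" "\<mu> \<le> 1/2" "\<mu> < \<delta>" "\<mu> < norm (y s) - R" "\<mu> \<le> R / 240"
    using \<delta>(1) ys R(1) by (auto simp: \<mu>_def min_less_iff_disj min_le_iff_disj)
  define \<theta> where "\<theta> = min 1 (\<mu> / (C + 1))"
  have \<theta>: "0 < \<theta>" "\<theta> \<le> 1" using \<mu>(1) C by (auto simp: \<theta>_def)
  have "\<theta> * C \<le> \<mu> / (C + 1) * (C + 1)" using \<mu>(1) C by (intro mult_mono) (auto simp: \<theta>_def)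
  then have \<theta>C: "\<theta> * C \<le> \<mu>" using C by simp
  obtain z where z: "z 0 = y 0" "\<And>b. 0 \<le> b \<Longrightarrow> b < T \<Longrightarrow> forced_solution p (\<lambda>t. g t + \<theta> *\<^sub>R k t) b z"
    using pert[of \<theta>] \<theta> by auto
  have d: "norm (z t - y t) \<le> \<theta> * C" "norm (z t) \<le> N + 1" if t: "t \<in> {0..s}" for t
  proof -
    have "norm ((g r + \<theta> *\<^sub>R k r) - g r) \<le> \<theta> * (2 * M)" if "r \<in> {0..s}" for r
      using kM[of r] that \<theta> by (simp add: mult_left_mono)
    note sp = small_perturbation[OF p y[OF s] z(2)[OF s] z(1) s(1) this _ _ t, of "N + 1"]
    have "\<theta> * (2 * M) * exp ((2 * p * (N + 1) powr (p - 1) + 1) * s) = \<theta> * C" by (simp add: C_def)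
    then show "norm (z t - y t) \<le> \<theta> * C" "norm (z t) \<le> N + 1"
      using sp N \<theta>C \<mu>(2) by auto
  qed
  have "\<theta> * I - norm (\<psi> 0) * (\<epsilon> * (\<theta> * C)) * s \<le> \<psi> s \<bullet> (z s - y s) - \<psi> 0 \<bullet> (z 0 - y 0)"
  proof (rule has_integral_le)
    show "((\<lambda>t. \<psi> t \<bullet> (power_field p (z t) - power_field p (y t) - power_jacobian p (y t) (z t - y t)) + \<theta> * (\<psi> t \<bullet> k t))
       has_integral (\<psi> s \<bullet> (z s - y s) - \<psi> 0 \<bullet> (z 0 - y 0))) {0..s}"
      using bounded_primitive_has_integral[OF pairing_primitive[OF y[OF s] z(2)[OF s] \<psi>[OF s]], of 0 s] s by simp
    show "((\<lambda>t. \<theta> * (\<psi> t \<bullet> k t) - norm (\<psi> 0) * (\<epsilon> * (\<theta> * C))) has_integral (\<theta> * I - norm (\<psi> 0) * (\<epsilon> * (\<theta> * C)) * s)) {0..s}"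
      using has_integral_diff[OF has_integral_mult_right[OF \<psi>k, of \<theta>]
          has_integral_const_real[of "norm (\<psi> 0) * (\<epsilon> * (\<theta> * C))" 0 s]] s
      by (simp add: mult.commute[of s])
    fix t assume t: "t \<in> {0..s}"
    let ?r = "power_field p (z t) - power_field p (y t) - power_jacobian p (y t) (z t - y t)"
    have "norm ?r \<le> \<epsilon> * norm (z t - y t)"
      using d[OF t] N[OF t] \<theta>C \<mu>(3) by (intro \<delta>(2)) auto
    also have "\<dots> \<le> \<epsilon> * (\<theta> * C)" using d[OF t] \<epsilon> by (intro mult_left_mono) auto
    finally have "norm (\<psi> t) * norm ?r \<le> norm (\<psi> 0) * (\<epsilon> * (\<theta> * C))"
      using \<psi>b[OF t] by (intro mult_mono) auto
    then have "- (norm (\<psi> 0) * (\<epsilon> * (\<theta> * C))) \<le> \<psi> t \<bullet> ?r"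
      using Cauchy_Schwarz_ineq2[of "\<psi> t" ?r] by linarith
    then show "\<theta> * (\<psi> t \<bullet> k t) - norm (\<psi> 0) * (\<epsilon> * (\<theta> * C)) \<le> \<psi> t \<bullet> ?r + \<theta> * (\<psi> t \<bullet> k t)" by simp
  qed
  moreover have "norm (\<psi> 0) * (\<epsilon> * (\<theta> * C)) * s = \<theta> * (norm (\<psi> 0) * C * s * \<epsilon>)" by simp
  ultimately have "\<theta> * (I - norm (\<psi> 0) * C * s * \<epsilon>) \<le> \<psi> s \<bullet> (z s - y s)" using z(1) by (simp add: right_diff_distrib)
  moreover have "0 < \<theta> * (I - norm (\<psi> 0) * C * s * \<epsilon>)" using \<theta> \<epsilon>' by simp
  ultimately have pos: "0 < \<psi> s \<bullet> (z s - y s)" by linarith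
  have ds: "norm (z s - y s) \<le> \<mu>" using d(1)[of s] s \<theta>C by auto
  have zs: "R < norm (z s)" using ds \<mu>(4) norm_triangle_sub[of "y s" "z s"] by (simp add: norm_minus_commute)
  have "\<bar>(z s - y s) \<bullet> e\<bar> \<le> \<mu>" using Cauchy_Schwarz_ineq2[of "z s - y s" e] e ds by simp
  moreover have "norm (z s) - \<mu> \<le> norm (y s)" using ds norm_triangle_sub[of "z s" "y s"] by simp
  ultimately have "118/120 * norm (z s) \<le> z s \<bullet> e"
    using ys(2) \<mu>(5) zs unfolding inner_diff_left abs_le_iff by argo
  moreover have "R < norm (y t) \<and> 39/40 * norm (y t) \<le> y t \<bullet> e" if "s \<le> t" "t < T" for t
  proof -
    have "39/40 * norm (y t) \<le> 119/120 * norm (y t)" by simp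
    then show ?thesis using yR[OF that] by linarith
  qed
  ultimately have "\<psi> s \<bullet> (z s - y s) \<le> 0"
    using zs \<theta> by (intro pairing_nonpos[OF p g gk[of \<theta>] R s y z(2) \<psi> nz k e blowup _ _ _ \<psi>e decay]) auto
  then show False using pos by simp
qed

section \<open>Null sets and half-open intervals\<close>

lemma AE_lebesgue_on_negligibleI:
  assumes "negligible N" "S \<in> sets lebesgue" "\<And>t. t \<in> S \<Longrightarrow> t \<notin> N \<Longrightarrow> P t"
  shows "AE t in lebesgue_on S. P t"
proof (rule AE_I')
  have "N \<inter> S \<in> null_sets lebesgue"
    using assms(1) by (metis inf_le1 negligible_iff_null_sets negligible_subset)
  then show "N \<inter> S \<in> null_sets (lebesgue_on S)"
    using assms(2) by (simp add: null_sets_restrict_space)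
qed (use assms(3) in auto)

lemma AE_lebesgue_on_negligible:
  assumes "AE t in lebesgue_on S. P t" "S \<in> sets lebesgue"
  shows "negligible {t \<in> S. \<not> P t}"
proof -
  obtain N where N: "N \<in> null_sets (lebesgue_on S)" "{t \<in> space (lebesgue_on S). \<not> P t} \<subseteq> N"
    using assms(1) unfolding eventually_ae_filter by blast
  then have "negligible N" using assms(2) by (simp add: null_sets_restrict_space negligible_iff_null_sets)
  then show ?thesis using N(2) by (auto intro: negligible_subset)
qed

lemma negligible_of_integral_le_0:
  fixes F :: "real \<Rightarrow> real"
  assumes F: "F \<in> borel_measurable (lebesgue_on {a..b})"
    and b: "\<And>t. t \<in> {a..b} \<Longrightarrow> 0 \<le> F t" "\<And>t. t \<in> {a..b} \<Longrightarrow> F t \<le> C"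
    and i: "integral {a..b} F \<le> 0"
  shows "negligible {t \<in> {a..b}. F t \<noteq> 0}"
proof -
  have int: "integrable (lebesgue_on {a..b}) F"
  proof (rule Bochner_Integration.integrable_bound)
    show "integrable (lebesgue_on {a..b}) (\<lambda>_. C)" by simp
    show "AE t in lebesgue_on {a..b}. norm (F t) \<le> norm C"
      using b by (intro AE_I2) force
  qed (rule F)
  have "0 \<le> integral\<^sup>L (lebesgue_on {a..b}) F" using b by (intro integral_nonneg_AE AE_I2) auto
  then have "integral\<^sup>L (lebesgue_on {a..b}) F = 0" using lebesgue_integral_eq_integral[OF int] i by simp
  moreover have "AE t in lebesgue_on {a..b}. 0 \<le> F t" using b by (intro AE_I2) auto
  ultimately have "AE t in lebesgue_on {a..b}. F t = 0" using integral_nonneg_eq_0_iff_AE[OF int] by blast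
  then show ?thesis using AE_lebesgue_on_negligible[where S = "{a..b}"] by simp
qed

lemma at_within_half_open:
  fixes t T :: real
  assumes "0 \<le> t" "t < b" "b < T"
  shows "at t within {0..<T} = at t within {0..b}"
  by (rule at_within_nhd[of _ "{..<b}"]) (use assms in auto)

lemma continuous_on_half_open:
  fixes f :: "real \<Rightarrow> 'a::topological_space"
  assumes "\<And>b. 0 \<le> b \<Longrightarrow> b < T \<Longrightarrow> continuous_on {0..b} f"
  shows "continuous_on {0..<T} f"
  unfolding continuous_on_eq_continuous_within
proof
  fix t assume t: "t \<in> {0..<T}"
  define b where "b = (t + T) / 2"
  have b: "0 \<le> t" "t < b" "b < T" using t by (auto simp: b_def)
  then have "continuous (at t within {0..b}) f"
    using assms[of b] unfolding continuous_on_eq_continuous_within by auto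
  then show "continuous (at t within {0..<T}) f" by (simp add: at_within_half_open[OF b])
qed

section \<open>From forced equations to the control problem\<close>

lemma blowup_jacobian_mult: "blowup_jacobian p y *v v = power_jacobian p y v"
proof (cases "y = 0")
  case False
  have "(\<chi> i j. y $ i * y $ j) *v v = (y \<bullet> v) *\<^sub>R y"
    by (simp add: vec_eq_iff matrix_vector_mult_def inner_vec_def sum_distrib_left sum_distrib_right mult.assoc mult.commute mult.left_commute)
  moreover have "norm y powr (p - 3) = norm y powr (p - 1) / (norm y)\<^sup>2"
    using False powr_diff[of "norm y" "p - 1" 2] by simp
  ultimately show ?thesis
    using False by (simp add: blowup_jacobian_def power_jacobian_def matrix_vector_mult_add_rdistrib
        scaleR_matrix_vector_assoc[symmetric] scaleR_add_right)
qed (simp add: blowup_jacobian_def power_jacobian_def)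

lemma adjoint_solution_of_primitives:
  assumes p: "p > 1" and y: "continuous_on {0..<T} y"
    and \<psi>: "\<And>b. 0 \<le> b \<Longrightarrow> b < T \<Longrightarrow> adjoint_primitive p y b \<psi>"
  shows "adjoint_solution p T y \<psi>"
  unfolding adjoint_solution_def
proof (intro conjI ballI)
  have \<psi>b: "continuous_on {0..b} \<psi>" if "0 \<le> b" "b < T" for b
    using \<psi>[OF that] unfolding adjoint_primitive_def by (rule bounded_primitive_continuous_on)
  then show "continuous_on {0..<T} \<psi>" by (rule continuous_on_half_open)
  fix t assume t: "t \<in> {0..<T}"
  define b where "b = (t + T) / 2"
  have b: "0 \<le> t" "t < b" "b < T" "t \<in> {0..b}" "0 \<le> b" using t by (auto simp: b_def)
  let ?h = "\<lambda>t. - power_jacobian p (y t) (\<psi> t)"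
  have "continuous_on {0..b} ?h"
    using b by (intro continuous_on_minus continuous_on_power_jacobian[OF p] \<psi>b continuous_on_subset[OF y]) auto
  then have "((\<lambda>u. integral {0..u} ?h) has_vector_derivative ?h t) (at t within {0..b})"
    using b by (intro integral_has_vector_derivative)
  then have "((\<lambda>u. \<psi> 0 + integral {0..u} ?h) has_vector_derivative ?h t) (at t within {0..b})"
    using has_vector_derivative_add[OF has_vector_derivative_const] by fastforce
  then have "(\<psi> has_vector_derivative ?h t) (at t within {0..b})"
  proof (rule has_vector_derivative_transform[OF b(4), rotated])
    fix u assume u: "u \<in> {0..b}"
    have "integral {0..u} ?h = \<psi> u - \<psi> 0"
      by (rule integral_unique)
        (use bounded_primitive_has_integral[OF \<psi>[unfolded adjoint_primitive_def], of b 0 u] u b in auto)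
    then show "\<psi> u = \<psi> 0 + integral {0..u} ?h" by (simp only: algebra_simps)
  qed
  then show "(\<psi> has_vector_derivative - (blowup_jacobian p (y t) *v \<psi> t)) (at t within {0..<T})"
    by (simp add: blowup_jacobian_mult at_within_half_open[OF b(1-3)])
qed

lemma bounded_bilinear_matrix_vector_mult:
  "bounded_bilinear ((*v) :: real^'m^'n \<Rightarrow> real^'m \<Rightarrow> real^'n)"
  unfolding bilinear_conv_bounded_bilinear[symmetric] bilinear_def
  by (auto simp: linear_iff matrix_vector_mult_add_rdistrib scaleR_matrix_vector_assoc
      matrix_vector_right_distrib matrix_vector_mult_scaleR)

lemma bounded_bilinear_vector_matrix_mult:
  "bounded_bilinear ((v*) :: real^'n \<Rightarrow> real^'m^'n \<Rightarrow> real^'m)"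
  unfolding bilinear_conv_bounded_bilinear[symmetric] bilinear_def
  by (auto simp: linear_iff vec_eq_iff vector_matrix_mult_def algebra_simps sum.distrib sum_distrib_left)

lemma essentially_bounded_version:
  fixes B :: "real \<Rightarrow> 'a::euclidean_space"
  assumes "essentially_bounded_on {0..} B"
  obtains B' C N where "B' \<in> borel_measurable (lebesgue_on {0..})" "\<And>t. norm (B' t) \<le> C"
    "negligible N" "\<And>t. 0 \<le> t \<Longrightarrow> t \<notin> N \<Longrightarrow> B' t = B t"
proof -
  obtain C where Bm: "B \<in> borel_measurable (lebesgue_on {0..})" and C: "AE t in lebesgue_on {0..}. norm (B t) \<le> C"
    using assms unfolding essentially_bounded_on_def by blast
  define B' where "B' t = (if norm (B t) \<le> C then B t else 0)" for t
  show thesis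
  proof (rule that)
    show "B' \<in> borel_measurable (lebesgue_on {0..})" unfolding B'_def using Bm by measurable
    show "norm (B' t) \<le> max C 0" for t by (auto simp: B'_def)
    show "negligible {t \<in> {0..}. \<not> norm (B t) \<le> C}" by (rule AE_lebesgue_on_negligible[OF C]) simp
  qed (auto simp: B'_def)
qed

lemma control_force_bounded:
  fixes B :: "real \<Rightarrow> real^'m^'n"
  assumes B: "B \<in> borel_measurable (lebesgue_on {0..})" "\<And>t. 0 \<le> t \<Longrightarrow> norm (B t) \<le> C"
  obtains M where "\<And>u. u \<in> admissible_controls \<rho> \<Longrightarrow> bounded_force M (\<lambda>t. B t *v u t)"
proof -
  obtain K where K: "0 \<le> K" "\<And>A x. norm ((A :: real^'m^'n) *v x) \<le> norm A * norm x * K"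
    using bounded_bilinear.nonneg_bounded[OF bounded_bilinear_matrix_vector_mult[where 'm='m and 'n='n]] by metis
  show thesis
  proof (rule that[of "C * \<rho> * K"])
    fix u :: "real \<Rightarrow> real^'m" assume u: "u \<in> admissible_controls \<rho>"
    have "(\<lambda>t. B t *v u t) \<in> borel_measurable (lebesgue_on {0..})"
      using u B(1) unfolding admissible_controls_def
      by (intro borel_measurable_continuous_Pair[of B _ u "(*v)"]
          bounded_bilinear.continuous_on[OF bounded_bilinear_matrix_vector_mult] continuous_intros) auto
    moreover have "norm (B t *v u t) \<le> C * \<rho> * K" if "0 \<le> t" for t
    proof -
      have "norm (B t *v u t) \<le> norm (B t) * norm (u t) * K" by (rule K)
      also have "\<dots> \<le> C * \<rho> * K"
      proof (intro mult_right_mono mult_mono)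
        show "norm (B t) \<le> C" using B(2)[OF that] .
        show "norm (u t) \<le> \<rho>" using u that by (auto simp: admissible_controls_def control_set_def)
        show "0 \<le> C" using B(2)[OF that] norm_ge_zero order_trans by blast
      qed (use K in auto)
      finally show ?thesis .
    qed
    ultimately show "bounded_force (C * \<rho> * K) (\<lambda>t. B t *v u t)" unfolding bounded_force_def by blast
  qed
qed

text \<open>Changing \<open>B\<close> on a null set does not change the integrals, so trajectories may be described with a version
of \<open>B\<close> that is bounded everywhere.\<close>

lemma trajectories_forced_solution:
  fixes B B' :: "real \<Rightarrow> real^'m^'n"
  assumes p: "p > 1" and T: "0 < T" and N: "negligible N" and eq: "\<And>t. 0 \<le> t \<Longrightarrow> t \<notin> N \<Longrightarrow> B' t = B t"
    and force: "bounded_force M (\<lambda>t. B' t *v u t)" and u: "u \<in> admissible_controls \<rho>"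
  shows "(T, y, u) \<in> trajectories p \<rho> y0 B \<longleftrightarrow>
    y 0 = y0 \<and> (\<forall>b. 0 \<le> b \<longrightarrow> b < T \<longrightarrow> forced_solution p (\<lambda>t. B' t *v u t) b y)"
    (is "?l \<longleftrightarrow> ?r")
proof
  assume l: ?l
  then have c: "continuous_on {0..<T} y"
    and i: "\<And>t. 0 \<le> t \<Longrightarrow> t < T \<Longrightarrow> ((\<lambda>s. (norm (y s) powr (p - 1)) *\<^sub>R y s + B s *v u s) has_integral (y t - y0)) {0..t}"
    unfolding trajectories_def by auto
  have y0: "y 0 = y0" using integral_unique[OF i[of 0]] T by simp
  show ?r
  proof (intro conjI y0 allI impI)
    fix b assume b: "0 \<le> b" "b < T"
    show "forced_solution p (\<lambda>t. B' t *v u t) b y"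
    proof (rule forced_solutionI[OF p force])
      show "continuous_on {0..b} y" using b by (auto intro: continuous_on_subset[OF c])
      fix t assume t: "t \<in> {0..b}"
      show "((\<lambda>s. power_field p (y s) + B' s *v u s) has_integral (y t - y 0)) {0..t}"
        by (rule has_integral_spike[OF N _ i[of t, folded y0]]) (use t b eq in \<open>auto simp: power_field_def\<close>)
    qed
  qed
next
  assume r: ?r
  have "continuous_on {0..<T} y"
    using r by (intro continuous_on_half_open) (auto intro: forced_solution_continuous)
  moreover have "((\<lambda>s. (norm (y s) powr (p - 1)) *\<^sub>R y s + B s *v u s) has_integral (y t - y0)) {0..t}" if t: "t \<in> {0..<T}" for t
  proof (rule has_integral_spike[OF N])
    show "((\<lambda>s. power_field p (y s) + B' s *v u s) has_integral (y t - y0)) {0..t}"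
      using r t bounded_primitive_has_integral[of 0 t _ y 0 t] unfolding forced_solution_def by auto
  qed (use eq t in \<open>auto simp: power_field_def\<close>)
  ultimately show ?l using T u unfolding trajectories_def by auto
qed

lemma admissible_controls_convex:
  assumes "u \<in> admissible_controls \<rho>" "v \<in> admissible_controls \<rho>" "0 \<le> \<theta>" "\<theta> \<le> 1"
  shows "(\<lambda>t. u t + \<theta> *\<^sub>R (v t - u t)) \<in> admissible_controls \<rho>"
proof -
  have "u t + \<theta> *\<^sub>R (v t - u t) \<in> control_set \<rho>" if "t \<ge> 0" for t
  proof -
    have "(1 - \<theta>) *\<^sub>R u t + \<theta> *\<^sub>R v t \<in> cball 0 \<rho>"
      using assms that by (intro convexD_alt[OF convex_cball])
        (auto simp: admissible_controls_def control_set_def)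
    then show ?thesis by (simp add: control_set_def algebra_simps)
  qed
  then show ?thesis using assms unfolding admissible_controls_def
    by (auto intro!: borel_measurable_add borel_measurable_scaleR borel_measurable_diff)
qed

text \<open>The maximizer of \<open>\<langle>\<psi>, B u\<rangle> = \<langle>B^T \<psi>, u\<rangle>\<close> over the ball of radius \<open>\<rho>\<close> before time \<open>s\<close>, and the control \<open>u\<close> afterwards. Where
\<open>B^T \<psi> = 0\<close>, every control is optimal and \<open>sgn 0 = 0\<close> selects 0. Being an explicit formula, it is
measurable without a selection theorem.\<close>

definition maximizing_control ::
    "real \<Rightarrow> real \<Rightarrow> (real \<Rightarrow> real^'n) \<Rightarrow> (real \<Rightarrow> real^'m^'n) \<Rightarrow> (real \<Rightarrow> real^'m) \<Rightarrow> real \<Rightarrow> real^'m" where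
  "maximizing_control \<rho> s \<psi> B u t = (if t < s then \<rho> *\<^sub>R sgn (\<psi> t v* B t) else u t)"

lemma maximizing_control_admissible:
  fixes B :: "real \<Rightarrow> real^'m^'n"
  assumes \<rho>: "0 \<le> \<rho>" and s: "0 \<le> s" and \<psi>: "continuous_on {0..s} \<psi>"
    and B: "B \<in> borel_measurable (lebesgue_on {0..})" and u: "u \<in> admissible_controls \<rho>"
  shows "maximizing_control \<rho> s \<psi> B u \<in> admissible_controls \<rho>"
proof -
  define \<phi> where "\<phi> t = \<psi> (max 0 (min t s))" for t
  have \<phi>c: "continuous_on UNIV \<phi>"
    unfolding \<phi>_def by (intro continuous_on_compose2[OF \<psi>] continuous_intros) (use s in auto)
  have \<phi>m: "\<phi> \<in> borel_measurable (lebesgue_on {0..})"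
    by (intro continuous_imp_measurable_on_sets_lebesgue continuous_on_subset[OF \<phi>c]) auto
  have wm: "(\<lambda>t. \<phi> t v* B t) \<in> borel_measurable (lebesgue_on {0..})"
    by (intro borel_measurable_continuous_Pair[OF \<phi>m B, of "(v*)"]
        bounded_bilinear.continuous_on[OF bounded_bilinear_vector_matrix_mult] continuous_intros)
  have "(\<lambda>t. \<rho> *\<^sub>R sgn (\<phi> t v* B t)) \<in> borel_measurable (lebesgue_on {0..})"
    unfolding sgn_div_norm using wm by measurable
  then have "(\<lambda>t. if t \<in> {..<s} then \<rho> *\<^sub>R sgn (\<phi> t v* B t) else u t) \<in> borel_measurable (lebesgue_on {0..})"
    using u by (intro measurable_If_set) (auto simp: admissible_controls_def sets_restrict_space)
  then have "maximizing_control \<rho> s \<psi> B u \<in> borel_measurable (lebesgue_on {0..})"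
    by (rule measurable_cong[THEN iffD1, rotated]) (auto simp: maximizing_control_def \<phi>_def)
  moreover have "maximizing_control \<rho> s \<psi> B u t \<in> control_set \<rho>" if "t \<ge> 0" for t
    using u that \<rho> by (auto simp: maximizing_control_def control_set_def admissible_controls_def norm_sgn)
  ultimately show ?thesis unfolding admissible_controls_def by blast
qed

lemma pairing_le_maximum:
  fixes A :: "real^'m^'n"
  assumes "norm u \<le> \<rho>"
  shows "\<psi> \<bullet> (A *v u) \<le> \<rho> * norm (\<psi> v* A)"
proof -
  have "\<psi> \<bullet> (A *v u) = (\<psi> v* A) \<bullet> u" by (simp add: dot_lmul_matrix)
  also have "\<dots> \<le> norm (\<psi> v* A) * norm u" by (rule norm_cauchy_schwarz)
  also have "\<dots> \<le> norm (\<psi> v* A) * \<rho>" using assms by (intro mult_left_mono) auto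
  finally show ?thesis by (simp add: mult.commute)
qed

lemma pairing_sgn_eq_maximum: "\<psi> \<bullet> (A *v (\<rho> *\<^sub>R sgn (\<psi> v* A))) = \<rho> * norm (\<psi> v* A)"
  for A :: "real^'m^'n"
proof -
  have "\<psi> \<bullet> (A *v (\<rho> *\<^sub>R sgn (\<psi> v* A))) = (\<psi> v* A) \<bullet> (\<rho> *\<^sub>R sgn (\<psi> v* A))"
    by (simp only: dot_lmul_matrix)
  also have "\<dots> = \<rho> * norm (\<psi> v* A)"
    by (cases "\<psi> v* A = 0") (simp_all add: sgn_div_norm dot_square_norm power2_eq_square)
  finally show ?thesis .
qed

section \<open>The maximum principle\<close>

theorem theorem5p4:
  fixes p \<rho>0 tbar :: real
    and y0 :: "real^'n"
    and B :: "real \<Rightarrow> real^'m^'n"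
    and ybar :: "real \<Rightarrow> real^'n"
    and ubar :: "real \<Rightarrow> real^'m"
  assumes "p > 1"
    and "\<rho>0 > 0"
    and "essentially_bounded_on {0..} B"
    and "optimal_classical_triple p \<rho>0 y0 B (tbar, ybar, ubar)"
  shows "\<exists>\<psi> :: real \<Rightarrow> real^'n.
           adjoint_solution p tbar ybar \<psi> \<and>
           (\<exists>t\<in>{0..<tbar}. \<psi> t \<noteq> 0) \<and>
           (AE t in lebesgue_on {0..<tbar}.
              \<psi> t \<bullet> (B t *v ubar t) = (SUP u\<in>control_set \<rho>0. \<psi> t \<bullet> (B t *v u))) \<and>
           (\<psi> \<longlongrightarrow> 0) (at_left tbar)"
proof -
  note p = assms(1)
  define T where "T = tbar"
  obtain B' C N where B': "B' \<in> borel_measurable (lebesgue_on {0..})" "\<And>t. norm (B' t) \<le> C"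
    and N: "negligible N" "\<And>t. 0 \<le> t \<Longrightarrow> t \<notin> N \<Longrightarrow> B' t = B t"
    using essentially_bounded_version[OF assms(3)] by metis
  obtain M where force: "\<And>u. u \<in> admissible_controls \<rho>0 \<Longrightarrow> bounded_force M (\<lambda>t. B' t *v u t)"
    using control_force_bounded[OF B'(1), of C \<rho>0] B'(2) by metis
  have traj: "(S, z, u) \<in> trajectories p \<rho>0 y0 B \<longleftrightarrow>
      z 0 = y0 \<and> (\<forall>b. 0 \<le> b \<longrightarrow> b < S \<longrightarrow> forced_solution p (\<lambda>t. B' t *v u t) b z)"
    if "0 < S" "u \<in> admissible_controls \<rho>0" for S z u
    by (rule trajectories_forced_solution[OF p that(1) N force[OF that(2)] that(2)])
  have opt: "(T, ybar, ubar) \<in> trajectories p \<rho>0 y0 B"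
    and blowup: "filterlim (\<lambda>t. norm (ybar t)) at_top (at_left T)"
    and inf: "T = Inf {S. \<exists>y u. (S, y, u) \<in> blowup_trajectories p \<rho>0 y0 B}"
    using assms(4) unfolding optimal_classical_triple_def blowup_trajectories_def T_def by auto
  have T: "0 < T" and ub: "ubar \<in> admissible_controls \<rho>0" using opt unfolding trajectories_def by auto
  define g where "g t = B' t *v ubar t" for t
  have y0: "ybar 0 = y0" and y: "\<And>b. 0 \<le> b \<Longrightarrow> b < T \<Longrightarrow> forced_solution p g b ybar"
    using opt traj[OF T ub] unfolding g_def by auto
  have g: "bounded_force M g" unfolding g_def by (rule force[OF ub])
  have M: "0 \<le> M" using g norm_ge_zero order_trans unfolding bounded_force_def by blast
  have global: "\<exists>z. z 0 = y0 \<and> (\<forall>b. 0 \<le> b \<longrightarrow> b < T \<longrightarrow> forced_solution p (\<lambda>t. B' t *v u t) b z)"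
    if u: "u \<in> admissible_controls \<rho>0" for u
  proof -
    have no_blowup: "\<not> filterlim (\<lambda>t. norm (z t)) at_top (at_left S)"
      if S: "0 < S" "S < T" "z 0 = y0" "\<And>b. 0 \<le> b \<Longrightarrow> b < S \<Longrightarrow> forced_solution p (\<lambda>t. B' t *v u t) b z" for S z
    proof
      assume "filterlim (\<lambda>t. norm (z t)) at_top (at_left S)"
      then have "(S, z, u) \<in> blowup_trajectories p \<rho>0 y0 B"
        using traj[OF S(1) u, of z] S(3,4) unfolding blowup_trajectories_def by auto
      moreover have "bdd_below {S. \<exists>y u. (S, y, u) \<in> blowup_trajectories p \<rho>0 y0 B}"
        by (rule bdd_belowI[of _ 0]) (auto simp: blowup_trajectories_def trajectories_def)
      ultimately have "T \<le> S" unfolding inf by (intro cInf_lower) auto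
      then show False using S(2) by simp
    qed
    show ?thesis
      by (rule solution_until_blowup[OF p force[OF u] T no_blowup]) blast+
  qed
  \<comment> \<open>The radius beyond which the forcing is negligible: \<open>R^p \<ge> R \<ge> 2M\<close> for the rate, and \<open>2MT/R \<le> 1/120\<close> for the
  total change of direction until \<open>T\<close>.\<close>
  define R where "R = max 1 (max (2 * M) (240 * M * T))"
  have R: "1 \<le> R" "2 * M \<le> R" "240 * M * T \<le> R" by (auto simp: R_def)
  have R': "0 < R" "2 * M \<le> R powr p" "2 * M / R * T \<le> 1/120"
    using R powr_mono[of 1 p R] p by (auto simp: field_simps)
  have "\<forall>\<^sub>F t in at_left T. R + 1 \<le> norm (ybar t)" using blowup unfolding filterlim_at_top by blast
  then obtain r' where r': "r' < T" "\<And>t. r' < t \<Longrightarrow> t < T \<Longrightarrow> R + 1 \<le> norm (ybar t)"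
    using eventually_at_left[OF T] by auto
  define r where "r = (max r' 0 + T) / 2"
  have r: "0 \<le> r" "r < T" "r' < r" using r' T by (auto simp: r_def)
  have large: "R < norm (ybar t)" if "r \<le> t" "t < T" for t using r'(2)[of t] that r by auto
  define e where "e = sgn (ybar r)"
  have yr: "0 < norm (ybar r)" using large[of r] r R by auto
  have e: "norm e = 1" using yr by (simp add: e_def norm_sgn)
  have ye: "119/120 * norm (ybar t) \<le> ybar t \<bullet> e" if t: "r \<le> t" "t < T" for t
  proof -
    have "ybar r \<bullet> e / norm (ybar r) - 2 * M / R * (t - r) \<le> ybar t \<bullet> e / norm (ybar t)"
      using t r large by (intro large_solution_direction[OF y[of t] g R'(1) e]) (auto intro: less_imp_le)
    moreover have "ybar r \<bullet> e / norm (ybar r) = 1"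
      using yr by (simp add: e_def sgn_div_norm dot_square_norm power2_eq_square)
    moreover have "2 * M / R * (t - r) \<le> 2 * M / R * T"
      using t r M R'(1) by (intro mult_left_mono) auto
    ultimately have "119/120 \<le> ybar t \<bullet> e / norm (ybar t)" using R'(3) by linarith
    moreover have "0 < norm (ybar t)" using large[OF t] R by linarith
    ultimately show ?thesis by (simp only: pos_le_divide_eq)
  qed
  have ye': "39/40 * norm (ybar t) \<le> ybar t \<bullet> e" if "r \<le> t" "t < T" for t
    using ye[OF that] norm_ge_zero[of "ybar t"] by linarith
  have yc: "continuous_on {0..<T} ybar"
    by (rule continuous_on_half_open) (rule forced_solution_continuous[OF y])
  obtain \<psi> where \<psi>: "\<And>b. 0 \<le> b \<Longrightarrow> b < T \<Longrightarrow> adjoint_primitive p ybar b \<psi>" "\<psi> 0 \<noteq> 0"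
    and \<psi>e: "\<And>t. r \<le> t \<Longrightarrow> t < T \<Longrightarrow> 39/40 * norm (\<psi> t) \<le> \<psi> t \<bullet> e"
  proof (rule costate_exists[OF p T yc e r(1,2)])
    show "ybar t \<noteq> 0 \<and> 39/40 * norm (ybar t) \<le> ybar t \<bullet> e" if "r \<le> t" "t < T" for t
      using large[OF that] ye'[OF that] R by auto
  qed blast
  have decay: "((\<lambda>t. norm (\<psi> t) * norm (ybar t)) \<longlongrightarrow> 0) (at_left T)"
    by (rule costate_decay[OF p g r(1,2) y \<psi>(1) blowup])
      (use inner_ge_of_common_cone[OF e \<psi>e ye'] in blast)+
  have limit: "(\<psi> \<longlongrightarrow> 0) (at_left T)"
  proof (rule Lim_null_comparison[OF _ decay])
    have "norm (\<psi> t) \<le> norm (\<psi> t) * norm (ybar t)" if "r < t" "t < T" for t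
      using mult_left_mono[of 1 "norm (ybar t)" "norm (\<psi> t)"] large[of t] R that by auto
    then show "\<forall>\<^sub>F t in at_left T. norm (\<psi> t) \<le> norm (\<psi> t) * norm (ybar t)"
      using r by (auto simp: eventually_at_left[OF r(2)] intro!: exI[of _ r])
  qed
  have null: "negligible {t \<in> {0..<s}. \<psi> t \<bullet> (B' t *v ubar t) \<noteq> \<rho>0 * norm (\<psi> t v* B' t)}"
    if s: "r \<le> s" "s < T" for s
  proof -
    have s0: "0 \<le> s" using s r by simp
    have \<psi>c: "continuous_on {0..s} \<psi>"
      using \<psi>(1)[OF s0 s(2)] unfolding adjoint_primitive_def by (rule bounded_primitive_continuous_on)
    define v where "v = maximizing_control \<rho>0 s \<psi> B' ubar"
    have v: "v \<in> admissible_controls \<rho>0"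
      unfolding v_def using assms(2) by (intro maximizing_control_admissible s0 \<psi>c B'(1) ub) simp
    define k where "k t = B' t *v (v t - ubar t)" for t
    have gk: "g t + \<theta> *\<^sub>R k t = B' t *v (ubar t + \<theta> *\<^sub>R (v t - ubar t))" for \<theta> t
      by (simp add: g_def k_def matrix_vector_right_distrib matrix_vector_mult_scaleR)
    have adm: "(\<lambda>t. ubar t + \<theta> *\<^sub>R (v t - ubar t)) \<in> admissible_controls \<rho>0" if "0 \<le> \<theta>" "\<theta> \<le> 1" for \<theta>
      by (rule admissible_controls_convex[OF ub v that])
    have k0: "k t = 0" if "s \<le> t" for t using that by (simp add: k_def v_def maximizing_control_def)
    have "integral {0..s} (\<lambda>t. \<psi> t \<bullet> k t) \<le> 0"
    proof (rule first_order_condition[OF p _ R' s0 s(2) y _ \<psi> k0 e blowup _ _ decay])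
      show "bounded_force M (\<lambda>t. g t + \<theta> *\<^sub>R k t)" if "0 \<le> \<theta>" "\<theta> \<le> 1" for \<theta>
        unfolding gk by (rule force[OF adm[OF that]])
      show "\<exists>z. z 0 = ybar 0 \<and> (\<forall>b. 0 \<le> b \<longrightarrow> b < T \<longrightarrow> forced_solution p (\<lambda>t. g t + \<theta> *\<^sub>R k t) b z)"
        if "0 \<le> \<theta>" "\<theta> \<le> 1" for \<theta>
        unfolding gk y0 by (rule global[OF adm[OF that]])
    qed (use large ye \<psi>e s in auto)
    \<comment> \<open>The integrand of the first-order condition is the gap in the maximum condition, hence nonnegative.\<close>
    have F: "\<psi> t \<bullet> k t = \<rho>0 * norm (\<psi> t v* B' t) - \<psi> t \<bullet> (B' t *v ubar t)" if "t < s" for t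
      using that pairing_sgn_eq_maximum[of "\<psi> t" "B' t" \<rho>0]
      by (simp add: k_def v_def maximizing_control_def matrix_vector_mult_diff_distrib inner_diff_right)
    have "negligible {t \<in> {0..s}. \<psi> t \<bullet> k t \<noteq> 0}"
    proof (rule negligible_of_integral_le_0[OF _ _ _ \<open>integral {0..s} (\<lambda>t. \<psi> t \<bullet> k t) \<le> 0\<close>])
      have "bounded_force M (\<lambda>t. B' t *v v t)" by (rule force[OF v])
      then have "(\<lambda>t. B' t *v v t - g t) \<in> borel_measurable (lebesgue_on {0..s})"
        by (intro borel_measurable_diff bounded_force_measurable[OF _ order_refl] bounded_force_measurable[OF g order_refl])
      then show "(\<lambda>t. \<psi> t \<bullet> k t) \<in> borel_measurable (lebesgue_on {0..s})"
        unfolding k_def g_def matrix_vector_mult_diff_distrib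
        by (intro borel_measurable_inner continuous_imp_measurable_on_sets_lebesgue[OF \<psi>c]) auto
      fix t assume t: "t \<in> {0..s}"
      have "norm (ubar t) \<le> \<rho>0" using ub t by (auto simp: admissible_controls_def control_set_def)
      then show "0 \<le> \<psi> t \<bullet> k t"
        using F[of t] k0[of t] pairing_le_maximum[of "ubar t" \<rho>0 "\<psi> t" "B' t"] by (cases "t < s") auto
      have "norm (B' t *v v t) \<le> M" "norm (B' t *v ubar t) \<le> M"
        using force[OF v] force[OF ub] t unfolding bounded_force_def by auto
      then have "norm (k t) \<le> 2 * M"
        unfolding k_def matrix_vector_mult_diff_distrib
        using norm_triangle_ineq4[of "B' t *v v t" "B' t *v ubar t"] by linarith
      then have "norm (\<psi> t) * norm (k t) \<le> norm (\<psi> 0) * (2 * M)"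
        using adjoint_primitive_norm_le[OF p \<psi>(1)[OF s0 s(2)] t] by (intro mult_mono) auto
      then show "\<psi> t \<bullet> k t \<le> norm (\<psi> 0) * (2 * M)" using norm_cauchy_schwarz[of "\<psi> t" "k t"] by linarith
    qed
    then show ?thesis by (rule negligible_subset) (use F in auto)
  qed
  \<comment> \<open>The first-order condition is available for each perturbation time \<open>s < T\<close>; countably many of them exhaust \<open>[0,T)\<close>.\<close>
  define s where "s n = T - (T - r) / real (Suc n)" for n
  have s: "r \<le> s n" "s n < T" for n
  proof -
    have "(T - r) / real (Suc n) \<le> (T - r) / 1" using r by (intro divide_left_mono) auto
    moreover have "0 < (T - r) / real (Suc n)" using r by simp
    ultimately show "r \<le> s n" "s n < T" by (simp_all add: s_def)
  qed
  have cover: "\<exists>n. t < s n" if "t < T" for t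
  proof -
    have "0 < (T - t) / (T - r)" using that r by (intro divide_pos_pos) auto
    then obtain n where "inverse (real (Suc n)) < (T - t) / (T - r)"
      using reals_Archimedean by blast
    then have "inverse (real (Suc n)) * (T - r) < T - t" using r by (simp only: pos_less_divide_eq diff_gt_0_iff_gt)
    then have "t < s n" by (simp add: s_def divide_inverse mult.commute)
    then show ?thesis ..
  qed
  define Z where "Z = N \<union> (\<Union>n. {t \<in> {0..<s n}. \<psi> t \<bullet> (B' t *v ubar t) \<noteq> \<rho>0 * norm (\<psi> t v* B' t)})"
  have "negligible Z" unfolding Z_def by (intro negligible_Un N(1) negligible_countable_Union) (use null s in auto)
  then have "AE t in lebesgue_on {0..<T}.
      \<psi> t \<bullet> (B t *v ubar t) = (SUP u\<in>control_set \<rho>0. \<psi> t \<bullet> (B t *v u))"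
  proof (rule AE_lebesgue_on_negligibleI)
    fix t assume t: "t \<in> {0..<T}" "t \<notin> Z"
    have BB: "B' t = B t" using N(2) t by (auto simp: Z_def)
    have max: "\<psi> t \<bullet> (B t *v ubar t) = \<rho>0 * norm (\<psi> t v* B t)"
      using t cover[of t] unfolding Z_def BB[symmetric] by auto
    show "\<psi> t \<bullet> (B t *v ubar t) = (SUP u\<in>control_set \<rho>0. \<psi> t \<bullet> (B t *v u))"
    proof (rule cSup_eq_maximum[symmetric])
      show "\<psi> t \<bullet> (B t *v ubar t) \<in> (\<lambda>u. \<psi> t \<bullet> (B t *v u)) ` control_set \<rho>0"
        using ub t by (auto simp: admissible_controls_def)
      show "x \<le> \<psi> t \<bullet> (B t *v ubar t)" if "x \<in> (\<lambda>u. \<psi> t \<bullet> (B t *v u)) ` control_set \<rho>0" for x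
        using that pairing_le_maximum unfolding max control_set_def by auto
    qed
  qed simp
  moreover have "adjoint_solution p T ybar \<psi>"
    by (rule adjoint_solution_of_primitives[OF p yc \<psi>(1)])
  moreover have "\<exists>t\<in>{0..<T}. \<psi> t \<noteq> 0" using \<psi>(2) T by (intro bexI[of _ 0]) auto
  ultimately show ?thesis using limit unfolding T_def by blast
qed

end
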